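(* Fair Bisection is W[1]-hard when parameterized by the number of colors $c$, even when restricted to instances with $k=0$.
   Context: An edge cut of a graph $G$ is a pair $(A,B)$ with $A\cup B=V(G)$ and $A\cap B=\emptyset$; its order is the number of edges with one endpoint in $A$ and the other in $B$. Fair Bisection: given an unweighted undirected graph $G$, nonnegative integer $k$ (cut size), positive integer $c$, a coloring $\chi:V(G)\to[c]$, and a tuple $r^\circ=(r_1,\dots,r_c)$ of positive integers, decide whether there is an edge cut $(A,B)$ of $G$ of order at most $k$ such that $A$ contains exactly $r_i$ vertices of color $i$ for every $i\in[c]$. *)

theory Defs
  imports Main
begin

section \<open>Random access machines\<close>

text \<open>
  Computations are those of a random access machine whose memory cells hold natural numbers. The
  only arithmetic operations are addition and truncated subtraction, so that the uniform cost
  measure (every instruction and every test costs one step) is polynomially related to Turing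
  machine time. Programs have structured control flow instead of jumps.
\<close>

type_synonym memory = "nat \<Rightarrow> nat"

datatype prog =
    Skip
  | Const nat nat        \<comment> \<open>\<open>M[r] := n\<close>\<close>
  | Add nat nat nat      \<comment> \<open>\<open>M[r] := M[a] + M[b]\<close>\<close>
  | Sub nat nat nat      \<comment> \<open>\<open>M[r] := M[a] - M[b]\<close>, truncated at \<open>0\<close>\<close>
  | Load nat nat         \<comment> \<open>\<open>M[r] := M[M[a]]\<close>\<close>
  | Store nat nat        \<comment> \<open>\<open>M[M[a]] := M[r]\<close>\<close>
  | Seq prog prog
  | Cond nat prog prog   \<comment> \<open>tests \<open>M[r] \<noteq> 0\<close>\<close>
  | While nat prog       \<comment> \<open>tests \<open>M[r] \<noteq> 0\<close>\<close>

text \<open>\<open>exec p s t s'\<close>: started in memory \<open>s\<close>, program \<open>p\<close> halts after exactly \<open>t\<close> steps in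
  memory \<open>s'\<close>.\<close>

inductive exec :: "prog \<Rightarrow> memory \<Rightarrow> nat \<Rightarrow> memory \<Rightarrow> bool" where
  exec_Skip: "exec Skip s 1 s"
| exec_Const: "exec (Const r n) s 1 (s(r := n))"
| exec_Add: "exec (Add r a b) s 1 (s(r := s a + s b))"
| exec_Sub: "exec (Sub r a b) s 1 (s(r := s a - s b))"
| exec_Load: "exec (Load r a) s 1 (s(r := s (s a)))"
| exec_Store: "exec (Store a r) s 1 (s(s a := s r))"
| exec_Seq: "exec p s t s' \<Longrightarrow> exec q s' t' s'' \<Longrightarrow> exec (Seq p q) s (t + t') s''"
| exec_Cond_True: "s r \<noteq> 0 \<Longrightarrow> exec p s t s' \<Longrightarrow> exec (Cond r p q) s (t + 1) s'"
| exec_Cond_False: "s r = 0 \<Longrightarrow> exec q s t s' \<Longrightarrow> exec (Cond r p q) s (t + 1) s'"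
| exec_While_False: "s r = 0 \<Longrightarrow> exec (While r p) s 1 s"
| exec_While_True:
    "s r \<noteq> 0 \<Longrightarrow> exec p s t s' \<Longrightarrow> exec (While r p) s' t' s'' \<Longrightarrow>
     exec (While r p) s (t + t' + 1) s''"

type_synonym word = "bool list"

text \<open>Input and output consist of a word and a number. Letters are stored as \<open>1\<close> and \<open>2\<close> and a
  word ends at the first blank cell \<open>0\<close>; hence a word written in \<open>t\<close> steps on input \<open>x\<close> has
  length at most \<open>length x + t\<close>.\<close>

definition letter_code :: "bool \<Rightarrow> nat" where
  "letter_code b = (if b then 2 else 1)"

definition input_memory :: "word \<Rightarrow> nat \<Rightarrow> memory" where
  "input_memory x k =
     (\<lambda>i. if i = 0 then k else if i \<le> length x then letter_code (x ! (i - 1)) else 0)"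

definition is_output :: "memory \<Rightarrow> word \<Rightarrow> nat \<Rightarrow> bool" where
  "is_output s x k \<longleftrightarrow>
     s 0 = k \<and> (\<forall>i < length x. s (Suc i) = letter_code (x ! i)) \<and> s (Suc (length x)) = 0"

definition computable :: "(nat \<Rightarrow> nat) \<Rightarrow> bool" where
  "computable f \<longleftrightarrow> (\<exists>p. \<forall>n. \<exists>t s. exec p (input_memory [] n) t s \<and> s 0 = f n)"

section \<open>Parameterized problems and reductions\<close>

text \<open>A parameterized problem is given by its set of instances, each a word together with its
  parameter, and the yes-instances among them. Restricting a problem to a class of instances
  restricts \<open>insts\<close>. A reduction has to produce instances of the target problem, so a reduction
  to a restricted problem only produces instances of the restricted form.\<close>

record param_problem =
  insts :: "(word \<times> nat) set"
  yes :: "(word \<times> nat) set"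

definition fpt_reducible :: "param_problem \<Rightarrow> param_problem \<Rightarrow> bool" where
  "fpt_reducible P Q \<longleftrightarrow>
     (\<exists>p f g e. computable f \<and> computable g \<and>
        (\<forall>(x, k) \<in> insts P. \<exists>t s x' k'.
           exec p (input_memory x k) t s \<and> t \<le> f k * (length x + 1) ^ e \<and> is_output s x' k' \<and>
           (x', k') \<in> insts Q \<and> k' \<le> g k \<and> ((x, k) \<in> yes P \<longleftrightarrow> (x', k') \<in> yes Q)))"

text \<open>Binary representation (least significant bit first), made self-delimiting by putting
  \<open>True\<close> in front of every bit and \<open>False\<close> at the end. Lists of numbers are encoded by
  concatenation.\<close>

fun bits :: "nat \<Rightarrow> bool list" where
  "bits n = (if n = 0 then [] else odd n # bits (n div 2))"

declare bits.simps [simp del]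

definition encode_nat :: "nat \<Rightarrow> word" where
  "encode_nat n = concat (map (\<lambda>b. [True, b]) (bits n)) @ [False]"

definition encode_nats :: "nat list \<Rightarrow> word" where
  "encode_nats ns = concat (map encode_nat ns)"

section \<open>Boolean circuits and the W-hierarchy\<close>

datatype gate = Input | Neg nat | Conj "nat list" | Disj "nat list"

fun preds :: "gate \<Rightarrow> nat list" where
  "preds Input = []"
| "preds (Neg j) = [j]"
| "preds (Conj js) = js"
| "preds (Disj js) = js"

text \<open>A circuit is an acyclic digraph of gates listed in a topological order; gates refer to
  their in-neighbours by position, and the output is the last gate.\<close>

type_synonym circuit = "gate list"

definition circuit :: "circuit \<Rightarrow> bool" where
  "circuit C \<longleftrightarrow> C \<noteq> [] \<and>
     (\<forall>i < length C. (\<forall>j \<in> set (preds (C ! i)). j < i) \<and> distinct (preds (C ! i)) \<and>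
        (case C ! i of Input \<Rightarrow> True | Neg j \<Rightarrow> True
         | Conj js \<Rightarrow> length js \<ge> 2 | Disj js \<Rightarrow> length js \<ge> 2))"

definition input_gates :: "circuit \<Rightarrow> nat set" where
  "input_gates C = {i. i < length C \<and> C ! i = Input}"

fun gate_holds :: "(nat \<Rightarrow> bool) \<Rightarrow> nat \<Rightarrow> gate \<Rightarrow> bool" where
  "gate_holds v i Input \<longleftrightarrow> v i"
| "gate_holds v i (Neg j) \<longleftrightarrow> \<not> v j"
| "gate_holds v i (Conj js) \<longleftrightarrow> (\<forall>j \<in> set js. v j)"
| "gate_holds v i (Disj js) \<longleftrightarrow> (\<exists>j \<in> set js. v j)"

text \<open>The values at the input gates determine a valuation uniquely on the gates of a circuit.\<close>

definition valuation :: "circuit \<Rightarrow> (nat \<Rightarrow> bool) \<Rightarrow> bool" where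
  "valuation C v \<longleftrightarrow> (\<forall>i < length C. v i \<longleftrightarrow> gate_holds v i (C ! i))"

definition weighted_satisfiable :: "circuit \<Rightarrow> nat \<Rightarrow> bool" where
  "weighted_satisfiable C k \<longleftrightarrow>
     (\<exists>v. valuation C v \<and> card {i \<in> input_gates C. v i} = k \<and> v (length C - 1))"

text \<open>Paths from an input gate to the output gate, as lists of positions.\<close>

definition io_path :: "circuit \<Rightarrow> nat list \<Rightarrow> bool" where
  "io_path C ps \<longleftrightarrow> ps \<noteq> [] \<and> hd ps \<in> input_gates C \<and> last ps = length C - 1 \<and>
     set ps \<subseteq> {..<length C} \<and>
     (\<forall>i. Suc i < length ps \<longrightarrow> ps ! i \<in> set (preds (C ! (ps ! Suc i))))"

text \<open>Depth counts the wires on a path, weft counts the large gates, i.e. those of in-degree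
  greater than \<open>2\<close>.\<close>

definition depth_at_most :: "nat \<Rightarrow> circuit \<Rightarrow> bool" where
  "depth_at_most d C \<longleftrightarrow> (\<forall>ps. io_path C ps \<longrightarrow> length ps - 1 \<le> d)"

definition weft_at_most :: "nat \<Rightarrow> circuit \<Rightarrow> bool" where
  "weft_at_most t C \<longleftrightarrow>
     (\<forall>ps. io_path C ps \<longrightarrow> length (filter (\<lambda>i. length (preds (C ! i)) > 2) ps) \<le> t)"

fun encode_gate :: "gate \<Rightarrow> nat list" where
  "encode_gate Input = [0]"
| "encode_gate (Neg j) = [1, j]"
| "encode_gate (Conj js) = [2, length js] @ js"
| "encode_gate (Disj js) = [3, length js] @ js"

definition encode_circuit :: "circuit \<Rightarrow> word" where
  "encode_circuit C = encode_nats (concat (map encode_gate C))"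

text \<open>Weighted circuit satisfiability for circuits of weft at most \<open>t\<close> and depth at most \<open>d\<close>,
  parameterized by the weight of the assignment.\<close>

definition weighted_circuit_sat :: "nat \<Rightarrow> nat \<Rightarrow> param_problem" where
  "weighted_circuit_sat t d =
     \<lparr> insts = {(encode_circuit C, k) | C k. circuit C \<and> weft_at_most t C \<and> depth_at_most d C},
       yes = {(encode_circuit C, k) | C k. circuit C \<and> weft_at_most t C \<and> depth_at_most d C \<and>
                weighted_satisfiable C k} \<rparr>"

definition W_class :: "nat \<Rightarrow> param_problem set" where
  "W_class t = {P. \<exists>d \<ge> 1. fpt_reducible P (weighted_circuit_sat t d)}"

definition W1_hard :: "param_problem \<Rightarrow> bool" where
  "W1_hard Q \<longleftrightarrow> (\<forall>P \<in> W_class 1. fpt_reducible P Q)"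

section \<open>Fair bisection\<close>

definition edge_cut :: "'v set \<Rightarrow> 'v set \<Rightarrow> 'v set \<Rightarrow> bool" where
  "edge_cut V A B \<longleftrightarrow> A \<union> B = V \<and> A \<inter> B = {}"

definition cut_order :: "'v set set \<Rightarrow> 'v set \<Rightarrow> 'v set \<Rightarrow> nat" where
  "cut_order E A B = card {e \<in> E. \<exists>a \<in> A. \<exists>b \<in> B. e = {a, b}}"

definition has_fair_bisection ::
  "'v set \<Rightarrow> 'v set set \<Rightarrow> nat \<Rightarrow> nat \<Rightarrow> ('v \<Rightarrow> nat) \<Rightarrow> (nat \<Rightarrow> nat) \<Rightarrow> bool" where
  "has_fair_bisection V E k c \<chi> r \<longleftrightarrow>
     (\<exists>A B. edge_cut V A B \<and> cut_order E A B \<le> k \<and>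
        (\<forall>i \<in> {1..c}. card {v \<in> A. \<chi> v = i} = r i))"

text \<open>The graph of an instance has the vertices \<open>0, \<dots>, nverts - 1\<close>.\<close>

record fb_instance =
  nverts :: nat
  edges :: "(nat \<times> nat) list"
  cut_size :: nat
  ncolors :: nat
  color :: "nat \<Rightarrow> nat"
  target :: "nat \<Rightarrow> nat"

definition fb_valid :: "fb_instance \<Rightarrow> bool" where
  "fb_valid I \<longleftrightarrow>
     distinct (edges I) \<and> (\<forall>(u, v) \<in> set (edges I). u < v \<and> v < nverts I) \<and>
     ncolors I \<ge> 1 \<and> (\<forall>v < nverts I. color I v \<in> {1..ncolors I}) \<and>
     (\<forall>i \<in> {1..ncolors I}. target I i \<ge> 1)"

definition fb_yes :: "fb_instance \<Rightarrow> bool" where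
  "fb_yes I \<longleftrightarrow>
     has_fair_bisection {..<nverts I} {{u, v} | u v. (u, v) \<in> set (edges I)}
       (cut_size I) (ncolors I) (color I) (target I)"

text \<open>The number of colors needs no place in the word, since it is the parameter.\<close>

definition encode_fb :: "fb_instance \<Rightarrow> word" where
  "encode_fb I = encode_nats
     ([nverts I, cut_size I] @ map (color I) [0..<nverts I] @ map (target I) [1..<Suc (ncolors I)] @
      concat (map (\<lambda>(u, v). [u, v]) (edges I)))"

text \<open>Fair Bisection, parameterized by the number of colors, restricted to the instances in
  \<open>X\<close>.\<close>

definition fair_bisection :: "fb_instance set \<Rightarrow> param_problem" where
  "fair_bisection X =
     \<lparr> insts = {(encode_fb I, ncolors I) | I. I \<in> X \<and> fb_valid I},
       yes = {(encode_fb I, ncolors I) | I. I \<in> X \<and> fb_valid I \<and> fb_yes I} \<rparr>"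

end

theory Submission
  imports Defs
begin

text \<open>
  With cut size \<open>0\<close>, every component of the graph lies on one side, so that Fair Bisection asks for a
  selection of components whose colour counts add up to the target: a subset sum problem for vectors
  of polynomially bounded numbers, parameterized by the dimension.

  Weighted satisfiability of a circuit of weft \<open>1\<close> and depth \<open>d\<close> reduces to this problem as follows.
  The output is determined by the numbers of true predecessors of at most \<open>2\<^sup>d\<close> large gates. A
  predecessor of a large gate depends on at most \<open>2\<^sup>d\<close> input gates, so these numbers, packed into a
  single number \<open>\<Phi>(S)\<close>, are a polynomial of degree at most \<open>q\<close> in the chosen set \<open>S\<close> of inputs: by
  Moebius inversion, \<open>\<Phi>(S)\<close> is the sum of weights \<open>\<mu>(U)\<close> over the \<open>U \<subseteq> S\<close> with at most \<open>q\<close> elements.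
  If \<open>S = {v\<^sub>1 < \<dots> < v\<^sub>k}\<close>, then for each of the \<open>k\<^sup>q\<close> tuples of indices one component is
  chosen, which stands for the tuple of inputs with these indices and contributes the weight of this
  tuple to one coordinate. Coordinates in which a gate \<open>t\<close> meets its complement \<open>\<beta> - t\<close> force the
  choices to be consistent, and one further component guesses a value of \<open>\<Phi>(S)\<close> for which the
  circuit accepts.
\<close>


section \<open>Weakest preconditions\<close>

text \<open>Moebius weights may be negative while colour counts may not, so every tuple item also
  carries the offset \<open>offA\<close>; as exactly \<open>k ^ q\<close> tuple items are selected,
  the offsets add up to a known number. The value of \<open>Phi\<close> varies with the selection
  but the target does not, hence a guess \<open>b\<close> contributes the complement
  \<open>bet ^ q - b\<close>. The number of colours may depend on \<open>k\<close> and
  \<open>d\<close> only, so no gate can have a coordinate of its own: gates have to be compared as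
  numbers.

  W[1] is itself defined by reducibility, so the reduction is run after an arbitrary one. It starts
  in a memory of which nothing but the word and its parameter is known, and in which the word
  occupies the cells that a program would like to use as registers. Once the word is moved away, all
  loops are bounded by a single number \<open>N\<close>, a fixed power of
  \<open>k + length x + 2\<close>. The functions whose names end in \<open>A\<close> read the word
  in the array \<open>A\<close>; they are total, and agree with the intended functions when
  \<open>N\<close> is large enough.\<close>

text \<open>The second argument of the postcondition is a clock, which starts at \<open>t\<close>.\<close>

definition wp :: "prog \<Rightarrow> (memory \<Rightarrow> nat \<Rightarrow> bool) \<Rightarrow> memory \<Rightarrow> nat \<Rightarrow> bool" where
  "wp p Q s t \<longleftrightarrow> (\<exists>t' s'. exec p s t' s' \<and> Q s' (t + t'))"

inductive_cases exec_primE: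
  "exec Skip s t s'" "exec (Const r n) s t s'" "exec (Add r a b) s t s'" "exec (Sub r a b) s t s'"
  "exec (Load r a) s t s'" "exec (Store a r) s t s'"
inductive_cases exec_SeqE: "exec (Seq p q) s t s'"
inductive_cases exec_CondE: "exec (Cond r p q) s t s'"

lemma wp_prim [simp]:
  "wp Skip Q s t = Q s (Suc t)"
  "wp (Const r n) Q s t = Q (s(r := n)) (Suc t)"
  "wp (Add r a b) Q s t = Q (s(r := s a + s b)) (Suc t)"
  "wp (Sub r a b) Q s t = Q (s(r := s a - s b)) (Suc t)"
  "wp (Load r a) Q s t = Q (s(r := s (s a))) (Suc t)"
  "wp (Store a r) Q s t = Q (s(s a := s r)) (Suc t)"
  unfolding wp_def
  by (metis exec_primE(1) exec_Skip Suc_eq_plus1, metis exec_primE(2) exec_Const Suc_eq_plus1,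
      metis exec_primE(3) exec_Add Suc_eq_plus1, metis exec_primE(4) exec_Sub Suc_eq_plus1,
      metis exec_primE(5) exec_Load Suc_eq_plus1, metis exec_primE(6) exec_Store Suc_eq_plus1)

lemma wp_Seq [simp]: "wp (Seq p q) Q s t = wp p (wp q Q) s t"
proof
  assume "wp (Seq p q) Q s t"
  then show "wp p (wp q Q) s t"
    unfolding wp_def by (metis exec_SeqE add.assoc)
next
  assume "wp p (wp q Q) s t"
  then show "wp (Seq p q) Q s t"
    unfolding wp_def by (metis exec_Seq add.assoc)
qed

lemma wp_Cond [simp]:
  "wp (Cond r p q) Q s t = (if s r \<noteq> 0 then wp p Q s (Suc t) else wp q Q s (Suc t))"
proof (cases "s r = 0")
  case True
  then have "exec (Cond r p q) s u s' \<longleftrightarrow> (\<exists>v. u = v + 1 \<and> exec q s v s')" for u s'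
    by (auto elim: exec_CondE intro: exec_Cond_False[unfolded Suc_eq_plus1[symmetric]])
  with True show ?thesis
    unfolding wp_def by (metis add_Suc_right add_Suc Suc_eq_plus1)
next
  case False
  then have "exec (Cond r p q) s u s' \<longleftrightarrow> (\<exists>v. u = v + 1 \<and> exec p s v s')" for u s'
    by (auto elim: exec_CondE intro: exec_Cond_True[unfolded Suc_eq_plus1[symmetric]])
  with False show ?thesis
    unfolding wp_def by (metis add_Suc_right add_Suc Suc_eq_plus1)
qed

lemma wp_mono: "wp p Q s t \<Longrightarrow> (\<And>s' t'. Q s' t' \<Longrightarrow> Q' s' t') \<Longrightarrow> wp p Q' s t"
  unfolding wp_def by blast

lemma wp_While_unfold:
  assumes "s r \<noteq> 0" "wp p (wp (While r p) Q) s (Suc t)"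
  shows "wp (While r p) Q s t"
proof -
  from assms(2) obtain t1 s1 t2 s2 where "exec p s t1 s1" "exec (While r p) s1 t2 s2"
    "Q s2 (Suc t + t1 + t2)"
    unfolding wp_def by blast
  moreover from this have "exec (While r p) s (t1 + t2 + 1) s2"
    using assms(1) by (blast intro: exec_While_True)
  moreover have "Suc t + t1 + t2 = t + (t1 + t2 + 1)"
    by simp
  ultimately show ?thesis
    unfolding wp_def by metis
qed

text \<open>\<open>P n\<close> is the invariant with exactly \<open>n\<close> rounds to go, so that
  the rule yields termination together with a running time, which \<open>P\<close> can record
  through the clock.\<close>

lemma wp_While:
  assumes "P n s t"
    and step: "\<And>n s t. P (Suc n) s t \<Longrightarrow> s r \<noteq> 0 \<and> wp p (P n) s (Suc t)"
    and stop: "\<And>s t. P 0 s t \<Longrightarrow> s r = 0 \<and> Q s (Suc t)"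
  shows "wp (While r p) Q s t"
  using assms(1)
proof (induction n arbitrary: s t)
  case 0
  then show ?case
    using stop[OF 0] exec_While_False[of s r p] unfolding wp_def by (metis Suc_eq_plus1)
next
  case (Suc n)
  then show ?case
    using step[OF Suc.prems] wp_While_unfold wp_mono[of p "P n" s "Suc t" "wp (While r p) Q"] Suc.IH
    by simp
qed

section \<open>Polynomially bounded functions\<close>

text \<open>One constant serves as factor and as exponent; by \<open>poly_bdI\<close> this is no
  restriction.\<close>

definition poly_bd :: "(nat \<Rightarrow> nat) \<Rightarrow> bool" where
  "poly_bd T \<longleftrightarrow> (\<exists>c. \<forall>N. T N \<le> c * (N + 1) ^ c)"

lemma poly_bdI: "(\<And>N. T N \<le> a * (N + 1) ^ b) \<Longrightarrow> poly_bd T"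
proof -
  assume *: "\<And>N. T N \<le> a * (N + 1) ^ b"
  have "T N \<le> (a + b) * (N + 1) ^ (a + b)" for N
    by (rule order_trans[OF *]) (intro mult_le_mono power_increasing le_add1 le_add2)
  then show ?thesis unfolding poly_bd_def by blast
qed

lemma poly_bd_const: "poly_bd (\<lambda>_. c)"
  by (rule poly_bdI[of _ c 0]) simp

lemma poly_bd_id: "poly_bd (\<lambda>N. N)"
  by (rule poly_bdI[of _ 1 1]) simp

lemma poly_bd_add:
  assumes "poly_bd S" "poly_bd T"
  shows "poly_bd (\<lambda>N. S N + T N)"
proof -
  from assms obtain a b where a: "\<And>N. S N \<le> a * (N + 1) ^ a" and b: "\<And>N. T N \<le> b * (N + 1) ^ b"
    unfolding poly_bd_def by blast
  show ?thesis
  proof (rule poly_bdI)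
    fix N
    have "S N \<le> a * (N + 1) ^ (a + b)"
      by (rule order_trans[OF a]) (intro mult_le_mono power_increasing order_refl le_add1 le_add2)
    moreover have "T N \<le> b * (N + 1) ^ (a + b)"
      by (rule order_trans[OF b]) (intro mult_le_mono power_increasing order_refl le_add2)
    ultimately show "S N + T N \<le> (a + b) * (N + 1) ^ (a + b)"
      by (simp add: add_mult_distrib)
  qed
qed

lemma poly_bd_mult:
  assumes "poly_bd S" "poly_bd T"
  shows "poly_bd (\<lambda>N. S N * T N)"
proof -
  from assms obtain a b where a: "\<And>N. S N \<le> a * (N + 1) ^ a" and b: "\<And>N. T N \<le> b * (N + 1) ^ b"
    unfolding poly_bd_def by blast
  show ?thesis
  proof (rule poly_bdI)
    fix N
    have "S N * T N \<le> (a * (N + 1) ^ a) * (b * (N + 1) ^ b)"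
      by (rule mult_mono[OF a b]) simp_all
    then show "S N * T N \<le> (a * b) * (N + 1) ^ (a + b)"
      by (simp add: power_add algebra_simps)
  qed
qed

lemma poly_bd_power: "poly_bd T \<Longrightarrow> poly_bd (\<lambda>N. T N ^ m)"
  by (induction m) (auto intro: poly_bd_const poly_bd_mult)

lemmas poly_bd_intros = poly_bd_const poly_bd_id poly_bd_add poly_bd_mult poly_bd_power

section \<open>Functions computable in polynomial time relative to a loop bound\<close>

text \<open>Cell \<open>0\<close> holds the loop bound \<open>N\<close>, cell \<open>1\<close> the address \<open>D\<close> at which the data begin. The
  cells \<open>D, D + 2, \<dots>\<close> form the input array, the cells in between are left for the output, and the
  cells below \<open>D\<close> serve as registers. Variable \<open>i\<close> is kept in register \<open>\<rho> i\<close>, and only registers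
  from \<open>b\<close> on may be changed. Every loop makes exactly \<open>N\<close> rounds, so that the running time is
  polynomial in \<open>N\<close> whatever the values computed. As multiplication is a loop, products are only
  available in the form \<open>min N x * y\<close>.\<close>

definition data :: "memory \<Rightarrow> nat \<Rightarrow> nat" where
  "data s i = s (s 1 + 2 * i)"

definition cmp_post :: "((nat \<Rightarrow> nat) \<Rightarrow> (nat \<Rightarrow> nat) \<Rightarrow> nat) \<Rightarrow> (nat \<Rightarrow> nat) \<Rightarrow> nat \<Rightarrow>
    (nat \<Rightarrow> nat) \<Rightarrow> memory \<Rightarrow> nat \<Rightarrow> memory \<Rightarrow> nat \<Rightarrow> bool" where
  "cmp_post f \<rho> b T s t s' t' \<longleftrightarrow> s' b = f (data s) (s \<circ> \<rho>) \<and> (\<forall>i. i < b \<or> s 1 \<le> i \<longrightarrow> s' i = s i) \<and>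
     t' \<le> t + T (s 0)"

text \<open>A program is required for every placement \<open>\<rho>\<close> of the variables and
  every first free register \<open>b\<close>; this is what makes renaming and sequential composition
  possible. Variable \<open>0\<close> is always the loop bound, and \<open>R\<close> asks that the
  data begin far enough to the right.\<close>

definition cmp :: "nat \<Rightarrow> ((nat \<Rightarrow> nat) \<Rightarrow> (nat \<Rightarrow> nat) \<Rightarrow> nat) \<Rightarrow> bool" where
  "cmp n f \<longleftrightarrow> (\<forall>A s s'. (\<forall>i<n. s i = s' i) \<longrightarrow> f A s = f A s') \<and>
     (\<forall>\<rho> b. \<rho> 0 = 0 \<and> 1 < b \<and> (\<forall>i<n. \<rho> i < b) \<longrightarrow>
        (\<exists>p R T. poly_bd T \<and> (\<forall>s t. R \<le> s 1 \<longrightarrow> wp p (cmp_post f \<rho> b T s t) s t)))"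

lemma cmp_cong: "cmp n f \<Longrightarrow> (\<And>i. i < n \<Longrightarrow> s i = s' i) \<Longrightarrow> f A s = f A s'"
  unfolding cmp_def by blast

lemma cmp_upd [simp]: "cmp n f \<Longrightarrow> n \<le> m \<Longrightarrow> f A (s(m := x)) = f A s"
  using cmp_cong[of n f "s(m := x)" s A] by simp

lemma cmpE:
  assumes "cmp n f" "\<rho> 0 = 0" "1 < b" "\<And>i. i < n \<Longrightarrow> \<rho> i < b"
  obtains p R T where "poly_bd T" "\<And>s t. R \<le> s 1 \<Longrightarrow> wp p (cmp_post f \<rho> b T s t) s t"
  using assms unfolding cmp_def by blast

lemma cmpI:
  assumes "\<And>A s s'. (\<And>i. i < n \<Longrightarrow> s i = s' i) \<Longrightarrow> f A s = f A s'"
    and "\<And>\<rho> b. \<rho> 0 = 0 \<Longrightarrow> 1 < b \<Longrightarrow> (\<And>i. i < n \<Longrightarrow> \<rho> i < b) \<Longrightarrow>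
      \<exists>p R T. poly_bd T \<and> (\<forall>s t. R \<le> s 1 \<longrightarrow> wp p (cmp_post f \<rho> b T s t) s t)"
  shows "cmp n f"
  using assms unfolding cmp_def by blast

lemma cmp_weaken: "cmp n f \<Longrightarrow> n \<le> m \<Longrightarrow> cmp m f"
  unfolding cmp_def using less_le_trans[of _ n m] by auto

lemma data_eq: "s' 1 = s 1 \<Longrightarrow> (\<And>i. s 1 \<le> i \<Longrightarrow> s' i = s i) \<Longrightarrow> data s' = data s"
  by (auto simp: data_def)

section \<open>Single instructions as computable functions\<close>

lemma cmp_const: "cmp n (\<lambda>A s. c)"
proof (rule cmpI)
  fix \<rho> :: "nat \<Rightarrow> nat" and b :: nat
  show "\<exists>p R T. poly_bd T \<and> (\<forall>s t. R \<le> s 1 \<longrightarrow> wp p (cmp_post (\<lambda>A s. c) \<rho> b T s t) s t)"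
    by (rule exI[of _ "Const b c"], rule exI[of _ "Suc b"], rule exI[of _ "\<lambda>_. 1"])
      (auto simp: cmp_post_def poly_bd_const)
qed simp

lemma cmp_add_var:
  assumes "i < n" "j < n"
  shows "cmp n (\<lambda>A s. s i + s j)"
proof (rule cmpI)
  fix \<rho> :: "nat \<Rightarrow> nat" and b :: nat
  show "\<exists>p R T. poly_bd T \<and> (\<forall>s t. R \<le> s 1 \<longrightarrow> wp p (cmp_post (\<lambda>A s. s i + s j) \<rho> b T s t) s t)"
    by (rule exI[of _ "Add b (\<rho> i) (\<rho> j)"], rule exI[of _ "Suc b"], rule exI[of _ "\<lambda>_. 1"])
      (auto simp: cmp_post_def poly_bd_const)
qed (use assms in simp)

lemma cmp_sub_var:
  assumes "i < n" "j < n"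
  shows "cmp n (\<lambda>A s. s i - s j)"
proof (rule cmpI)
  fix \<rho> :: "nat \<Rightarrow> nat" and b :: nat
  show "\<exists>p R T. poly_bd T \<and> (\<forall>s t. R \<le> s 1 \<longrightarrow> wp p (cmp_post (\<lambda>A s. s i - s j) \<rho> b T s t) s t)"
    by (rule exI[of _ "Sub b (\<rho> i) (\<rho> j)"], rule exI[of _ "Suc b"], rule exI[of _ "\<lambda>_. 1"])
      (auto simp: cmp_post_def poly_bd_const)
qed (use assms in simp)

lemma cmp_load_var:
  assumes "i < n"
  shows "cmp n (\<lambda>A s. A (s i))"
proof (rule cmpI)
  fix \<rho> :: "nat \<Rightarrow> nat" and b :: nat
  assume "1 < b" "\<And>i. i < n \<Longrightarrow> \<rho> i < b"
  with assms have *: "1 < b" "\<rho> i < b" by auto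
  let ?p = "Seq (Add b 1 (\<rho> i)) (Seq (Add b b (\<rho> i)) (Load b b))"
  have "wp ?p (cmp_post (\<lambda>A s. A (s i)) \<rho> b (\<lambda>_. 3) s t) s t" if "b < s 1" for s t
    using * that by (simp add: cmp_post_def data_def add.assoc mult_2[symmetric])
  then show "\<exists>p R T. poly_bd T \<and> (\<forall>s t. R \<le> s 1 \<longrightarrow> wp p (cmp_post (\<lambda>A s. A (s i)) \<rho> b T s t) s t)"
    by (intro exI[of _ ?p] exI[of _ "Suc b"] exI[of _ "\<lambda>_. 3"]) (simp add: poly_bd_const)
qed (use assms in simp)

lemma cmp_ite_var:
  assumes "i < n" "j < n" "l < n"
  shows "cmp n (\<lambda>A s. if s i \<noteq> 0 then s j else s l)"
proof (rule cmpI)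
  fix \<rho> :: "nat \<Rightarrow> nat" and b :: nat
  assume "1 < b" "\<And>i. i < n \<Longrightarrow> \<rho> i < b"
  with assms have "1 < b" "\<rho> i < b" "\<rho> j < b" "\<rho> l < b" by auto
  then show "\<exists>p R T. poly_bd T \<and>
      (\<forall>s t. R \<le> s 1 \<longrightarrow> wp p (cmp_post (\<lambda>A s. if s i \<noteq> 0 then s j else s l) \<rho> b T s t) s t)"
    by (intro exI[of _ "Seq (Const b 0) (Cond (\<rho> i) (Add b b (\<rho> j)) (Add b b (\<rho> l)))"]
          exI[of _ "Suc b"] exI[of _ "\<lambda>_. 3"])
      (auto simp: cmp_post_def poly_bd_const)
qed (use assms in simp)

lemma cmp_rename:
  assumes f: "cmp m f" and \<pi>: "\<pi> 0 = 0" "\<And>i. i < m \<Longrightarrow> \<pi> i < n"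
  shows "cmp n (\<lambda>A s. f A (s \<circ> \<pi>))"
proof (rule cmpI)
  fix A and s s' :: "nat \<Rightarrow> nat"
  assume "\<And>i. i < n \<Longrightarrow> s i = s' i"
  then show "f A (s \<circ> \<pi>) = f A (s' \<circ> \<pi>)"
    by (intro cmp_cong[OF f]) (simp add: \<pi>)
next
  fix \<rho> :: "nat \<Rightarrow> nat" and b :: nat
  assume *: "\<rho> 0 = 0" "1 < b" "\<And>i. i < n \<Longrightarrow> \<rho> i < b"
  obtain p R T where "poly_bd T" "\<And>s t. R \<le> s 1 \<Longrightarrow> wp p (cmp_post f (\<rho> \<circ> \<pi>) b T s t) s t"
    by (rule cmpE[OF f, of "\<rho> \<circ> \<pi>" b]) (use * \<pi> in auto)
  moreover have "cmp_post (\<lambda>A s. f A (s \<circ> \<pi>)) \<rho> = cmp_post f (\<rho> \<circ> \<pi>)"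
    by (simp add: cmp_post_def fun_eq_iff comp_assoc)
  ultimately show "\<exists>p R T. poly_bd T \<and>
      (\<forall>s t. R \<le> s 1 \<longrightarrow> wp p (cmp_post (\<lambda>A s. f A (s \<circ> \<pi>)) \<rho> b T s t) s t)"
    by (intro exI[of _ p] exI[of _ R] exI[of _ T]) simp
qed

text \<open>The value of \<open>g\<close> stays in register \<open>b\<close>, which becomes the
  place of variable \<open>n\<close>, while \<open>h\<close> works from register
  \<open>Suc b\<close> on; its result is then copied down to \<open>b\<close>. All substitution of
  terms for variables goes back to this rule.\<close>

lemma cmp_let:
  assumes g: "cmp n g" and h: "cmp (Suc n) h" and n: "0 < n"
  shows "cmp n (\<lambda>A s. h A (s(n := g A s)))"
proof (rule cmpI)
  fix A and s s' :: "nat \<Rightarrow> nat"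
  assume "\<And>i. i < n \<Longrightarrow> s i = s' i"
  then show "h A (s(n := g A s)) = h A (s'(n := g A s'))"
    by (intro cmp_cong[OF h]) (auto simp: less_Suc_eq intro: cmp_cong[OF g])
next
  fix \<rho> :: "nat \<Rightarrow> nat" and b :: nat
  assume *: "\<rho> 0 = 0" "1 < b" "\<And>i. i < n \<Longrightarrow> \<rho> i < b"
  obtain p R T where p: "poly_bd T" "\<And>s t. R \<le> s 1 \<Longrightarrow> wp p (cmp_post g \<rho> b T s t) s t"
    by (rule cmpE[OF g, of \<rho> b]) (use * in auto)
  obtain q R' T' where q: "poly_bd T'"
      "\<And>s t. R' \<le> s 1 \<Longrightarrow> wp q (cmp_post h (\<rho>(n := b)) (Suc b) T' s t) s t"
    by (rule cmpE[OF h, of "\<rho>(n := b)" "Suc b"]) (use * n in \<open>auto simp: less_Suc_eq\<close>)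
  have "wp (Seq p (Seq q (Seq (Const b 0) (Add b b (Suc b)))))
      (cmp_post (\<lambda>A s. h A (s(n := g A s))) \<rho> b (\<lambda>N. T N + T' N + 2) s t) s t"
    if R: "R + R' + b + 3 \<le> s 1" for s t
  proof (unfold wp_Seq, rule wp_mono[OF p(2)])
    fix s1 t1
    assume s1: "cmp_post g \<rho> b T s t s1 t1"
    then have 1: "s1 1 = s 1" "s1 0 = s 0" "data s1 = data s"
      using * by (auto simp: cmp_post_def intro!: data_eq)
    have 2: "h (data s) (s1 \<circ> \<rho>(n := b)) = h (data s) ((s \<circ> \<rho>)(n := g (data s) (s \<circ> \<rho>)))"
      using s1 * by (intro cmp_cong[OF h]) (auto simp: cmp_post_def less_Suc_eq)
    show "wp q (wp (Const b 0) (wp (Add b b (Suc b))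
        (cmp_post (\<lambda>A s. h A (s(n := g A s))) \<rho> b (\<lambda>N. T N + T' N + 2) s t))) s1 t1"
      by (rule wp_mono[OF q(2)]) (use R s1 1 2 in \<open>auto simp: cmp_post_def\<close>)
  qed (use R in simp)
  then show "\<exists>p R T. poly_bd T \<and>
      (\<forall>s t. R \<le> s 1 \<longrightarrow> wp p (cmp_post (\<lambda>A s. h A (s(n := g A s))) \<rho> b T s t) s t)"
    by (intro exI[of _ "Seq p (Seq q (Seq (Const b 0) (Add b b (Suc b))))"]
          exI[of _ "R + R' + b + 3"] exI[of _ "\<lambda>N. T N + T' N + 2"] conjI,
        intro poly_bd_intros p(1) q(1)) blast
qed

section \<open>Loops\<close>

fun iter :: "nat \<Rightarrow> (nat \<Rightarrow> nat \<Rightarrow> nat) \<Rightarrow> nat \<Rightarrow> nat" where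
  "iter 0 g a = a"
| "iter (Suc i) g a = g i (iter i g a)"

lemma iter_cong: "(\<And>j x. j < i \<Longrightarrow> g j x = g' j x) \<Longrightarrow> iter i g a = iter i g' a"
  by (induction i) auto

lemma cmp_iter_var:
  assumes g: "cmp (Suc (Suc n)) g" and m: "m < n"
  shows "cmp n (\<lambda>A s. iter (s 0) (\<lambda>i x. g A (s(n := i, Suc n := x))) (s m))"
proof (rule cmpI)
  fix A and s s' :: "nat \<Rightarrow> nat"
  assume *: "\<And>i. i < n \<Longrightarrow> s i = s' i"
  have "g A (s(n := i, Suc n := x)) = g A (s'(n := i, Suc n := x))" for i x
    by (rule cmp_cong[OF g]) (use * in \<open>auto simp: less_Suc_eq\<close>)
  then show "iter (s 0) (\<lambda>i x. g A (s(n := i, Suc n := x))) (s m) =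
      iter (s' 0) (\<lambda>i x. g A (s'(n := i, Suc n := x))) (s' m)"
    using * m by simp
next
  fix \<rho> :: "nat \<Rightarrow> nat" and b :: nat
  assume *: "\<rho> 0 = 0" "1 < b" "\<And>i. i < n \<Longrightarrow> \<rho> i < b"
  define \<rho>' where "\<rho>' = \<rho>(n := Suc b, Suc n := b)"
  obtain p R T where p: "poly_bd T"
      "\<And>s t. R \<le> s 1 \<Longrightarrow> wp p (cmp_post g \<rho>' (b + 4) T s t) s t"
    by (rule cmpE[OF g, of \<rho>' "b + 4"])
      (use * m in \<open>auto simp: less_Suc_eq \<rho>'_def intro: less_trans[of _ b]\<close>)
  \<comment> \<open>Register \<open>b\<close> holds the accumulator, \<open>b + 1\<close> the index,
    \<open>b + 2\<close> the number of rounds left and \<open>b + 3\<close> a constant;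
    \<open>p\<close> leaves the new value in \<open>b + 4\<close>.\<close>
  define body where "body = Seq p (Seq (Const (b + 3) 0) (Seq (Add b (b + 4) (b + 3))
    (Seq (Const (b + 3) 1) (Seq (Add (b + 1) (b + 1) (b + 3)) (Sub (b + 2) (b + 2) (b + 3))))))"
  define prg where "prg = Seq (Const (b + 1) 0) (Seq (Add b (\<rho> m) (b + 1))
    (Seq (Add (b + 2) 0 (b + 1)) (While (b + 2) body)))"
  let ?f = "\<lambda>A s. iter (s 0) (\<lambda>i x. g A (s(n := i, Suc n := x))) (s m)"
  let ?T = "\<lambda>N. N * (T N + 7) + 7"
  have "wp prg (cmp_post ?f \<rho> b ?T s t) s t" if R: "R + b + 5 \<le> s 1" for s t
  proof -
    define G where "G i x = g (data s) ((s \<circ> \<rho>)(n := i, Suc n := x))" for i x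
    define P where "P j s' t' \<longleftrightarrow> j \<le> s 0 \<and> s' (b + 2) = j \<and> s' (b + 1) = s 0 - j \<and>
      s' b = iter (s 0 - j) G (s (\<rho> m)) \<and> (\<forall>i. i < b \<or> s 1 \<le> i \<longrightarrow> s' i = s i) \<and>
      t' \<le> t + 3 + (s 0 - j) * (T (s 0) + 7)" for j s' t'
    have \<rho>m: "\<rho> m < b" using * m by simp
    show ?thesis
      unfolding prg_def wp_Seq wp_prim
    proof (rule wp_While[where P = P and n = "s 0"])
      show "P (s 0) (s(b + 1 := 0, b := (s(b + 1 := 0)) (\<rho> m) + (s(b + 1 := 0)) (b + 1),
          b + 2 := (s(b + 1 := 0, b := (s(b + 1 := 0)) (\<rho> m) + (s(b + 1 := 0)) (b + 1))) 0 +
           (s(b + 1 := 0, b := (s(b + 1 := 0)) (\<rho> m) + (s(b + 1 := 0)) (b + 1))) (b + 1)))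
          (Suc (Suc (Suc t)))"
        using R *(2) \<rho>m by (auto simp: P_def)
    next
      fix j s' t'
      assume P: "P (Suc j) s' t'"
      then have 1: "s' 1 = s 1" "s' 0 = s 0" "data s' = data s"
        using * by (auto simp: P_def intro!: data_eq)
      have 2: "g (data s) (s' \<circ> \<rho>') = G (s 0 - Suc j) (iter (s 0 - Suc j) G (s (\<rho> m)))"
        by (rule trans[OF cmp_cong[OF g] G_def[symmetric]]) (use P * in \<open>auto simp: P_def \<rho>'_def less_Suc_eq\<close>)
      have 3: "s 0 - j = Suc (s 0 - Suc j)"
        using P by (auto simp: P_def)
      show "s' (b + 2) \<noteq> 0 \<and> wp body (P j) s' (Suc t')"
      proof
        show "s' (b + 2) \<noteq> 0"
          using P by (simp add: P_def)
        show "wp body (P j) s' (Suc t')"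
          unfolding body_def wp_Seq
        proof (rule wp_mono[OF p(2)])
          fix s2 t2
          assume s2: "cmp_post g \<rho>' (b + 4) T s' (Suc t') s2 t2"
          have 4: "s2 i = s' i" if "i < b + 4 \<or> s 1 \<le> i" for i
            using s2 that 1 by (auto simp: cmp_post_def)
          have 5: "s2 (b + 4) = G (s 0 - Suc j) (iter (s 0 - Suc j) G (s (\<rho> m)))"
            using s2 1 2 by (simp add: cmp_post_def)
          have 6: "t2 \<le> Suc t' + T (s 0)"
            using s2 1 by (simp add: cmp_post_def)
          show "wp (Const (b + 3) 0) (wp (Add b (b + 4) (b + 3)) (wp (Const (b + 3) 1)
             (wp (Add (b + 1) (b + 1) (b + 3)) (wp (Sub (b + 2) (b + 2) (b + 3)) (P j))))) s2 t2"
            using P R 5 6 by (auto simp: P_def 4 3)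
        qed (use 1 R in simp)
      qed
    next
      fix s' t'
      assume P: "P 0 s' t'"
      show "s' (b + 2) = 0 \<and> cmp_post ?f \<rho> b ?T s t s' (Suc t')"
        using P * by (auto simp: P_def cmp_post_def G_def[abs_def])
    qed
  qed
  then show "\<exists>p R T. poly_bd T \<and> (\<forall>s t. R \<le> s 1 \<longrightarrow> wp p (cmp_post ?f \<rho> b T s t) s t)"
    by (intro exI[of _ prg] exI[of _ "R + b + 5"] exI[of _ ?T] conjI, intro poly_bd_intros p(1)) blast
qed

text \<open>A function is shown computable once, with its arguments in the variables
  \<open>1, 2, ...\<close>. Here they move to fresh variables, for which the \<open>cmp_app\<close>
  rules then substitute arbitrary terms.\<close>

lemma cmp_at:
  assumes "cmp (Suc m) (\<lambda>A s. F A (s 0) (\<lambda>i. s (Suc i)))" "0 < n"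
  shows "cmp (n + m) (\<lambda>A s. F A (s 0) (\<lambda>i. s (n + i)))"
proof -
  have "cmp (n + m) (\<lambda>A s. (\<lambda>A s. F A (s 0) (\<lambda>i. s (Suc i))) A
      (s \<circ> (\<lambda>i. if i = 0 then 0 else n + (i - 1))))"
    by (rule cmp_rename[OF assms(1)]) (use assms(2) in auto)
  then show ?thesis by simp
qed

lemma cmp_app1:
  assumes "cmp 2 (\<lambda>A s. F A (s 0) (s 1))" "cmp n a" "0 < n"
  shows "cmp n (\<lambda>A s. F A (s 0) (a A s))"
proof -
  have "cmp (Suc n) (\<lambda>A s. F A (s 0) (s n))"
    using cmp_at[of 1 "\<lambda>A N v. F A N (v 0)" n] assms by (simp add: numeral_eq_Suc)
  from cmp_let[OF assms(2) this assms(3)] show ?thesis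
    using assms(3) by simp
qed

lemma cmp_app2:
  assumes "cmp 3 (\<lambda>A s. F A (s 0) (s 1) (s 2))" "cmp n a" "cmp n b" "0 < n"
  shows "cmp n (\<lambda>A s. F A (s 0) (a A s) (b A s))"
proof -
  have "cmp (Suc (Suc n)) (\<lambda>A s. F A (s 0) (s n) (s (Suc n)))"
    using cmp_at[of 2 "\<lambda>A N v. F A N (v 0) (v 1)" n] assms by (simp add: numeral_eq_Suc)
  from cmp_let[OF cmp_weaken[OF assms(3)] this]
  have "cmp (Suc n) (\<lambda>A s. F A (s 0) (s n) (b A s))"
    using assms(3) by simp
  from cmp_let[OF assms(2) this assms(4)] show ?thesis
    using assms by simp
qed

lemma cmp_app3:
  assumes "cmp 4 (\<lambda>A s. F A (s 0) (s 1) (s 2) (s 3))" "cmp n a" "cmp n b" "cmp n c" "0 < n"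
  shows "cmp n (\<lambda>A s. F A (s 0) (a A s) (b A s) (c A s))"
proof -
  have "cmp (n + 3) (\<lambda>A s. F A (s 0) (s n) (s (n + 1)) (s (n + 2)))"
    using cmp_at[of 3 "\<lambda>A N v. F A N (v 0) (v 1) (v 2)" n] assms by (simp add: numeral_eq_Suc)
  then have 1: "cmp (Suc (Suc (Suc n))) (\<lambda>A s. F A (s 0) (s n) (s (Suc n)) (s (Suc (Suc n))))"
    by (simp add: numeral_eq_Suc)
  from cmp_let[OF cmp_weaken[OF assms(4)] 1]
  have "cmp (Suc (Suc n)) (\<lambda>A s. F A (s 0) (s n) (s (Suc n)) (c A s))"
    using assms(4) by simp
  from cmp_let[OF cmp_weaken[OF assms(3)] this]
  have "cmp (Suc n) (\<lambda>A s. F A (s 0) (s n) (b A s) (c A s))"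
    using assms(3,4) by simp
  from cmp_let[OF assms(2) this assms(5)] show ?thesis
    using assms by simp
qed

lemma cmp_var: "i < n \<Longrightarrow> cmp n (\<lambda>A s. s i)"
  using cmp_let[OF cmp_const[of n 0] cmp_add_var[of i "Suc n" n]] by simp

lemma cmp_add: "cmp n f \<Longrightarrow> cmp n g \<Longrightarrow> 0 < n \<Longrightarrow> cmp n (\<lambda>A s. f A s + g A s)"
  by (rule cmp_app2[where F = "\<lambda>A N x y. x + y"]) (rule cmp_add_var; simp)

lemma cmp_Suc: "cmp n f \<Longrightarrow> 0 < n \<Longrightarrow> cmp n (\<lambda>A s. Suc (f A s))"
  using cmp_add[OF _ cmp_const[of n 1]] by simp

lemma cmp_diff: "cmp n f \<Longrightarrow> cmp n g \<Longrightarrow> 0 < n \<Longrightarrow> cmp n (\<lambda>A s. f A s - g A s)"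
  by (rule cmp_app2[where F = "\<lambda>A N x y. x - y"]) (rule cmp_sub_var; simp)

lemma cmp_load: "cmp n f \<Longrightarrow> 0 < n \<Longrightarrow> cmp n (\<lambda>A s. A (f A s))"
  by (rule cmp_app1[where F = "\<lambda>A N x. A x"]) (rule cmp_load_var; simp)

lemma cmp_ite:
  "cmp n f \<Longrightarrow> cmp n g \<Longrightarrow> cmp n h \<Longrightarrow> 0 < n \<Longrightarrow> cmp n (\<lambda>A s. if f A s \<noteq> 0 then g A s else h A s)"
  by (rule cmp_app3[where F = "\<lambda>A N x y z. if x \<noteq> 0 then y else z"]) (rule cmp_ite_var; simp)

lemma cmp_iter:
  assumes G: "cmp (Suc (Suc n)) (\<lambda>A s. G A s (s n) (s (Suc n)))" and a: "cmp n a"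
    and inv: "\<And>A s x y i z. G A (s(n := x, Suc n := y)) i z = G A s i z" and n: "0 < n"
  shows "cmp n (\<lambda>A s. iter (s 0) (G A s) (a A s))"
proof -
  define g where "g = (\<lambda>A s. G A s (s n) (s (Suc n)))"
  \<comment> \<open>Variable \<open>n\<close> will hold the initial value, so the two loop variables
    move up by one.\<close>
  define \<pi> where "\<pi> i = (if i < n then i else Suc i)" for i
  have g: "cmp (Suc (Suc n)) g"
    using G by (simp add: g_def)
  have "cmp (Suc (Suc (Suc n))) (\<lambda>A s. g A (s \<circ> \<pi>))"
    by (rule cmp_rename[OF g]) (use n in \<open>auto simp: \<pi>_def\<close>)
  from cmp_iter_var[OF this, of n]
  have "cmp (Suc n) (\<lambda>A s. iter (s 0) (\<lambda>i x. g A (s(Suc n := i, Suc (Suc n) := x) \<circ> \<pi>)) (s n))"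
    by simp
  from cmp_let[OF a this n]
  have *: "cmp n (\<lambda>A s. iter (s 0)
      (\<lambda>i x. g A (s(n := a A s, Suc n := i, Suc (Suc n) := x) \<circ> \<pi>)) (a A s))"
    using n by simp
  have "g A (s(n := y, Suc n := i, Suc (Suc n) := x) \<circ> \<pi>) = G A s i x" for A s y i x
  proof -
    have "g A (s(n := y, Suc n := i, Suc (Suc n) := x) \<circ> \<pi>) = g A (s(n := i, Suc n := x))"
      by (rule cmp_cong[OF g]) (auto simp: \<pi>_def less_Suc_eq)
    then show ?thesis
      by (simp add: g_def inv)
  qed
  with * show ?thesis by simp
qed

lemma sum_eq_iter: "(\<Sum>i<n. f i) = iter n (\<lambda>i x. x + f i) 0"
  by (induction n) auto

lemma cmp_sum:
  assumes F: "cmp (Suc n) (\<lambda>A s. F A s (s n))"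
    and inv: "\<And>A s x i. F A (s(n := x)) i = F A s i" and n: "0 < n"
  shows "cmp n (\<lambda>A s. \<Sum>i<s 0. F A s i)"
  unfolding sum_eq_iter
proof (rule cmp_iter)
  show "cmp (Suc (Suc n)) (\<lambda>A s. s (Suc n) + F A s (s n))"
    by (intro cmp_add cmp_var cmp_weaken[OF F]) auto
  fix A and s :: "nat \<Rightarrow> nat" and x y i z :: nat
  \<comment> \<open>The assumption \<open>inv\<close> covers changes of variable \<open>n\<close>
    only. Variable \<open>Suc n\<close> is beyond those on which the function in \<open>F\<close>
    depends, once the index is stored in \<open>n\<close>.\<close>
  have "F A (s(Suc n := y)) i = F A (s(Suc n := y, n := i)) i"
    by (simp add: inv)
  also have "\<dots> = F A (s(n := i)) i"
    using cmp_cong[OF F, of "s(Suc n := y, n := i)" "s(n := i)" A] by simp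
  also have "\<dots> = F A s i"
    by (simp add: inv)
  finally have "F A (s(Suc n := y)) i = F A s i" .
  moreover have "s(n := x, Suc n := y) = s(Suc n := y, n := x)"
    by auto
  ultimately show "z + F A (s(n := x, Suc n := y)) i = z + F A s i"
    by (simp add: inv)
qed (auto intro: cmp_const n)

section \<open>Computable conditions\<close>

definition cmpb :: "nat \<Rightarrow> ((nat \<Rightarrow> nat) \<Rightarrow> (nat \<Rightarrow> nat) \<Rightarrow> bool) \<Rightarrow> bool" where
  "cmpb n P \<longleftrightarrow> cmp n (\<lambda>A s. of_bool (P A s))"

lemma cmp_if:
  assumes "cmpb n P" "cmp n f" "cmp n g" "0 < n"
  shows "cmp n (\<lambda>A s. if P A s then f A s else g A s)"
  using cmp_ite[OF assms(1)[unfolded cmpb_def] assms(2-4)] by simp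

lemma cmp_of_bool: "cmpb n P \<Longrightarrow> cmp n (\<lambda>A s. of_bool (P A s))"
  by (simp add: cmpb_def)

lemma cmpb_neq0: "cmp n f \<Longrightarrow> 0 < n \<Longrightarrow> cmpb n (\<lambda>A s. f A s \<noteq> 0)"
  using cmp_ite[of n f "\<lambda>_ _. 1" "\<lambda>_ _. 0"] by (simp add: cmpb_def cmp_const of_bool_def)

lemma cmpb_not:
  assumes "cmpb n P" "0 < n"
  shows "cmpb n (\<lambda>A s. \<not> P A s)"
proof -
  have "cmp n (\<lambda>A s. if P A s then 0 else 1)"
    by (intro cmp_if cmp_const assms)
  also have "(\<lambda>A s. if P A s then 0 else (1 :: nat)) = (\<lambda>A s. of_bool (\<not> P A s))"
    by (simp add: fun_eq_iff)
  finally show ?thesis by (simp add: cmpb_def)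
qed

lemma cmpb_conj: "cmpb n P \<Longrightarrow> cmpb n Q \<Longrightarrow> 0 < n \<Longrightarrow> cmpb n (\<lambda>A s. P A s \<and> Q A s)"
proof -
  assume *: "cmpb n P" "cmpb n Q" "0 < n"
  have "cmp n (\<lambda>A s. if P A s then of_bool (Q A s) else 0)"
    by (intro cmp_if cmp_const cmp_of_bool *)
  also have "(\<lambda>A s. if P A s then of_bool (Q A s) else (0 :: nat)) = (\<lambda>A s. of_bool (P A s \<and> Q A s))"
    by (simp add: fun_eq_iff)
  finally show ?thesis by (simp add: cmpb_def)
qed

lemma cmpb_disj: "cmpb n P \<Longrightarrow> cmpb n Q \<Longrightarrow> 0 < n \<Longrightarrow> cmpb n (\<lambda>A s. P A s \<or> Q A s)"
  using cmpb_not[OF cmpb_conj[OF cmpb_not cmpb_not]] by simp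

lemma cmpb_imp: "cmpb n P \<Longrightarrow> cmpb n Q \<Longrightarrow> 0 < n \<Longrightarrow> cmpb n (\<lambda>A s. P A s \<longrightarrow> Q A s)"
  using cmpb_disj[OF cmpb_not[of n P], of Q] by (simp only: imp_conv_disj)

lemma cmpb_less: "cmp n f \<Longrightarrow> cmp n g \<Longrightarrow> 0 < n \<Longrightarrow> cmpb n (\<lambda>A s. f A s < g A s)"
  using cmpb_neq0[OF cmp_diff[of n g f]] by (simp add: not_le)

lemma cmpb_le: "cmp n f \<Longrightarrow> cmp n g \<Longrightarrow> 0 < n \<Longrightarrow> cmpb n (\<lambda>A s. f A s \<le> g A s)"
  using cmpb_not[OF cmpb_less[of n g f]] by (simp add: not_less)

lemma cmpb_eq:
  assumes "cmp n f" "cmp n g" "0 < n"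
  shows "cmpb n (\<lambda>A s. f A s = g A s)"
  using cmpb_conj[OF cmpb_le[OF assms] cmpb_le[OF assms(2,1,3)] assms(3)]
  by (simp add: eq_iff[symmetric])

lemma cmpb_all:
  assumes P: "cmpb (Suc n) (\<lambda>A s. P A s (s n))"
    and inv: "\<And>A s x i. P A (s(n := x)) i = P A s i" and n: "0 < n"
  shows "cmpb n (\<lambda>A s. \<forall>i<s 0. P A s i)"
proof -
  have "cmp n (\<lambda>A s. \<Sum>i<s 0. of_bool (\<not> P A s i))"
    by (rule cmp_sum) (use P inv n in \<open>auto intro: cmp_of_bool cmpb_not\<close>)
  from cmpb_not[OF cmpb_neq0[OF this n] n] show ?thesis
    by (simp add: disjoint_iff)
qed

lemma cmpb_ex:
  assumes P: "cmpb (Suc n) (\<lambda>A s. P A s (s n))"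
    and inv: "\<And>A s x i. P A (s(n := x)) i = P A s i" and n: "0 < n"
  shows "cmpb n (\<lambda>A s. \<exists>i<s 0. P A s i)"
  using cmpb_not[OF cmpb_all[of n "\<lambda>A s i. \<not> P A s i"] n] cmpb_not[OF P] inv n by simp

lemma cmp_sum_finite:
  "finite S \<Longrightarrow> (\<And>a. a \<in> S \<Longrightarrow> cmp n (F a)) \<Longrightarrow> 0 < n \<Longrightarrow> cmp n (\<lambda>A s. \<Sum>a\<in>S. F a A s)"
  by (induction S rule: finite_induct) (auto intro: cmp_const cmp_add)

lemma cmpb_const: "cmpb n (\<lambda>A s. P)"
  by (simp add: cmpb_def cmp_const)

lemma cmpb_ball_finite:
  "finite S \<Longrightarrow> (\<And>a. a \<in> S \<Longrightarrow> cmpb n (P a)) \<Longrightarrow> 0 < n \<Longrightarrow> cmpb n (\<lambda>A s. \<forall>a\<in>S. P a A s)"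
  by (induction S rule: finite_induct) (auto intro: cmpb_conj cmpb_const)

lemma cmpb_all_less:
  "(\<And>a. a < (q :: nat) \<Longrightarrow> cmpb n (P a)) \<Longrightarrow> 0 < n \<Longrightarrow> cmpb n (\<lambda>A s. \<forall>a<q. P a A s)"
  using cmpb_ball_finite[of "{..<q}" n P, OF finite_lessThan] by (simp add: Ball_def)

lemma cmpb_bex_finite:
  "finite S \<Longrightarrow> (\<And>a. a \<in> S \<Longrightarrow> cmpb n (P a)) \<Longrightarrow> 0 < n \<Longrightarrow> cmpb n (\<lambda>A s. \<exists>a\<in>S. P a A s)"
  by (induction S rule: finite_induct) (auto intro: cmpb_disj cmpb_const)

lemma cmp_min: "cmp n f \<Longrightarrow> cmp n g \<Longrightarrow> 0 < n \<Longrightarrow> cmp n (\<lambda>A s. min (f A s) (g A s))"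
  unfolding min_def by (rule cmp_if[OF cmpb_le])

lemma sum_if_less: "(\<Sum>i<N. if i < m then c else 0) = min N m * (c :: nat)"
  by (induction N) (auto simp: min_def not_le less_Suc_eq_le)

lemma cmp_mult:
  assumes "cmp n f" "cmp n g" "0 < n"
  shows "cmp n (\<lambda>A s. min (s 0) (f A s) * g A s)"
proof -
  have "cmp n (\<lambda>A s. \<Sum>i<s 0. if i < f A s then g A s else 0)"
    by (rule cmp_sum) (use assms in \<open>auto intro!: cmp_if cmpb_less cmp_var cmp_const intro: cmp_weaken[of n]\<close>)
  also have "(\<lambda>A s. \<Sum>i<s 0. if i < f A s then g A s else 0) = (\<lambda>A s. min (s 0) (f A s) * g A s)"
    by (simp add: sum_if_less)
  finally show ?thesis .
qed

lemma cmp_cmult: "cmp n f \<Longrightarrow> 0 < n \<Longrightarrow> cmp n (\<lambda>A s. c * f A s)"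
  by (induction c) (auto intro: cmp_const cmp_add)

lemmas cmp_intros = cmp_const cmp_var cmp_add cmp_Suc cmp_diff cmp_load cmp_iter cmp_sum cmp_if
  cmp_of_bool cmpb_not cmpb_conj cmpb_disj cmpb_imp cmpb_less cmpb_le cmpb_eq cmpb_all cmpb_ex
  cmpb_all_less cmpb_const cmp_min cmp_mult cmp_cmult

section \<open>Writing output\<close>

text \<open>Register \<open>2\<close> points to the next free output cell. The time bound also bounds the length
  of the output.\<close>

definition emit_post :: "((nat \<Rightarrow> nat) \<Rightarrow> (nat \<Rightarrow> nat) \<Rightarrow> nat list) \<Rightarrow> (nat \<Rightarrow> nat) \<Rightarrow> nat \<Rightarrow>
    (nat \<Rightarrow> nat) \<Rightarrow> memory \<Rightarrow> nat \<Rightarrow> memory \<Rightarrow> nat \<Rightarrow> bool" where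
  "emit_post f \<rho> b T s t s' t' \<longleftrightarrow> (let L = f (data s) (s \<circ> \<rho>) in
     (\<forall>i<length L. s' (s 2 + 2 * i) = L ! i) \<and> s' 2 = s 2 + 2 * length L \<and>
     (\<forall>i<b. i \<noteq> 2 \<longrightarrow> s' i = s i) \<and>
     (\<forall>i\<ge>s 1. (\<forall>j<length L. i \<noteq> s 2 + 2 * j) \<longrightarrow> s' i = s i) \<and>
     t' \<le> t + T (s 0) \<and> length L \<le> T (s 0))"

text \<open>The odd offset from the start of the data puts the output between the cells of the input
  array, so that writing leaves \<open>data\<close> unchanged.\<close>

definition emit_pre :: "nat \<Rightarrow> memory \<Rightarrow> bool" where
  "emit_pre R s \<longleftrightarrow> R \<le> s 1 \<and> (\<exists>w. s 2 = Suc (s 1 + 2 * w))"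

definition emits :: "nat \<Rightarrow> ((nat \<Rightarrow> nat) \<Rightarrow> (nat \<Rightarrow> nat) \<Rightarrow> nat list) \<Rightarrow> bool" where
  "emits n f \<longleftrightarrow> (\<forall>A s s'. (\<forall>i<n. s i = s' i) \<longrightarrow> f A s = f A s') \<and>
     (\<forall>\<rho> b. \<rho> 0 = 0 \<and> 2 < b \<and> (\<forall>i<n. \<rho> i < b \<and> \<rho> i \<noteq> 2) \<longrightarrow>
        (\<exists>p R T. poly_bd T \<and> (\<forall>s t. emit_pre R s \<longrightarrow> wp p (emit_post f \<rho> b T s t) s t)))"

lemma emits_cong: "emits n f \<Longrightarrow> (\<And>i. i < n \<Longrightarrow> s i = s' i) \<Longrightarrow> f A s = f A s'"
  unfolding emits_def by blast

lemma emitsE: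
  assumes "emits n f" "\<rho> 0 = 0" "2 < b" "\<And>i. i < n \<Longrightarrow> \<rho> i < b \<and> \<rho> i \<noteq> 2"
  obtains p R T where "poly_bd T" "\<And>s t. emit_pre R s \<Longrightarrow> wp p (emit_post f \<rho> b T s t) s t"
  using assms unfolding emits_def by blast

lemma emitsI:
  assumes "\<And>A s s'. (\<And>i. i < n \<Longrightarrow> s i = s' i) \<Longrightarrow> f A s = f A s'"
    and "\<And>\<rho> b. \<rho> 0 = 0 \<Longrightarrow> 2 < b \<Longrightarrow> (\<And>i. i < n \<Longrightarrow> \<rho> i < b \<and> \<rho> i \<noteq> 2) \<Longrightarrow>
      \<exists>p R T. poly_bd T \<and> (\<forall>s t. emit_pre R s \<longrightarrow> wp p (emit_post f \<rho> b T s t) s t)"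
  shows "emits n f"
  using assms unfolding emits_def by blast

lemma emit_post_data:
  assumes "emit_post f \<rho> b T s t s' t'" "emit_pre R s" "2 < b"
  shows "data s' = data s" "s' 1 = s 1" "s' 0 = s 0" "emit_pre R s'"
proof -
  from assms(2) obtain w where w: "s 2 = Suc (s 1 + 2 * w)" "R \<le> s 1"
    unfolding emit_pre_def by blast
  show 1: "s' 1 = s 1" "s' 0 = s 0"
    using assms by (auto simp: emit_post_def Let_def)
  have "s 1 + 2 * i \<noteq> s 2 + 2 * j" for i j
    unfolding w by presburger
  then show "data s' = data s"
    using assms(1) 1 unfolding data_def emit_post_def Let_def by (auto simp: fun_eq_iff)
  have "s' 2 = Suc (s 1 + 2 * (w + length (f (data s) (s \<circ> \<rho>))))"
    using assms(1) by (simp add: emit_post_def Let_def w)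
  then show "emit_pre R s'"
    unfolding emit_pre_def 1 using w(2) by blast
qed

lemma emits_Nil: "emits n (\<lambda>A s. [])"
proof (rule emitsI)
  fix \<rho> :: "nat \<Rightarrow> nat" and b :: nat
  show "\<exists>p R T. poly_bd T \<and> (\<forall>s t. emit_pre R s \<longrightarrow> wp p (emit_post (\<lambda>A s. []) \<rho> b T s t) s t)"
    by (rule exI[of _ Skip], rule exI[of _ 0], rule exI[of _ "\<lambda>_. 1"])
      (simp add: emit_post_def poly_bd_const)
qed simp

lemma emits_single:
  assumes g: "cmp n g"
  shows "emits n (\<lambda>A s. [g A s])"
proof (rule emitsI)
  fix A and s s' :: "nat \<Rightarrow> nat"
  assume "\<And>i. i < n \<Longrightarrow> s i = s' i"
  then show "[g A s] = [g A s']"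
    using cmp_cong[OF g, of s s' A] by simp
next
  fix \<rho> :: "nat \<Rightarrow> nat" and b :: nat
  assume *: "\<rho> 0 = 0" "2 < b" "\<And>i. i < n \<Longrightarrow> \<rho> i < b \<and> \<rho> i \<noteq> 2"
  obtain p R T where p: "poly_bd T" "\<And>s t. R \<le> s 1 \<Longrightarrow> wp p (cmp_post g \<rho> b T s t) s t"
    by (rule cmpE[OF g, of \<rho> b]) (use * in auto)
  let ?p = "Seq p (Seq (Store 2 b) (Seq (Const b 2) (Add 2 2 b)))"
  have "wp ?p (emit_post (\<lambda>A s. [g A s]) \<rho> b (\<lambda>N. T N + 4) s t) s t"
    if pre: "emit_pre (R + b + 1) s" for s t
  proof -
    have R: "R + b + 1 \<le> s 1" "s 1 \<le> s 2"
      using pre by (auto simp: emit_pre_def)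
    show ?thesis
      unfolding wp_Seq
    proof (rule wp_mono[OF p(2)])
      fix s' t'
      assume "cmp_post g \<rho> b T s t s' t'"
      then have s': "s' b = g (data s) (s \<circ> \<rho>)" "\<And>i. i < b \<or> s 1 \<le> i \<Longrightarrow> s' i = s i" "t' \<le> t + T (s 0)"
        by (auto simp: cmp_post_def)
      show "wp (Store 2 b) (wp (Const b 2) (wp (Add 2 2 b)
          (emit_post (\<lambda>A s. [g A s]) \<rho> b (\<lambda>N. T N + 4) s t))) s' t'"
        using *(2) R s' by (auto simp: emit_post_def)
    qed (use R in simp)
  qed
  then show "\<exists>p R T. poly_bd T \<and> (\<forall>s t. emit_pre R s \<longrightarrow> wp p (emit_post (\<lambda>A s. [g A s]) \<rho> b T s t) s t)"
    by (intro exI[of _ ?p] exI[of _ "R + b + 1"] exI[of _ "\<lambda>N. T N + 4"] conjI,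
        intro poly_bd_intros p(1)) blast
qed

text \<open>Made general enough for loops: the second output may use more registers
  (\<open>b'\<close>), its variables are placed by another map and read in the intermediate state,
  and \<open>c\<close> accounts for steps between the two parts.\<close>

lemma emit_post_append:
  assumes 1: "emit_post f \<rho> b T s t s1 t1" and 2: "emit_post g \<rho>' b' T' s1 t1' s2 t2"
    and L: "g (data s) (s1 \<circ> \<rho>') = L" and b: "2 < b" "b \<le> b'" and R: "emit_pre R s"
    and t: "t1' \<le> t1 + c"
  shows "emit_post (\<lambda>A s'. f A s' @ L) \<rho> b (\<lambda>N. T N + T' N + c) s t s2 t2"
proof -
  note d = emit_post_data[OF 1 R b(1)]
  let ?K = "f (data s) (s \<circ> \<rho>)"
  have L': "g (data s1) (s1 \<circ> \<rho>') = L"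
    using L d by simp
  have R': "s 1 \<le> s 2"
    using R by (auto simp: emit_pre_def)
  have s1: "s1 2 = s 2 + 2 * length ?K"
    using 1 by (simp add: emit_post_def Let_def)
  have a: "s2 (s 2 + 2 * i) = (?K @ L) ! i" if i: "i < length (?K @ L)" for i
  proof (cases "i < length ?K")
    case True
    then have "\<forall>j<length L. s 2 + 2 * i \<noteq> s1 2 + 2 * j"
      using s1 by simp
    then have "s2 (s 2 + 2 * i) = s1 (s 2 + 2 * i)"
      using 2 L' R' d(2) by (simp add: emit_post_def Let_def)
    then show ?thesis
      using 1 True by (simp add: emit_post_def Let_def nth_append)
  next
    case False
    then have "s 2 + 2 * i = s1 2 + 2 * (i - length ?K)"
      using s1 by simp
    then show ?thesis
      using 2 L' False i by (simp add: emit_post_def Let_def nth_append)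
  qed
  have e: "s2 i = s i" if i: "s 1 \<le> i" "\<forall>j<length (?K @ L). i \<noteq> s 2 + 2 * j" for i
  proof -
    have "i \<noteq> s1 2 + 2 * j" if "j < length L" for j
      using i(2)[rule_format, of "length ?K + j"] that s1 by simp
    moreover have "\<forall>j<length ?K. i \<noteq> s 2 + 2 * j"
      using i(2) by simp
    ultimately show ?thesis
      using 1 2 i(1) L' d(2) by (simp add: emit_post_def Let_def)
  qed
  have "s2 2 = s1 2 + 2 * length L" "t2 \<le> t1' + T' (s 0)" "length L \<le> T' (s 0)"
    "t1 \<le> t + T (s 0)" "length ?K \<le> T (s 0)"
    using 1 2 L' d(3) by (simp_all add: emit_post_def Let_def)
  moreover have "s2 i = s i" if "i < b" "i \<noteq> 2" for i
    using 1 2 that b by (simp add: emit_post_def Let_def)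
  ultimately show ?thesis
    unfolding emit_post_def Let_def using a e s1 t by auto
qed

lemma emits_append:
  assumes f: "emits n f" and g: "emits n g"
  shows "emits n (\<lambda>A s. f A s @ g A s)"
proof (rule emitsI)
  fix A and s s' :: "nat \<Rightarrow> nat"
  assume "\<And>i. i < n \<Longrightarrow> s i = s' i"
  then show "f A s @ g A s = f A s' @ g A s'"
    using emits_cong[OF f, of s s' A] emits_cong[OF g, of s s' A] by simp
next
  fix \<rho> :: "nat \<Rightarrow> nat" and b :: nat
  assume *: "\<rho> 0 = 0" "2 < b" "\<And>i. i < n \<Longrightarrow> \<rho> i < b \<and> \<rho> i \<noteq> 2"
  obtain p R T where p: "poly_bd T" "\<And>s t. emit_pre R s \<Longrightarrow> wp p (emit_post f \<rho> b T s t) s t"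
    by (rule emitsE[OF f, of \<rho> b]) (use * in auto)
  obtain q R' T' where q: "poly_bd T'" "\<And>s t. emit_pre R' s \<Longrightarrow> wp q (emit_post g \<rho> b T' s t) s t"
    by (rule emitsE[OF g, of \<rho> b]) (use * in auto)
  have "wp (Seq p q) (emit_post (\<lambda>A s. f A s @ g A s) \<rho> b (\<lambda>N. T N + T' N + 0) s t) s t"
    if R: "emit_pre (R + R') s" for s t
    unfolding wp_Seq
  proof (rule wp_mono[OF p(2)])
    fix s1 t1
    assume s1: "emit_post f \<rho> b T s t s1 t1"
    note d = emit_post_data[OF s1 R *(2)]
    have eq: "g (data s) (s1 \<circ> \<rho>) = g (data s) (s \<circ> \<rho>)"
      by (rule emits_cong[OF g]) (use s1 *(3) in \<open>auto simp: emit_post_def Let_def\<close>)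
    show "wp q (emit_post (\<lambda>A s. f A s @ g A s) \<rho> b (\<lambda>N. T N + T' N + 0) s t) s1 t1"
    proof (rule wp_mono[OF q(2)])
      fix s2 t2
      assume "emit_post g \<rho> b T' s1 t1 s2 t2"
      from emit_post_append[OF s1 this eq *(2) _ R, of 0]
      show "emit_post (\<lambda>A s. f A s @ g A s) \<rho> b (\<lambda>N. T N + T' N + 0) s t s2 t2"
        by (simp add: emit_post_def)
    qed (use d(4) in \<open>auto simp: emit_pre_def\<close>)
  qed (use R in \<open>auto simp: emit_pre_def\<close>)
  then show "\<exists>p R T. poly_bd T \<and> (\<forall>s t. emit_pre R s \<longrightarrow>
      wp p (emit_post (\<lambda>A s. f A s @ g A s) \<rho> b T s t) s t)"
    by (intro exI[of _ "Seq p q"] exI[of _ "R + R'"] exI[of _ "\<lambda>N. T N + T' N + 0"] conjI,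
        intro poly_bd_intros p(1) q(1)) blast
qed

lemma emits_if:
  assumes P: "cmpb n P" and f: "emits n f" and g: "emits n g"
  shows "emits n (\<lambda>A s. if P A s then f A s else g A s)"
proof (rule emitsI)
  fix A and s s' :: "nat \<Rightarrow> nat"
  assume *: "\<And>i. i < n \<Longrightarrow> s i = s' i"
  from cmp_cong[OF P[unfolded cmpb_def], of s s' A] * have "P A s = P A s'"
    by (simp add: of_bool_def split: if_splits)
  then show "(if P A s then f A s else g A s) = (if P A s' then f A s' else g A s')"
    using emits_cong[OF f, of s s' A] emits_cong[OF g, of s s' A] * by simp
next
  fix \<rho> :: "nat \<Rightarrow> nat" and b :: nat
  assume *: "\<rho> 0 = 0" "2 < b" "\<And>i. i < n \<Longrightarrow> \<rho> i < b \<and> \<rho> i \<noteq> 2"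
  obtain c R0 T0 where c: "poly_bd T0"
      "\<And>s t. R0 \<le> s 1 \<Longrightarrow> wp c (cmp_post (\<lambda>A s. of_bool (P A s)) \<rho> b T0 s t) s t"
    by (rule cmpE[OF P[unfolded cmpb_def], of \<rho> b]) (use * in auto)
  obtain p R T where p: "poly_bd T" "\<And>s t. emit_pre R s \<Longrightarrow> wp p (emit_post f \<rho> b T s t) s t"
    by (rule emitsE[OF f, of \<rho> b]) (use * in auto)
  obtain q R' T' where q: "poly_bd T'" "\<And>s t. emit_pre R' s \<Longrightarrow> wp q (emit_post g \<rho> b T' s t) s t"
    by (rule emitsE[OF g, of \<rho> b]) (use * in auto)
  let ?h = "\<lambda>A s. if P A s then f A s else g A s"
  let ?T = "\<lambda>N. T0 N + (T N + T' N) + 1"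
  have "wp (Seq c (Cond b p q)) (emit_post ?h \<rho> b ?T s t) s t"
    if R: "emit_pre (R0 + R + R') s" for s t
    unfolding wp_Seq
  proof (rule wp_mono[OF c(2)])
    fix s1 t1
    assume s1: "cmp_post (\<lambda>A s. of_bool (P A s)) \<rho> b T0 s t s1 t1"
    then have e: "\<And>i. i < b \<or> s 1 \<le> i \<Longrightarrow> s1 i = s i" "t1 \<le> t + T0 (s 0)"
      by (auto simp: cmp_post_def)
    have e': "s1 1 = s 1" "s1 2 = s 2" "s1 0 = s 0"
      using *(2) by (auto intro: e)
    have d: "data s1 = data s"
      using data_eq[of s1 s] e e'(1) by simp
    have \<rho>: "f (data s) (s1 \<circ> \<rho>) = f (data s) (s \<circ> \<rho>)" "g (data s) (s1 \<circ> \<rho>) = g (data s) (s \<circ> \<rho>)"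
      by (rule emits_cong[OF f], simp add: e *(3), rule emits_cong[OF g], simp add: e *(3))
    show "wp (Cond b p q) (emit_post ?h \<rho> b ?T s t) s1 t1"
    proof (cases "P (data s) (s \<circ> \<rho>)")
      case True
      then have b: "s1 b \<noteq> 0"
        using s1 by (simp add: cmp_post_def)
      have "wp p (emit_post ?h \<rho> b ?T s t) s1 (Suc t1)"
        by (rule wp_mono[OF p(2)]) (use R e e' d \<rho> True in \<open>auto simp: emit_pre_def emit_post_def Let_def\<close>)
      with b show ?thesis by simp
    next
      case False
      then have b: "s1 b = 0"
        using s1 by (simp add: cmp_post_def)
      have "wp q (emit_post ?h \<rho> b ?T s t) s1 (Suc t1)"
        by (rule wp_mono[OF q(2)]) (use R e e' d \<rho> False in \<open>auto simp: emit_pre_def emit_post_def Let_def\<close>)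
      with b show ?thesis by simp
    qed
  qed (use R in \<open>auto simp: emit_pre_def\<close>)
  then show "\<exists>p R T. poly_bd T \<and> (\<forall>s t. emit_pre R s \<longrightarrow> wp p (emit_post ?h \<rho> b T s t) s t)"
    by (intro exI[of _ "Seq c (Cond b p q)"] exI[of _ "R0 + R + R'"] exI[of _ ?T] conjI,
        intro poly_bd_intros c(1) p(1) q(1)) blast
qed

lemma emits_for:
  assumes F: "emits (Suc n) (\<lambda>A s. F A s (s n))"
    and inv: "\<And>A s x i. F A (s(n := x)) i = F A s i" and n: "0 < n"
  shows "emits n (\<lambda>A s. concat (map (F A s) [0..<s 0]))"
proof (rule emitsI)
  fix A and s s' :: "nat \<Rightarrow> nat"
  assume *: "\<And>i. i < n \<Longrightarrow> s i = s' i"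
  have "(s(n := i)) j = (s'(n := i)) j" if "j < Suc n" for i j
    using * that by (auto simp: less_Suc_eq)
  from emits_cong[OF F, of "s(n := i)" "s'(n := i)" A for i, OF this]
  have "F A s i = F A s' i" for i
    by (simp add: inv)
  then have "F A s = F A s'" by blast
  then show "concat (map (F A s) [0..<s 0]) = concat (map (F A s') [0..<s' 0])"
    using * n by simp
next
  fix \<rho> :: "nat \<Rightarrow> nat" and b :: nat
  assume *: "\<rho> 0 = 0" "2 < b" "\<And>i. i < n \<Longrightarrow> \<rho> i < b \<and> \<rho> i \<noteq> 2"
  define \<rho>' where "\<rho>' = \<rho>(n := b)"
  obtain p R T where p: "poly_bd T"
      "\<And>s t. emit_pre R s \<Longrightarrow> wp p (emit_post (\<lambda>A s. F A s (s n)) \<rho>' (b + 3) T s t) s t"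
    by (rule emitsE[OF F, of \<rho>' "b + 3"])
      (use * n in \<open>auto simp: less_Suc_eq \<rho>'_def intro: less_trans[of _ b]\<close>)
  \<comment> \<open>Register \<open>b\<close> holds the index, \<open>b + 1\<close> the number of
    rounds left, and \<open>b + 2\<close> the constant \<open>1\<close>; the loop body proper works
    from \<open>b + 3\<close> on.\<close>
  define body where "body = Seq p (Seq (Const (b + 2) 1) (Seq (Add b b (b + 2))
    (Sub (b + 1) (b + 1) (b + 2))))"
  define prg where "prg = Seq (Const b 0) (Seq (Add (b + 1) 0 b) (While (b + 1) body))"
  let ?f = "\<lambda>A s. concat (map (F A s) [0..<s 0])"
  let ?T = "\<lambda>N. N * (T N + 7) + 7"
  have "wp prg (emit_post ?f \<rho> b ?T s t) s t" if R: "emit_pre (R + b + 5) s" for s t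
  proof -
    define L where "L i = F (data s) (s \<circ> \<rho>) i" for i
    define C where "C i = concat (map L [0..<i])" for i
    have C_Suc: "C (Suc i) = C i @ L i" for i
      by (simp add: C_def)
    define P where "P j s' t' \<longleftrightarrow> j \<le> s 0 \<and> s' (b + 1) = j \<and> s' b = s 0 - j \<and>
      emit_post (\<lambda>A x. C (s 0 - j)) \<rho> b (\<lambda>N. (s 0 - j) * (T N + 7) + 2) s t s' t'" for j s' t'
    have b1: "b + 5 \<le> s 1" "s 1 \<le> s 2"
      using R by (auto simp: emit_pre_def)
    show ?thesis
      unfolding prg_def wp_Seq wp_prim
    proof (rule wp_While[where P = P and n = "s 0"])
      show "P (s 0) (s(b := 0, b + 1 := (s(b := 0)) 0 + (s(b := 0)) b)) (Suc (Suc t))"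
        using b1 *(2) by (auto simp: P_def emit_post_def C_def)
    next
      fix j s' t'
      assume P: "P (Suc j) s' t'"
      then have post: "emit_post (\<lambda>A x. C (s 0 - Suc j)) \<rho> b
          (\<lambda>N. (s 0 - Suc j) * (T N + 7) + 2) s t s' t'"
        by (simp add: P_def)
      note d = emit_post_data[OF post R *(2)]
      have j: "s 0 - j = Suc (s 0 - Suc j)"
        using P by (auto simp: P_def)
      have eq: "(\<lambda>A s. F A s (s n)) (data s) (s' \<circ> \<rho>') = L (s 0 - Suc j)"
      proof -
        have "(\<lambda>A s. F A s (s n)) (data s) (s' \<circ> \<rho>') =
            (\<lambda>A s. F A s (s n)) (data s) ((s \<circ> \<rho>)(n := s 0 - Suc j))"
          by (rule emits_cong[OF F])
            (use P * n in \<open>auto simp: P_def \<rho>'_def less_Suc_eq emit_post_def Let_def\<close>)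
        then show ?thesis by (simp add: L_def inv)
      qed
      show "s' (b + 1) \<noteq> 0 \<and> wp body (P j) s' (Suc t')"
      proof
        show "s' (b + 1) \<noteq> 0"
          using P by (simp add: P_def)
        show "wp body (P j) s' (Suc t')"
          unfolding body_def wp_Seq
        proof (rule wp_mono[OF p(2)])
          fix s2 t2
          assume s2: "emit_post (\<lambda>A s. F A s (s n)) \<rho>' (b + 3) T s' (Suc t') s2 t2"
          have pre': "emit_pre R s'"
            using d(4) by (auto simp: emit_pre_def)
          note d2 = emit_post_data[OF s2 pre']
          have keep: "s2 b = s 0 - Suc j" "s2 (b + 1) = Suc j"
            using s2 P *(2) by (simp_all add: emit_post_def Let_def P_def)
          have new: "emit_post (\<lambda>A x. C (s 0 - j)) \<rho> b
              (\<lambda>N. (s 0 - Suc j) * (T N + 7) + 2 + T N + 1) s t s2 t2"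
            using emit_post_append[OF post s2 eq *(2) _ R, of 1] by (simp add: j C_Suc)
          show "wp (Const (b + 2) 1) (wp (Add b b (b + 2))
              (wp (Sub (b + 1) (b + 1) (b + 2)) (P j))) s2 t2"
            using new keep P b1 *(2) d d2
            by (auto simp: P_def emit_post_def Let_def j)
        qed (use d(4) in \<open>auto simp: emit_pre_def\<close>)
      qed
    next
      fix s' t'
      assume P: "P 0 s' t'"
      have "C (s 0) = ?f (data s) (s \<circ> \<rho>)"
        using * by (simp add: C_def L_def[abs_def])
      with P show "s' (b + 1) = 0 \<and> emit_post ?f \<rho> b ?T s t s' (Suc t')"
        by (auto simp: P_def emit_post_def Let_def)
    qed
  qed
  then show "\<exists>p R T. poly_bd T \<and> (\<forall>s t. emit_pre R s \<longrightarrow> wp p (emit_post ?f \<rho> b T s t) s t)"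
    by (intro exI[of _ prg] exI[of _ "R + b + 5"] exI[of _ ?T] conjI, intro poly_bd_intros p(1)) blast
qed

section \<open>Moving input and output\<close>

fun put :: "nat \<Rightarrow> nat list \<Rightarrow> prog" where
  "put a [] = Skip"
| "put a (v # vs) = Seq (Const a v) (put (a + 2) vs)"

lemma wp_put:
  assumes "\<And>s'. (\<And>j. j < length vs \<Longrightarrow> s' (a + 2 * j) = vs ! j) \<Longrightarrow>
      (\<And>i. (\<And>j. j < length vs \<Longrightarrow> i \<noteq> a + 2 * j) \<Longrightarrow> s' i = s i) \<Longrightarrow> Q s' (t + length vs + 1)"
  shows "wp (put a vs) Q s t"
  using assms
proof (induction vs arbitrary: a s t)
  case (Cons v vs)
  have "wp (put (a + 2) vs) Q (s(a := v)) (Suc t)"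
  proof (rule Cons.IH)
    fix s' :: memory
    assume 1: "\<And>j. j < length vs \<Longrightarrow> s' (a + 2 + 2 * j) = vs ! j"
      and 2: "\<And>i. (\<And>j. j < length vs \<Longrightarrow> i \<noteq> a + 2 + 2 * j) \<Longrightarrow> s' i = (s(a := v)) i"
    have "s' (a + 2 * j) = (v # vs) ! j" if "j < length (v # vs)" for j
      using that 1[of "j - 1"] 2[of a] by (cases j) auto
    moreover have "s' i = s i" if i: "\<And>j. j < length (v # vs) \<Longrightarrow> i \<noteq> a + 2 * j" for i
    proof -
      have "i \<noteq> a + 2 + 2 * j" if "j < length vs" for j
        using i[of "Suc j"] that by simp
      then have "s' i = (s(a := v)) i"
        by (rule 2)
      then show ?thesis
        using i[of 0] by auto
    qed
    ultimately have "Q s' (t + length (v # vs) + 1)"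
      by (rule Cons.prems)
    then show "Q s' (Suc t + length vs + 1)"
      by simp
  qed
  then show ?case by simp
qed simp

text \<open>For words that have been read completely before the registers run out. The blank behind
  the word has to be written, since the target cells may hold anything.\<close>

definition short_reloc :: "nat \<Rightarrow> nat list \<Rightarrow> prog" where
  "short_reloc D w = Seq (Const 1 0) (Seq (Add D 0 1) (put (D + 2) (w @ [0])))"

text \<open>The first loop looks for the blank from cell \<open>6\<close> on. The second copies from
  right to left, the blank included: cell \<open>i\<close> goes to cell \<open>D + 2 * i\<close>,
  which may lie inside the word, but only in a part that has been copied already.\<close>

definition long_reloc :: "nat \<Rightarrow> nat list \<Rightarrow> prog" where
  "long_reloc D w =
     Seq (Const 1 6) (Seq (Const 3 1) (Seq (Load 2 1) (Seq (While 2 (Seq (Add 1 1 3) (Load 2 1)))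
     (Seq (Const 4 D) (Seq (Add 4 4 1) (Seq (Add 4 4 1) (Seq (Const 5 5) (Seq (Sub 5 1 5)
     (Seq (While 5 (Seq (Load 2 1) (Seq (Store 4 2) (Seq (Sub 1 1 3) (Seq (Sub 4 4 3)
        (Seq (Sub 4 4 3) (Sub 5 5 3)))))))
     (Seq (Const 1 0) (Seq (Add D 0 1) (put (D + 2) w))))))))))))"

text \<open>The five letters in the cells needed as registers are remembered in the control state. The
  first of them must be known in advance.\<close>

fun reloc :: "nat \<Rightarrow> nat \<Rightarrow> nat list \<Rightarrow> prog" where
  "reloc D 0 w = long_reloc D w"
| "reloc D (Suc m) w = Cond (Suc (length w))
     (Seq (Const 1 1) (Seq (Sub 1 (Suc (length w)) 1)
       (Cond 1 (reloc D m (w @ [2])) (reloc D m (w @ [1])))))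
     (short_reloc D w)"

definition reloc_post :: "nat \<Rightarrow> memory \<Rightarrow> nat \<Rightarrow> memory \<Rightarrow> bool" where
  "reloc_post D s l s' \<longleftrightarrow> (\<forall>i\<le>Suc l. s' (D + 2 * i) = s i)"

lemma wp_short_reloc:
  assumes s: "s 0 = S 0" "S (Suc (length w)) = 0" "\<And>i. i < length w \<Longrightarrow> S (Suc i) = w ! i"
    and D: "6 \<le> D"
  shows "wp (short_reloc D w) (\<lambda>s' t'. reloc_post D S (length w) s' \<and> t' \<le> t + length w + 4) s t"
  unfolding short_reloc_def wp_Seq wp_prim
proof (rule wp_put, goal_cases)
  case (1 s')
  have "s' (D + 2 * i) = S i" if i: "i \<le> Suc (length w)" for i
  proof (cases i)
    case 0
    have "s' D = (s(1 := 0, D := (s(1 := 0)) 0 + (s(1 := 0)) 1)) D"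
      by (rule 1(2)) simp
    with 0 s D show ?thesis by simp
  next
    case (Suc j)
    then have "s' (D + 2 * i) = (w @ [0]) ! j"
      using 1(1)[of j] i by simp
    with Suc s i show ?thesis by (auto simp: nth_append less_Suc_eq_le)
  qed
  then show ?case by (simp add: reloc_post_def)
qed

lemma wp_long_reloc:
  assumes w: "length w = 5" "\<And>i. i < 5 \<Longrightarrow> S (Suc i) = w ! i" and l: "5 \<le> l"
    and s: "s 0 = S 0" "\<And>i. 5 < i \<Longrightarrow> i \<le> Suc l \<Longrightarrow> s i = S i"
    and S: "\<And>i. 5 < i \<Longrightarrow> i \<le> l \<Longrightarrow> S i \<noteq> 0" "S (Suc l) = 0"
    and D: "6 \<le> D"
  shows "wp (long_reloc D w) (\<lambda>s' t'. reloc_post D S l s' \<and> t' \<le> t + 10 * l + 20) s t"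
proof -
  define R where "R \<equiv> \<lambda>s' t'. reloc_post D S l s' \<and> t' \<le> t + 10 * l + 20"
  define P where "P j s' t' \<longleftrightarrow> j \<le> l - 5 \<and> s' 1 = Suc l - j \<and> s' 2 = S (Suc l - j) \<and> s' 3 = 1 \<and>
    s' 0 = S 0 \<and> (\<forall>i. 5 < i \<longrightarrow> i \<le> Suc l \<longrightarrow> s' i = S i) \<and> t' \<le> t + 3 + 3 * (l - 5 - j)"
    for j and s' :: memory and t'
  \<comment> \<open>With \<open>j\<close> cells to go, the cells \<open>6\<close> to
    \<open>j + 5\<close> are still in place and those behind them have arrived at their new
    address.\<close>
  define P' where "P' j s' t' \<longleftrightarrow> j \<le> l - 4 \<and> s' 5 = j \<and> s' 1 = j + 5 \<and> s' 4 = D + 2 * (j + 5) \<and>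
    s' 3 = 1 \<and> s' 0 = S 0 \<and> (\<forall>i. 5 < i \<longrightarrow> i \<le> j + 5 \<longrightarrow> s' i = S i) \<and>
    (\<forall>i. j + 5 < i \<longrightarrow> i \<le> Suc l \<longrightarrow> s' (D + 2 * i) = S i) \<and>
    t' \<le> t + 10 + 3 * (l - 5) + 7 * (l - 4 - j)" for j and s' :: memory and t'
  \<comment> \<open>After both loops the registers are free, and the number and the five remembered
    letters are put in front of the copied part.\<close>
  have fin: "wp (put (D + 2) w) R (s'(1 := 0, D := S 0)) (Suc (Suc t'))"
    if s': "\<And>i. 5 < i \<Longrightarrow> i \<le> Suc l \<Longrightarrow> s' (D + 2 * i) = S i"
      and t': "t' \<le> t + 10 * l + 10" for s' t'
  proof (rule wp_put, goal_cases put)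
    case (put s2)
    have "s2 (D + 2 * i) = S i" if i: "i \<le> Suc l" for i
    proof -
      consider "i = 0" | j where "i = Suc j" "j < 5" | "5 < i"
        by (cases i) force+
      then show ?thesis
      proof cases
        case 1
        then show ?thesis using put(2)[of D] by simp
      next
        case 2
        then show ?thesis using put(1)[of j] w by simp
      next
        case 3
        have "s2 (D + 2 * i) = (s'(1 := 0, D := S 0)) (D + 2 * i)"
          by (rule put(2)) (use 3 w in simp)
        then show ?thesis using 3 i D s' by simp
      qed
    qed
    then show ?case using t' w by (simp add: reloc_post_def R_def)
  qed
  show ?thesis
    unfolding long_reloc_def wp_Seq wp_prim R_def[symmetric]
  proof (rule wp_While[where P = P and n = "l - 5"], goal_cases)
    case 1
    then show ?case using s l by (auto simp: P_def)
  next
    case (2 j s' t')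
    then have "Suc l - j = Suc (Suc l - Suc j)"
      by (auto simp: P_def)
    with 2 S(1)[of "Suc l - Suc j"] l show ?case
      by (auto simp: P_def)
  next
    case (3 s' t')
    have "wp (While 5 (Seq (Load 2 1) (Seq (Store 4 2) (Seq (Sub 1 1 3) (Seq (Sub 4 4 3)
        (Seq (Sub 4 4 3) (Sub 5 5 3)))))))
        (\<lambda>s t. wp (put (D + 2) w) R (s(1 := 0, D := (s(1 := 0)) 0 + (s(1 := 0)) 1)) (Suc (Suc t))) s'' t''"
      if "P' (l - 4) s'' t''" for s'' t''
    proof (rule wp_While[where P = P', OF that], goal_cases)
      case (1 j s1 t1)
      have j: "Suc j \<le> l - 4" "s1 5 = Suc j" "s1 1 = j + 6" "s1 4 = D + 2 * (j + 6)" "s1 3 = 1"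
        and s1: "\<And>i. 5 < i \<Longrightarrow> i \<le> j + 6 \<Longrightarrow> s1 i = S i"
          "\<And>i. j + 6 < i \<Longrightarrow> i \<le> Suc l \<Longrightarrow> s1 (D + 2 * i) = S i"
        and t1: "s1 0 = S 0" "t1 \<le> t + 10 + 3 * (l - 5) + 7 * (l - 4 - Suc j)"
        using 1 by (simp_all add: P'_def)
      define s2 where "s2 = s1(2 := S (j + 6), D + 2 * (j + 6) := S (j + 6), 1 := j + 5,
        4 := D + 2 * (j + 5) + 1, 4 := D + 2 * (j + 5), 5 := j)"
      have "s2 i = S i" if "5 < i" "i \<le> j + 5" for i
        using that D s1(1)[of i] by (simp add: s2_def)
      moreover have "s2 (D + 2 * i) = S i" if "j + 5 < i" "i \<le> Suc l" for i
        using that D s1(2)[of i] by (cases "i = j + 6") (simp_all add: s2_def)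
      moreover have "l - 4 - j = Suc (l - 4 - Suc j)"
        using j by simp
      ultimately have "P' j s2 (t1 + 7)"
        using j(1,5) t1 D by (simp add: P'_def) (simp add: s2_def)
      with j s1(1)[of "j + 6"] D show ?case
        by (simp add: s2_def eval_nat_numeral)
    next
      case (2 s1 t1)
      then show ?case
        using fin[of s1 "Suc t1"] l by (auto simp: P'_def)
    qed
    moreover have "P' (l - 4) (s'(4 := D, 4 := D + s' 1, 4 := D + s' 1 + s' 1, 5 := 5, 5 := s' 1 - 5))
        (Suc (Suc (Suc (Suc (Suc (Suc t'))))))"
      using 3 S l by (auto simp: P_def P'_def)
    ultimately show ?case
      using 3 S by (simp add: P_def)
  qed
qed

text \<open>\<open>S\<close> is the original memory. The current memory has to agree with it only in
  cell \<open>0\<close> and behind the letters remembered in \<open>w\<close>; as \<open>w\<close>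
  is not empty, cell \<open>1\<close> can be overwritten when the next letter is tested.\<close>

lemma wp_reloc:
  assumes "length w + m = 5" "w \<noteq> []" "length w \<le> l" "\<And>i. i < length w \<Longrightarrow> S (Suc i) = w ! i"
    and S: "S (Suc l) = 0" "\<And>i. 0 < i \<Longrightarrow> i \<le> l \<Longrightarrow> S i = 1 \<or> S i = 2"
    and "s 0 = S 0" "\<And>i. length w < i \<Longrightarrow> i \<le> Suc l \<Longrightarrow> s i = S i"
    and D: "6 \<le> D"
  shows "wp (reloc D m w) (\<lambda>s' t'. reloc_post D S l s' \<and> t' \<le> t + 10 * l + 20 + 4 * m) s t"
  using assms(1-4,7,8)
proof (induction m arbitrary: w s t)
  case 0
  then have w: "length w = 5" by simp
  have "S i \<noteq> 0" if "5 < i" "i \<le> l" for i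
    using S(2)[of i] that by auto
  then show ?case
    using wp_long_reloc[of w S l s D t] 0 S D w by simp
next
  case (Suc m)
  let ?i = "Suc (length w)"
  show ?case
  proof (cases "length w = l")
    case True
    have "wp (short_reloc D w) (\<lambda>s' t'. reloc_post D S l s' \<and> t' \<le> t + 10 * l + 20 + 4 * Suc m) s (Suc t)"
      by (rule wp_mono[OF wp_short_reloc[of s S w]]) (use Suc.prems S D True in auto)
    moreover have "s ?i = 0"
      using Suc.prems(6)[of ?i] S(1) True by simp
    ultimately show ?thesis by simp
  next
    case False
    then have i: "?i \<le> l" using Suc.prems by simp
    then have si: "s ?i = S ?i" "S ?i = 1 \<or> S ?i = 2"
      using Suc.prems(6)[of ?i] S(2)[of ?i] by auto
    have *: "wp (reloc D m (w @ [S ?i])) (\<lambda>s' t'. reloc_post D S l s' \<and> t' \<le> t + 10 * l + 20 + 4 * Suc m)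
        (s(1 := S ?i - 1)) (t + 4)"
      by (rule wp_mono[OF Suc.IH])
        (use Suc.prems i in \<open>auto simp: nth_append less_Suc_eq\<close>)
    have "1 < ?i" using Suc.prems(2) by (cases w) auto
    with * si show ?thesis by (auto simp: eval_nat_numeral)
  qed
qed

section \<open>Computing the loop bound\<close>

definition count_len :: "nat \<Rightarrow> prog" where
  "count_len D = Seq (Const 1 2) (Seq (Const 4 1) (Seq (Const 2 (D + 2)) (Seq (Load 3 2)
     (Seq (While 3 (Seq (Add 1 1 4) (Seq (Add 2 2 4) (Seq (Add 2 2 4) (Load 3 2)))))
     (Seq (Const 2 D) (Seq (Load 2 2) (Add 1 1 2)))))))"

lemma wp_count_len:
  assumes s: "reloc_post D S l s" and S: "S (Suc l) = 0" "\<And>i. 0 < i \<Longrightarrow> i \<le> l \<Longrightarrow> S i \<noteq> 0"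
    and D: "6 \<le> D"
  shows "wp (count_len D) (\<lambda>s' t'. s' 1 = S 0 + l + 2 \<and> (\<forall>i\<ge>5. s' i = s i) \<and> t' \<le> t + 5 * l + 9) s t"
proof -
  define P where "P j s' t' \<longleftrightarrow> j \<le> l \<and> s' 1 = 2 + (l - j) \<and> s' 2 = D + 2 * (l - j + 1) \<and>
    s' 3 = S (l - j + 1) \<and> s' 4 = 1 \<and> (\<forall>i\<ge>5. s' i = s i) \<and> t' \<le> t + 4 + 5 * (l - j)" for j s' t'
  have s: "s (D + 2 * i) = S i" if "i \<le> Suc l" for i
    using s that by (simp add: reloc_post_def)
  show ?thesis
    unfolding count_len_def wp_Seq wp_prim
  proof (rule wp_While[where P = P and n = l], goal_cases)
    case 1
    then show ?case using s[of 1] D by (simp add: P_def)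
  next
    case (2 j s' t')
    then have j: "l - j = Suc (l - Suc j)" "Suc j \<le> l"
      by (auto simp: P_def)
    have "s' (D + 2 * (l - j + 1)) = S (l - j + 1)"
      using 2 D s[of "l - j + 1"] by (simp add: P_def)
    then show ?case
      using 2 j S(2)[of "l - Suc j + 1"] by (simp add: P_def)
  next
    case (3 s' t')
    then show ?case using s[of 0] S D by (simp add: P_def)
  qed
qed

definition mulstep :: prog where
  "mulstep = Seq (Const 3 0) (Seq (Add 2 1 3) (Seq (Const 4 1)
     (Seq (While 2 (Seq (Add 3 3 0) (Sub 2 2 4))) (Seq (Const 4 0) (Add 0 3 4)))))"

fun powp :: "nat \<Rightarrow> prog" where
  "powp 0 = Const 0 1"
| "powp (Suc m) = Seq (powp m) mulstep"

lemma wp_mulstep: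
  "wp mulstep (\<lambda>s' t'. s' 0 = s 0 * s 1 \<and> (\<forall>i. i = 1 \<or> 5 \<le> i \<longrightarrow> s' i = s i) \<and>
     t' \<le> t + 3 * s 1 + 6) s t"
proof -
  define P where "P j s' t' \<longleftrightarrow> j \<le> s 1 \<and> s' 2 = j \<and> s' 3 = (s 1 - j) * s 0 \<and> s' 4 = 1 \<and> s' 0 = s 0 \<and>
    (\<forall>i. i = 1 \<or> 5 \<le> i \<longrightarrow> s' i = s i) \<and> t' \<le> t + 3 + 3 * (s 1 - j)" for j s' t'
  show ?thesis
    unfolding mulstep_def wp_Seq wp_prim
  proof (rule wp_While[where P = P and n = "s 1"], goal_cases)
    case 1
    then show ?case by (simp add: P_def)
  next
    case (2 j s' t')
    then have "s 1 - j = Suc (s 1 - Suc j)" by (auto simp: P_def)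
    with 2 show ?case by (auto simp: P_def)
  next
    case (3 s' t')
    then show ?case by (simp add: P_def algebra_simps)
  qed
qed

lemma wp_powp:
  "wp (powp m) (\<lambda>s' t'. s' 0 = s 1 ^ m \<and> (\<forall>i. i = 1 \<or> 5 \<le> i \<longrightarrow> s' i = s i) \<and>
     t' \<le> t + 1 + m * (3 * s 1 + 6)) s t"
proof (induction m)
  case (Suc m)
  show ?case
    unfolding powp.simps wp_Seq
  proof (rule wp_mono[OF Suc.IH], elim conjE)
    fix s1 t1
    assume "s1 0 = s 1 ^ m" "\<forall>i. i = 1 \<or> 5 \<le> i \<longrightarrow> s1 i = s i" "t1 \<le> t + 1 + m * (3 * s 1 + 6)"
    then show "wp mulstep (\<lambda>s' t'. s' 0 = s 1 ^ Suc m \<and> (\<forall>i. i = 1 \<or> 5 \<le> i \<longrightarrow> s' i = s i) \<and>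
        t' \<le> t + 1 + Suc m * (3 * s 1 + 6)) s1 t1"
      by (intro wp_mono[OF wp_mulstep]) auto
  qed
qed simp

text \<open>The first six letters of the output are constants, since their cells serve as registers of
  the copying loop.\<close>

definition final_copy :: prog where
  "final_copy = Seq (Const 4 0) (Seq (Add 0 3 4) (Seq (Const 4 13) (Seq (Add 1 1 4) (Seq (Sub 2 2 1)
     (Seq (Const 3 7) (Seq (Const 5 1)
     (Seq (While 2 (Seq (Load 4 1) (Seq (Store 3 4) (Seq (Add 3 3 5) (Seq (Add 1 1 5)
        (Seq (Add 1 1 5) (Seq (Sub 2 2 5) (Sub 2 2 5))))))))
     (Seq (Const 1 2) (Seq (Const 2 1) (Seq (Const 3 2) (Seq (Const 4 1) (Seq (Const 5 2)
     (Const 6 1)))))))))))))"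

text \<open>The letters move to the left, so copying from left to right reads each of them before
  its cell is overwritten. Letter \<open>6\<close> lies in cell \<open>D + 13\<close> and goes to
  cell \<open>7\<close>, the first one behind the registers. Register \<open>2\<close> counts down
  in steps of two because the source cells are two apart.\<close>

lemma wp_final_copy:
  assumes s: "s 1 = D" "s 2 = D + 1 + 2 * length L" "\<And>i. i < length L \<Longrightarrow> s (D + 1 + 2 * i) = L ! i"
  shows "wp final_copy (\<lambda>s' t'. s' 0 = s 3 \<and>
     (take 6 L = [2, 1, 2, 1, 2, 1] \<longrightarrow> (\<forall>i<length L. s' (Suc i) = L ! i)) \<and>
     t' \<le> t + 8 * length L + 14) s t"
proof -
  let ?n = "length L - 6"
  define P where "P j s' t' \<longleftrightarrow> j \<le> ?n \<and> s' 2 = 2 * j \<and> s' 3 = 7 + (?n - j) \<and>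
    s' 1 = D + 13 + 2 * (?n - j) \<and> s' 5 = 1 \<and> s' 0 = s 3 \<and> (\<forall>i<?n - j. s' (7 + i) = L ! (6 + i)) \<and>
    (\<forall>i \<ge> 7 + (?n - j). s' i = s i) \<and> t' \<le> t + 7 + 8 * (?n - j)" for j s' t'
  show ?thesis
    unfolding final_copy_def wp_Seq wp_prim
  proof (rule wp_While[where P = P and n = "?n"], goal_cases)
    case 1
    then show ?case using s by (simp add: P_def)
  next
    case (2 j s' t')
    define i where "i = ?n - Suc j"
    have i: "?n - j = Suc i" "6 + i < length L"
      using 2 by (auto simp: P_def i_def)
    have s': "s' 2 = 2 * Suc j" "s' 3 = 7 + i" "s' 1 = D + 13 + 2 * i" "s' 5 = 1" "s' 0 = s 3"
      "\<And>m. m < i \<Longrightarrow> s' (7 + m) = L ! (6 + m)" "\<And>m. 7 + i \<le> m \<Longrightarrow> s' m = s m"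
      "t' \<le> t + 7 + 8 * i" "j \<le> ?n"
      using 2 unfolding P_def i_def[symmetric] by auto
    have "s (D + 1 + 2 * (6 + i)) = L ! (6 + i)"
      by (rule s(3)[OF i(2)])
    then have v: "s' (D + 13 + 2 * i) = L ! (6 + i)"
      using s'(7) by (simp add: algebra_simps)
    define s2 where "s2 = s'(4 := L ! (6 + i), 7 + i := L ! (6 + i), 3 := Suc (7 + i),
      1 := Suc (D + 13 + 2 * i), 1 := Suc (Suc (D + 13 + 2 * i)), 2 := Suc (2 * j), 2 := 2 * j)"
    have "\<forall>m<Suc i. s2 (7 + m) = L ! (6 + m)"
      using s'(6) by (auto simp: s2_def less_Suc_eq)
    then have "P j s2 (t' + 8)"
      using s' unfolding P_def i by (simp add: s2_def)
    with s' v show ?case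
      by (simp add: s2_def eval_nat_numeral)
  next
    case (3 s' t')
    define s2 where "s2 = s'(1 := 2, 2 := 1, 3 := 2, 4 := 1, 5 := 2, 6 := (1 :: nat))"
    have "s2 (Suc i) = L ! i" if L: "take 6 L = [2, 1, 2, 1, 2, 1]" and i: "i < length L" for i
    proof (cases "i < 6")
      case True
      then have "L ! i = [2, 1, 2, 1, 2, 1] ! i"
        using L by (metis nth_take)
      with True show ?thesis
        by (auto simp: s2_def eval_nat_numeral less_Suc_eq)
    next
      case False
      then obtain m where m: "i = 6 + m" by (metis le_Suc_ex not_less)
      with 3 i have "s' (7 + m) = L ! (6 + m)"
        by (simp add: P_def)
      with m show ?thesis by (simp add: s2_def)
    qed
    moreover have "s2 0 = s 3" "s' 2 = 0" "t' + 7 \<le> t + 8 * length L + 14"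
      using 3 by (auto simp: P_def s2_def)
    ultimately show ?case
      unfolding wp_prim s2_def[symmetric] by simp
  qed
qed

definition word_array :: "word \<Rightarrow> nat \<Rightarrow> (nat \<Rightarrow> nat) \<Rightarrow> bool" where
  "word_array x k A \<longleftrightarrow> A 0 = k \<and> (\<forall>i<length x. A (Suc i) = letter_code (x ! i)) \<and> A (Suc (length x)) = 0"

text \<open>That the first letter is \<open>False\<close> is what the relocation has to know in
  advance. The condition on the first six letters of the list can only be verified for a concrete
  \<open>f\<close> and a concrete input, so it is a premise inside the postcondition.\<close>

theorem emitting_program:
  assumes f: "emits 1 f" and g: "cmp 1 g"
  obtains p T where "poly_bd T" "\<And>s x k. is_output s x k \<Longrightarrow> x \<noteq> [] \<Longrightarrow> \<not> hd x \<Longrightarrow>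
    wp p (\<lambda>s' t'. t' \<le> T ((k + length x + 2) ^ Suc e) \<and> (\<exists>A. word_array x k A \<and>
      (let N = (k + length x + 2) ^ Suc e; L = f A (\<lambda>_. N) in
        take 6 L = [2, 1, 2, 1, 2, 1] \<longrightarrow> s' 0 = g A (\<lambda>_. N) \<and> (\<forall>i<length L. s' (Suc i) = L ! i)))) s 0"
proof -
  obtain pf R T where pf: "poly_bd T" "\<And>s t. emit_pre R s \<Longrightarrow> wp pf (emit_post f (\<lambda>_. 0) 3 T s t) s t"
    by (rule emitsE[OF f, of "\<lambda>_. 0" 3]) auto
  obtain pg R' T' where pg: "poly_bd T'" "\<And>s t. R' \<le> s 1 \<Longrightarrow> wp pg (cmp_post g (\<lambda>_. 0) 3 T' s t) s t"
    by (rule cmpE[OF g, of "\<lambda>_. 0" 3]) auto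
  \<comment> \<open>Room for the registers of \<open>pf\<close> and of \<open>pg\<close> and for
    those of the moving programs.\<close>
  define D where "D = R + R' + 6"
  define p where "p = Seq (reloc D 4 [1]) (Seq (count_len D) (Seq (powp (Suc e))
    (Seq (Const 1 D) (Seq (Const 2 (D + 1)) (Seq pf (Seq pg final_copy))))))"
  let ?T = "\<lambda>N. 15 * N + (46 + Suc e * (3 * N + 6)) + 8 * T N + T N + T' N + 20"
  have "wp p (\<lambda>s' t'. t' \<le> ?T ((k + length x + 2) ^ Suc e) \<and> (\<exists>A. word_array x k A \<and>
      (let N = (k + length x + 2) ^ Suc e; L = f A (\<lambda>_. N) in
        take 6 L = [2, 1, 2, 1, 2, 1] \<longrightarrow> s' 0 = g A (\<lambda>_. N) \<and> (\<forall>i<length L. s' (Suc i) = L ! i)))) s 0"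
    (is "wp p ?Q s 0") if s: "is_output s x k" and x: "x \<noteq> []" "\<not> hd x" for s x k
  proof -
    define l where "l = length x"
    define B where "B = k + l + 2"
    define N where "N = B ^ Suc e"
    have BN: "B \<le> N"
      unfolding N_def using self_le_power[of B "Suc e"] by (simp add: B_def)
    have sx: "s 0 = k" "\<And>i. i < l \<Longrightarrow> s (Suc i) = letter_code (x ! i)" "s (Suc l) = 0"
      using s by (auto simp: is_output_def l_def)
    have l: "0 < l" using x by (simp add: l_def)
    have s1: "s 1 = 1"
      using sx(2)[of 0] l x by (simp add: letter_code_def hd_conv_nth l_def)
    have cells: "s i = 1 \<or> s i = 2" if "0 < i" "i \<le> l" for i
      using sx(2)[of "i - 1"] that by (cases i) (auto simp: letter_code_def)
    have nz: "s i \<noteq> 0" if "0 < i" "i \<le> l" for i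
      using cells[OF that] by auto
    have 1: "wp (reloc D 4 [1]) (\<lambda>s' t'. reloc_post D s l s' \<and> t' \<le> 0 + 10 * l + 20 + 4 * 4) s 0"
      by (rule wp_reloc[where S = s and l = l, OF _ _ _ _ sx(3) cells])
        (use s1 l in \<open>auto simp: D_def\<close>)
    show ?thesis
      unfolding p_def wp_Seq
    proof (rule wp_mono[OF 1], elim conjE)
      fix s1 t1
      assume s1: "reloc_post D s l s1" and t1: "t1 \<le> 0 + 10 * l + 20 + 4 * 4"
      have 2: "wp (count_len D) (\<lambda>s' t'. s' 1 = s 0 + l + 2 \<and> (\<forall>i\<ge>5. s' i = s1 i) \<and> t' \<le> t1 + 5 * l + 9) s1 t1"
        by (rule wp_count_len[where S = s and l = l, OF s1 sx(3) nz]) (simp_all add: D_def)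
      show "wp (count_len D) (wp (powp (Suc e)) (wp (Const 1 D) (wp (Const 2 (D + 1))
          (wp pf (wp pg (wp final_copy ?Q)))))) s1 t1"
      proof (rule wp_mono[OF 2], elim conjE)
        fix s2 t2
        assume s2: "s2 1 = s 0 + l + 2" "\<forall>i\<ge>5. s2 i = s1 i" and t2: "t2 \<le> t1 + 5 * l + 9"
        show "wp (powp (Suc e)) (wp (Const 1 D) (wp (Const 2 (D + 1))
          (wp pf (wp pg (wp final_copy ?Q))))) s2 t2"
        proof (rule wp_mono[OF wp_powp], elim conjE, unfold wp_prim)
          fix s3 t3
          assume s3: "s3 0 = s2 1 ^ Suc e" "\<forall>i. i = 1 \<or> 5 \<le> i \<longrightarrow> s3 i = s2 i"
            and t3: "t3 \<le> t2 + 1 + Suc e * (3 * s2 1 + 6)"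
          define s4 where "s4 = s3(1 := D, 2 := D + 1)"
          have N: "s4 0 = N"
            using s3(1) s2(1) sx(1) by (simp add: s4_def N_def B_def)
          define A where "A = data s4"
          have A: "A i = s i" if "i \<le> Suc l" for i
            using that s1 s2(2) s3(2) by (simp add: A_def data_def s4_def reloc_post_def D_def)
          then have wa: "word_array x k A"
            using sx by (simp add: word_array_def l_def)
          define L where "L = f A (\<lambda>_. N)"
          have fA: "f (data s4) (s4 \<circ> (\<lambda>_. 0)) = L"
            by (simp add: L_def A_def N comp_def)
          have pre: "emit_pre R s4"
            unfolding emit_pre_def by (auto simp: s4_def D_def intro!: exI[of _ 0])
          have "wp pf (wp pg (wp final_copy ?Q)) s4 (Suc (Suc t3))"
          proof (rule wp_mono[OF pf(2)[OF pre]])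
            fix s5 t5
            assume s5: "emit_post f (\<lambda>_. 0) 3 T s4 (Suc (Suc t3)) s5 t5"
            note d = emit_post_data[OF s5 pre]
            have s5': "s5 2 = D + 1 + 2 * length L" "\<And>i. i < length L \<Longrightarrow> s5 (D + 1 + 2 * i) = L ! i"
              "t5 \<le> Suc (Suc t3) + T N" "length L \<le> T N"
              using s5 by (simp_all add: emit_post_def fA N) (simp_all add: s4_def)
            show "wp pg (wp final_copy ?Q) s5 t5"
            proof (rule wp_mono[OF pg(2)])
              fix s6 t6
              assume s6: "cmp_post g (\<lambda>_. 0) 3 T' s5 t5 s6 t6"
              have s6': "s6 3 = g A (\<lambda>_. N)" "\<And>i. i < 3 \<or> D \<le> i \<Longrightarrow> s6 i = s5 i" "t6 \<le> t5 + T' N"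
                using s6 d N by (auto simp: cmp_post_def A_def comp_def s4_def)
              have fc: "wp final_copy (\<lambda>s' t'. s' 0 = s6 3 \<and>
                  (take 6 L = [2, 1, 2, 1, 2, 1] \<longrightarrow> (\<forall>i<length L. s' (Suc i) = L ! i)) \<and>
                  t' \<le> t6 + 8 * length L + 14) s6 t6"
                by (rule wp_final_copy[where D = D]) (use s5' d in \<open>simp_all add: s6'(2) s4_def\<close>)
              show "wp final_copy ?Q s6 t6"
              proof (rule wp_mono[OF fc], elim conjE, intro conjI)
                fix s' t'
                assume t': "t' \<le> t6 + 8 * length L + 14"
                have "t3 \<le> 15 * B + (46 + Suc e * (3 * B + 6))"
                  using t1 t2 t3 s2(1) sx(1) by (simp add: B_def)
                moreover have "Suc e * (3 * B + 6) \<le> Suc e * (3 * N + 6)"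
                  using BN by (intro mult_le_mono2) simp
                ultimately have "t' \<le> ?T N"
                  using t' s6'(3) s5'(3,4) BN by linarith
                then show "t' \<le> ?T ((k + length x + 2) ^ Suc e)"
                  unfolding l_def[symmetric] B_def[symmetric] N_def[symmetric] .
              next
                fix s' t'
                assume "s' 0 = s6 3"
                  "take 6 L = [2, 1, 2, 1, 2, 1] \<longrightarrow> (\<forall>i<length L. s' (Suc i) = L ! i)"
                with wa s6'(1) show "\<exists>A. word_array x k A \<and>
                   (let N = (k + length x + 2) ^ Suc e; L = f A (\<lambda>_. N) in
                   take 6 L = [2, 1, 2, 1, 2, 1] \<longrightarrow> s' 0 = g A (\<lambda>_. N) \<and> (\<forall>i<length L. s' (Suc i) = L ! i))"
                  unfolding l_def[symmetric] B_def[symmetric] N_def[symmetric] Let_def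
                  by (intro exI[of _ A]) (simp add: L_def)
              qed
            qed (use d in \<open>simp add: s4_def D_def\<close>)
          qed
          then show "wp pf (wp pg (wp final_copy ?Q)) (s3(1 := D, 2 := D + 1)) (Suc (Suc t3))"
            by (simp add: s4_def)
        qed
      qed
    qed
  qed
  moreover have "poly_bd ?T"
    by (intro poly_bd_intros pf(1) pg(1))
  ultimately show thesis
    using that by blast
qed

section \<open>Composing reductions\<close>

text \<open>\<open>emb K p\<close> simulates \<open>p\<close> on the cells \<open>K, K + 2, K + 4, \<dots>\<close>, so that two programs can be run
  one after the other without the second seeing what the first has left behind. The cells \<open>1\<close> and
  \<open>2\<close> serve for address computations.\<close>

fun emb :: "nat \<Rightarrow> prog \<Rightarrow> prog" where
  "emb K Skip = Skip"
| "emb K (Const r n) = Const (2 * r + K) n"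
| "emb K (Add r a b) = Add (2 * r + K) (2 * a + K) (2 * b + K)"
| "emb K (Sub r a b) = Sub (2 * r + K) (2 * a + K) (2 * b + K)"
| "emb K (Load r a) = Seq (Const 2 K) (Seq (Add 1 (2 * a + K) (2 * a + K)) (Seq (Add 1 1 2) (Load (2 * r + K) 1)))"
| "emb K (Store a r) = Seq (Const 2 K) (Seq (Add 1 (2 * a + K) (2 * a + K)) (Seq (Add 1 1 2) (Store 1 (2 * r + K))))"
| "emb K (Seq p q) = Seq (emb K p) (emb K q)"
| "emb K (Cond r p q) = Cond (2 * r + K) (emb K p) (emb K q)"
| "emb K (While r p) = While (2 * r + K) (emb K p)"

definition emb_post :: "nat \<Rightarrow> memory \<Rightarrow> memory \<Rightarrow> memory \<Rightarrow> nat \<Rightarrow> bool" where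
  "emb_post K s' \<sigma> \<sigma>' u \<longleftrightarrow> (\<forall>a. \<sigma>' (2 * a + K) = s' a) \<and>
     (\<forall>b. b \<noteq> 1 \<longrightarrow> b \<noteq> 2 \<longrightarrow> (\<forall>a. b \<noteq> 2 * a + K) \<longrightarrow> \<sigma>' b = \<sigma> b)"

lemma emb_post_trans: "emb_post K s1 \<sigma> \<sigma>1 u \<Longrightarrow> emb_post K s2 \<sigma>1 \<sigma>2 v \<Longrightarrow> emb_post K s2 \<sigma> \<sigma>2 v"
  by (simp add: emb_post_def)

lemma wp_emb:
  assumes "exec p s t s'" "3 \<le> K" "\<And>a. \<sigma> (2 * a + K) = s a"
  shows "wp (emb K p) (emb_post K s' \<sigma>) \<sigma> u"
  using assms
proof (induction arbitrary: \<sigma> u rule: exec.induct)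
  case (exec_Load r a s)
  then show ?case
    by (simp add: emb_post_def mult_2[symmetric])
next
  case (exec_Store a r s)
  then show ?case
    by (simp add: emb_post_def mult_2[symmetric])
next
  case (exec_Seq p s t s' q t' s'' \<sigma> u)
  show ?case
    unfolding emb.simps wp_Seq
  proof (rule wp_mono[OF exec_Seq.IH(1)[OF exec_Seq.prems]])
    fix \<sigma>1 u1
    assume 1: "emb_post K s' \<sigma> \<sigma>1 u1"
    show "wp (emb K q) (emb_post K s'' \<sigma>) \<sigma>1 u1"
      by (rule wp_mono[OF exec_Seq.IH(2)]) (use exec_Seq.prems 1 emb_post_trans[OF 1] in \<open>auto simp: emb_post_def\<close>)
  qed
next
  case (exec_While_True s r p t s' t' s'' \<sigma> u)
  have "wp (emb K p) (wp (While (2 * r + K) (emb K p)) (emb_post K s'' \<sigma>)) \<sigma> (Suc u)"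
  proof (rule wp_mono[OF exec_While_True.IH(1)[OF exec_While_True.prems]])
    fix \<sigma>1 u1
    assume 1: "emb_post K s' \<sigma> \<sigma>1 u1"
    have "wp (emb K (While r p)) (emb_post K s'' \<sigma>) \<sigma>1 u1"
      by (rule wp_mono[OF exec_While_True.IH(2)])
        (use exec_While_True.prems 1 emb_post_trans[OF 1] in \<open>auto simp: emb_post_def\<close>)
    then show "wp (While (2 * r + K) (emb K p)) (emb_post K s'' \<sigma>) \<sigma>1 u1"
      by simp
  qed
  with exec_While_True show ?case
    by (simp add: wp_While_unfold)
next
  case (exec_While_False s r p \<sigma> u)
  then have "exec (While (2 * r + K) (emb K p)) \<sigma> 1 \<sigma>"
    by (intro exec.exec_While_False) simp
  then show ?case
    using exec_While_False by (auto simp: wp_def emb_post_def)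
next
  case exec_Cond_True
  then show ?case by simp
next
  case exec_Cond_False
  then show ?case by simp
qed (auto simp: emb_post_def)

lemma computable_wp:
  "computable f \<longleftrightarrow> (\<exists>p. \<forall>n. wp p (\<lambda>s t. s 0 = f n) (input_memory [] n) 0)"
  by (simp add: computable_def wp_def)

text \<open>Cell \<open>3\<close> is blank, so adding it copies the argument to the cells
  \<open>4\<close> and \<open>5\<close>. One program is then simulated on the even cells from
  \<open>4\<close> on and the other on the odd cells from \<open>5\<close> on: both start in a blank
  memory and do not disturb each other.\<close>

lemma computable_poly:
  assumes "computable f" "computable g"
  shows "computable (\<lambda>n. (f n + g n + 2) ^ m)"
proof -
  obtain p where p: "\<And>n. \<exists>t s. exec p (input_memory [] n) t s \<and> s 0 = f n"
    using assms(1) unfolding computable_def by blast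
  obtain q where q: "\<And>n. \<exists>t s. exec q (input_memory [] n) t s \<and> s 0 = g n"
    using assms(2) unfolding computable_def by blast
  define r where "r = Seq (Add 4 0 3) (Seq (Add 5 0 3) (Seq (emb 4 p) (Seq (emb 5 q)
    (Seq (Const 1 2) (Seq (Add 1 1 4) (Seq (Add 1 1 5) (powp m)))))))"
  have "wp r (\<lambda>s t. s 0 = (f n + g n + 2) ^ m) (input_memory [] n) 0" (is "wp r ?Q _ _") for n
  proof -
    obtain t s where s: "exec p (input_memory [] n) t s" "s 0 = f n"
      using p by blast
    obtain t' s' where s': "exec q (input_memory [] n) t' s'" "s' 0 = g n"
      using q by blast
    let ?\<sigma> = "(input_memory [] n)(4 := n, 5 := n)"
    have init: "?\<sigma> (2 * a + 4) = input_memory [] n a" "?\<sigma> (2 * a + 5) = input_memory [] n a" for a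
      by (cases a; auto simp: input_memory_def)+
    have "wp (emb 4 p) (wp (emb 5 q) (wp (Const 1 2) (wp (Add 1 1 4) (wp (Add 1 1 5) (wp (powp m) ?Q))))) ?\<sigma> 2"
    proof (rule wp_mono[OF wp_emb[OF s(1)]])
      fix \<sigma>1 u1
      assume 1: "emb_post 4 s ?\<sigma> \<sigma>1 u1"
      have odd: "\<sigma>1 (2 * a + 5) = ?\<sigma> (2 * a + 5)" for a
      proof -
        have "2 * a + 5 \<noteq> 2 * b + 4" for b by presburger
        then show ?thesis using 1 by (simp add: emb_post_def)
      qed
      show "wp (emb 5 q) (wp (Const 1 2) (wp (Add 1 1 4) (wp (Add 1 1 5) (wp (powp m) ?Q)))) \<sigma>1 u1"
      proof (rule wp_mono[OF wp_emb[OF s'(1)]])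
        fix \<sigma>2 u2
        assume 2: "emb_post 5 s' \<sigma>1 \<sigma>2 u2"
        have "4 \<noteq> 2 * a + (5 :: nat)" for a by presburger
        then have "\<sigma>2 4 = \<sigma>1 4"
          using 2 by (simp add: emb_post_def)
        also have "\<sigma>1 4 = f n"
          using 1 s(2) by (simp add: emb_post_def) (metis mult_0_right add_0)
        finally have 4: "\<sigma>2 4 = f n" .
        have 5: "\<sigma>2 5 = g n"
          using 2 s'(2) by (simp add: emb_post_def) (metis mult_0_right add_0)
        have "wp (powp m) ?Q (\<sigma>2(1 := 2, 1 := 2 + f n, 1 := 2 + f n + g n)) (Suc (Suc (Suc u2)))"
          by (rule wp_mono[OF wp_powp]) (simp add: algebra_simps)
        then show "wp (Const 1 2) (wp (Add 1 1 4) (wp (Add 1 1 5) (wp (powp m) ?Q))) \<sigma>2 u2"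
          using 4 5 by simp
      qed (simp, simp only: odd init)
    qed (simp, simp only: init)
    then show ?thesis
      unfolding r_def wp_Seq by (simp add: input_memory_def numeral_2_eq_2)
  qed
  then show ?thesis
    unfolding computable_wp by blast
qed

text \<open>A step changes a single cell. As a word ends at the first blank, the output of the first
  of two reductions is at most about as long as its input and its running time together, which
  bounds the time of the second.\<close>

lemma exec_support:
  "exec p s t s' \<Longrightarrow> finite {i. s i \<noteq> 0} \<Longrightarrow>
     finite {i. s' i \<noteq> 0} \<and> card {i. s' i \<noteq> 0} \<le> card {i. s i \<noteq> 0} + t"
proof (induction rule: exec.induct)
  have upd: "finite {i. (s(r := v)) i \<noteq> 0} \<and> card {i. (s(r := v)) i \<noteq> 0} \<le> card {i. s i \<noteq> 0} + 1"
    if "finite {i. s i \<noteq> 0}" for s :: memory and r v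
  proof -
    have "{i. (s(r := v)) i \<noteq> 0} \<subseteq> insert r {i. s i \<noteq> 0}"
      by auto
    moreover have "card (insert r {i. s i \<noteq> 0}) \<le> card {i. s i \<noteq> 0} + 1"
      using that by (simp add: card_insert_if)
    ultimately show ?thesis
      using that by (meson card_mono finite.insertI finite_subset order_trans)
  qed
  {
    case exec_Const then show ?case by (rule upd)
  next
    case exec_Add then show ?case by (rule upd)
  next
    case exec_Sub then show ?case by (rule upd)
  next
    case exec_Load then show ?case by (rule upd)
  next
    case exec_Store then show ?case by (rule upd)
  }
qed auto

lemma output_length:
  assumes "exec p (input_memory x k) t s" "is_output s y k'"
  shows "length y \<le> length x + t + 1"
proof -
  have sub: "{i. input_memory x k i \<noteq> 0} \<subseteq> {0..length x}"
    by (auto simp: input_memory_def split: if_splits)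
  then have fin: "finite {i. input_memory x k i \<noteq> 0}"
    by (rule finite_subset) simp
  have "card {i. input_memory x k i \<noteq> 0} \<le> card {0..length x}"
    by (rule card_mono[OF _ sub]) simp
  then have "card {i. s i \<noteq> 0} \<le> length x + 1 + t"
    using exec_support[OF assms(1) fin] by simp
  moreover have "Suc ` {..<length y} \<subseteq> {i. s i \<noteq> 0}"
    using assms(2) by (auto simp: is_output_def letter_code_def)
  then have "card (Suc ` {..<length y}) \<le> card {i. s i \<noteq> 0}"
    using exec_support[OF assms(1) fin] by (intro card_mono) auto
  ultimately show ?thesis
    by (simp add: card_image)
qed

text \<open>The second reduction must not rely on the memory behind its input being blank.\<close>

lemma fpt_reducible_trans:
  assumes "fpt_reducible P Q"
    and red: "\<And>y k s. (y, k) \<in> insts Q \<Longrightarrow> is_output s y k \<Longrightarrow>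
      wp p (\<lambda>s' t. t \<le> ((k + 2) * (length y + 1)) ^ m \<and> (\<exists>z k'. is_output s' z k' \<and>
        (z, k') \<in> insts R \<and> k' \<le> (k + 2) ^ m \<and> ((y, k) \<in> yes Q \<longleftrightarrow> (z, k') \<in> yes R))) s 0"
  shows "fpt_reducible P R"
proof -
  obtain p0 f g e where fg: "computable f" "computable g"
    and p0: "\<forall>(x, k) \<in> insts P. \<exists>t s y k'. exec p0 (input_memory x k) t s \<and>
      t \<le> f k * (length x + 1) ^ e \<and> is_output s y k' \<and> (y, k') \<in> insts Q \<and> k' \<le> g k \<and>
      ((x, k) \<in> yes P \<longleftrightarrow> (y, k') \<in> yes Q)"
    using assms(1) unfolding fpt_reducible_def by blast
  \<comment> \<open>The intermediate word has length below \<open>G ^ 2 * X ^ (e + 1)\<close>, and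
    \<open>k' + 2\<close> is another factor \<open>G\<close>, which gives \<open>3 * m\<close>. One
    more \<open>G\<close> covers the time of the first reduction, and the last one the factor
    \<open>2\<close> for the sum of both times.\<close>
  define F where "F n = (f n + g n + 2) ^ (3 * m + 2)" for n
  define e' where "e' = (e + 1) * (m + 1)"
  have "computable F"
    unfolding F_def by (rule computable_poly[OF fg])
  moreover have "\<exists>t s z k'. exec (Seq p0 p) (input_memory x k) t s \<and> t \<le> F k * (length x + 1) ^ e' \<and>
      is_output s z k' \<and> (z, k') \<in> insts R \<and> k' \<le> F k \<and> ((x, k) \<in> yes P \<longleftrightarrow> (z, k') \<in> yes R)"
    if inst: "(x, k) \<in> insts P" for x k
  proof -
    obtain t s y k' where 1: "exec p0 (input_memory x k) t s" "t \<le> f k * (length x + 1) ^ e"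
      "is_output s y k'" "(y, k') \<in> insts Q" "k' \<le> g k" "(x, k) \<in> yes P \<longleftrightarrow> (y, k') \<in> yes Q"
      using bspec[OF p0 inst] unfolding case_prod_conv by blast
    obtain t' s' z k'' where 2: "exec p s t' s'" "t' \<le> ((k' + 2) * (length y + 1)) ^ m"
      "is_output s' z k''" "(z, k'') \<in> insts R" "k'' \<le> (k' + 2) ^ m" "(y, k') \<in> yes Q \<longleftrightarrow> (z, k'') \<in> yes R"
      using red[OF 1(4,3)] unfolding wp_def by auto
    define G where "G = f k + g k + 2"
    define X where "X = length x + 1"
    have G: "2 \<le> G" "f k \<le> G" "k' + 2 \<le> G" and X: "1 \<le> X"
      using 1(5) by (auto simp: G_def X_def)
    have t: "t \<le> G * X ^ e"
      using order_trans[OF 1(2)[folded X_def] mult_le_mono1[OF G(2)]] .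
    have y: "length y + 1 \<le> X + t + 1"
      using output_length[OF 1(1,3)] by (simp add: X_def)
    have "X \<le> X ^ (e + 1)" "X ^ e \<le> X ^ (e + 1)" "1 \<le> X ^ (e + 1)"
      using X by simp_all
    then have "X + t + 1 \<le> X ^ (e + 1) + G * X ^ (e + 1) + X ^ (e + 1)"
      using t by (meson add_mono mult_le_mono2 order_trans)
    also have "\<dots> = (G + 2) * X ^ (e + 1)"
      by (simp add: algebra_simps)
    also have "\<dots> \<le> (G * G) * X ^ (e + 1)"
    proof (rule mult_le_mono1)
      have "G + 2 \<le> 2 * G" using G by simp
      also have "\<dots> \<le> G * G" using G(1) by (rule mult_le_mono1)
      finally show "G + 2 \<le> G * G" .
    qed
    finally have "length y + 1 \<le> (G * G) * X ^ (e + 1)"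
      using y by simp
    then have "(k' + 2) * (length y + 1) \<le> G * ((G * G) * X ^ (e + 1))"
      using G(3) by (intro mult_le_mono)
    then have "((k' + 2) * (length y + 1)) ^ m \<le> (G ^ 3 * X ^ (e + 1)) ^ m"
      by (intro power_mono) (simp_all add: power3_eq_cube)
    also have "\<dots> = G ^ (3 * m) * X ^ ((e + 1) * m)"
      by (simp only: power_mult_distrib power_mult)
    also have "\<dots> \<le> G ^ (3 * m + 1) * X ^ e'"
      unfolding e'_def using G X by (intro mult_le_mono power_increasing) auto
    finally have t': "t' \<le> G ^ (3 * m + 1) * X ^ e'"
      using 2(2) by simp
    have "G * X ^ e \<le> G ^ (3 * m + 1) * X ^ e'"
      unfolding e'_def using G X by (intro mult_le_mono power_increasing self_le_power) auto
    with t t' have "t + t' \<le> 2 * (G ^ (3 * m + 1) * X ^ e')"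
      by linarith
    also have "\<dots> \<le> G * (G ^ (3 * m + 1) * X ^ e')"
      using G(1) by (rule mult_le_mono1)
    also have "\<dots> = F k * X ^ e'"
      unfolding F_def G_def[symmetric] by (simp add: mult.assoc)
    finally have "t + t' \<le> F k * (length x + 1) ^ e'"
      by (simp add: X_def)
    moreover have "k'' \<le> F k"
    proof -
      have "(k' + 2) ^ m \<le> G ^ m"
        using G(3) by (rule power_mono) simp
      also have "\<dots> \<le> F k"
        unfolding F_def G_def[symmetric] using G(1) by (intro power_increasing) auto
      finally show ?thesis using 2(5) by simp
    qed
    ultimately show ?thesis
      using exec_Seq[OF 1(1) 2(1)] 1(6) 2(3,4,6) by blast
  qed
  ultimately show ?thesis
    unfolding fpt_reducible_def by fast
qed

section \<open>Parsing circuits\<close>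

text \<open>As loops always make \<open>N\<close> rounds, shorter ones are expressed by a guard on
  the index.\<close>

lemma iter_guard:
  assumes "p \<le> N"
  shows "iter N (\<lambda>i a. if i < p then g i a else a) a = iter p g a"
proof -
  let ?g = "\<lambda>i a. if i < p then g i a else a"
  obtain d where N: "N = p + d"
    using assms le_Suc_ex by blast
  have "iter (p + d) ?g a = iter p ?g a"
    by (induction d) auto
  also have "\<dots> = iter p g a"
    by (rule iter_cong) simp
  finally show ?thesis by (simp add: N)
qed

lemma sum_of_bool_eq: "(\<Sum>i<N. of_bool (P i)) = card {i. i < (N :: nat) \<and> P i}"
  by (simp add: Collect_conj_eq lessThan_def[symmetric] Int_commute)

definition lenA :: "(nat \<Rightarrow> nat) \<Rightarrow> nat \<Rightarrow> nat" where
  "lenA A N = (\<Sum>p<N. of_bool (\<forall>i<N. i \<le> p \<longrightarrow> A (Suc i) \<noteq> 0))"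

text \<open>The state of a scanner in front of position \<open>p\<close>: \<open>1\<close> if a
  continuation marker comes next, \<open>0\<close> if a bit does.\<close>

definition markA :: "(nat \<Rightarrow> nat) \<Rightarrow> nat \<Rightarrow> nat \<Rightarrow> nat" where
  "markA A N p = iter N (\<lambda>i a. if i < p then (if a = 1 \<and> A (Suc i) = 2 then 0 else 1) else a) 1"

text \<open>Counts the end markers before \<open>p\<close>, which gives the index of the number to
  which position \<open>p\<close> belongs.\<close>

definition idxA :: "(nat \<Rightarrow> nat) \<Rightarrow> nat \<Rightarrow> nat \<Rightarrow> nat" where
  "idxA A N p = (\<Sum>i<N. of_bool (i < p \<and> markA A N i = 1 \<and> A (Suc i) = 1))"

text \<open>The positions of index below \<open>j\<close> form an initial segment of the word, so
  their number is the position where number \<open>j\<close> begins.\<close>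

definition startA :: "(nat \<Rightarrow> nat) \<Rightarrow> nat \<Rightarrow> nat \<Rightarrow> nat" where
  "startA A N j = (\<Sum>p<N. of_bool (p < lenA A N \<and> idxA A N p < j))"

definition pow2 :: "nat \<Rightarrow> nat \<Rightarrow> nat" where
  "pow2 N e = iter N (\<lambda>i a. if i < e then a + a else a) 1"

definition tokA :: "(nat \<Rightarrow> nat) \<Rightarrow> nat \<Rightarrow> nat \<Rightarrow> nat" where
  "tokA A N j = (\<Sum>i<N. if (\<forall>h<N. h \<le> i \<longrightarrow> A (Suc (startA A N j + 2 * h)) = 2) \<and>
     A (Suc (Suc (startA A N j + 2 * i))) = 2 then pow2 N i else 0)"

definition gate_lenA :: "(nat \<Rightarrow> nat) \<Rightarrow> nat \<Rightarrow> nat \<Rightarrow> nat" where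
  "gate_lenA A N t = (if tokA A N t = 0 then 1 else if tokA A N t = 1 then 2 else 2 + tokA A N (Suc t))"

definition gate_startA :: "(nat \<Rightarrow> nat) \<Rightarrow> nat \<Rightarrow> nat \<Rightarrow> nat" where
  "gate_startA A N g = iter N (\<lambda>i t. if i < g then t + gate_lenA A N t else t) 0"

definition num_gatesA :: "(nat \<Rightarrow> nat) \<Rightarrow> nat \<Rightarrow> nat" where
  "num_gatesA A N = (\<Sum>g<N. of_bool (gate_startA A N g < idxA A N (lenA A N)))"

definition gtypA :: "(nat \<Rightarrow> nat) \<Rightarrow> nat \<Rightarrow> nat \<Rightarrow> nat" where
  "gtypA A N g = tokA A N (gate_startA A N g)"

definition garA :: "(nat \<Rightarrow> nat) \<Rightarrow> nat \<Rightarrow> nat \<Rightarrow> nat" where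
  "garA A N g = (if gtypA A N g = 0 then 0 else if gtypA A N g = 1 then 1
     else tokA A N (Suc (gate_startA A N g)))"

definition gpredA :: "(nat \<Rightarrow> nat) \<Rightarrow> nat \<Rightarrow> nat \<Rightarrow> nat \<Rightarrow> nat" where
  "gpredA A N g i = (if gtypA A N g = 1 then tokA A N (Suc (gate_startA A N g))
     else tokA A N (gate_startA A N g + 2 + i))"

text \<open>From here on computability is read off the syntax: a rule is applied to the outermost
  operation, and \<open>simp\<close> proves the side conditions that a variable number is in range
  or that a term does not depend on a loop variable.\<close>

lemma cmp_lenA: "0 < n \<Longrightarrow> cmp n (\<lambda>A s. lenA A (s 0))"
  unfolding lenA_def by (rule cmp_intros | (simp cong: if_cong; fail))+

lemma cmp_markA: "cmp n a \<Longrightarrow> 0 < n \<Longrightarrow> cmp n (\<lambda>A s. markA A (s 0) (a A s))"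
  by (rule cmp_app1[where F = markA], unfold markA_def)
    (rule cmp_intros | (simp cong: if_cong; fail))+

lemma cmp_idxA: "cmp n a \<Longrightarrow> 0 < n \<Longrightarrow> cmp n (\<lambda>A s. idxA A (s 0) (a A s))"
  by (rule cmp_app1[where F = idxA], unfold idxA_def)
    (rule cmp_intros cmp_markA | (simp cong: if_cong; fail))+

lemma cmp_startA: "cmp n a \<Longrightarrow> 0 < n \<Longrightarrow> cmp n (\<lambda>A s. startA A (s 0) (a A s))"
  by (rule cmp_app1[where F = startA], unfold startA_def)
    (rule cmp_intros cmp_idxA cmp_lenA | (simp cong: if_cong; fail))+

lemma cmp_pow2: "cmp n a \<Longrightarrow> 0 < n \<Longrightarrow> cmp n (\<lambda>A s. pow2 (s 0) (a A s))"
  by (rule cmp_app1[where F = "\<lambda>A. pow2"], unfold pow2_def) (rule cmp_intros | (simp cong: if_cong; fail))+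

lemma cmp_tokA: "cmp n a \<Longrightarrow> 0 < n \<Longrightarrow> cmp n (\<lambda>A s. tokA A (s 0) (a A s))"
  by (rule cmp_app1[where F = tokA], unfold tokA_def)
    (rule cmp_intros cmp_startA cmp_pow2 | (simp cong: if_cong; fail))+

lemma cmp_gate_lenA: "cmp n a \<Longrightarrow> 0 < n \<Longrightarrow> cmp n (\<lambda>A s. gate_lenA A (s 0) (a A s))"
  by (rule cmp_app1[where F = gate_lenA], unfold gate_lenA_def)
    (rule cmp_intros cmp_tokA | (simp cong: if_cong; fail))+

lemma cmp_gate_startA: "cmp n a \<Longrightarrow> 0 < n \<Longrightarrow> cmp n (\<lambda>A s. gate_startA A (s 0) (a A s))"
  by (rule cmp_app1[where F = gate_startA], unfold gate_startA_def)
    (rule cmp_intros cmp_gate_lenA | (simp cong: if_cong; fail))+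

lemma cmp_num_gatesA: "0 < n \<Longrightarrow> cmp n (\<lambda>A s. num_gatesA A (s 0))"
  unfolding num_gatesA_def by (rule cmp_intros cmp_gate_startA cmp_idxA cmp_lenA | (simp cong: if_cong; fail))+

lemma cmp_gtypA: "cmp n a \<Longrightarrow> 0 < n \<Longrightarrow> cmp n (\<lambda>A s. gtypA A (s 0) (a A s))"
  unfolding gtypA_def by (rule cmp_tokA cmp_gate_startA | assumption)+

lemma cmp_garA: "cmp n a \<Longrightarrow> 0 < n \<Longrightarrow> cmp n (\<lambda>A s. garA A (s 0) (a A s))"
  by (rule cmp_app1[where F = garA], unfold garA_def)
    (rule cmp_intros cmp_gtypA cmp_tokA cmp_gate_startA | (simp cong: if_cong; fail))+

lemma cmp_gpredA:
  "cmp n a \<Longrightarrow> cmp n b \<Longrightarrow> 0 < n \<Longrightarrow> cmp n (\<lambda>A s. gpredA A (s 0) (a A s) (b A s))"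
  by (rule cmp_app2[where F = gpredA], unfold gpredA_def)
    (rule cmp_intros cmp_gtypA cmp_tokA cmp_gate_startA | (simp cong: if_cong; fail))+

section \<open>Encoded numbers and concatenations\<close>

lemma length_encode_nat: "length (encode_nat n) = 2 * length (bits n) + 1"
  by (simp add: encode_nat_def length_concat comp_def sum_list_triv)

lemma nth_encode_nat:
  "i < length (bits n) \<Longrightarrow> encode_nat n ! (2 * i)"
  "i < length (bits n) \<Longrightarrow> encode_nat n ! Suc (2 * i) = bits n ! i"
  "\<not> encode_nat n ! (2 * length (bits n))"
proof -
  have *: "(concat (map (\<lambda>b. [True, b]) bs) @ [False]) ! (2 * i) \<and>
      (concat (map (\<lambda>b. [True, b]) bs) @ [False]) ! Suc (2 * i) = bs ! i" if "i < length bs" for bs :: word and i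
    using that
  proof (induction bs arbitrary: i)
    case (Cons b bs)
    then show ?case by (cases i) auto
  qed simp
  show "i < length (bits n) \<Longrightarrow> encode_nat n ! (2 * i)"
    "i < length (bits n) \<Longrightarrow> encode_nat n ! Suc (2 * i) = bits n ! i"
    using *[of i "bits n"] by (simp_all add: encode_nat_def)
  have "length (concat (map (\<lambda>b. [True, b]) bs)) = 2 * length bs" for bs :: word
    by (induction bs) auto
  then show "\<not> encode_nat n ! (2 * length (bits n))"
    by (simp add: encode_nat_def nth_append)
qed

lemma sum_bits: "(\<Sum>i<length (bits n). if bits n ! i then 2 ^ i else 0) = n"
proof (induction n rule: bits.induct)
  case (1 n)
  show ?case
  proof (cases "n = 0")
    case True
    then show ?thesis by (simp add: bits.simps)
  next
    case False
    then have b: "bits n = odd n # bits (n div 2)"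
      by (simp add: bits.simps)
    have "(\<Sum>i<length (bits n). if bits n ! i then 2 ^ i else (0 :: nat)) =
        of_bool (odd n) + 2 * (\<Sum>i<length (bits (n div 2)). if bits (n div 2) ! i then 2 ^ i else 0)"
      unfolding b by (simp add: sum.lessThan_Suc_shift sum_distrib_left if_distrib del: sum.lessThan_Suc cong: if_cong)
    with 1[OF False] show ?thesis by (simp add: of_bool_def odd_two_times_div_two_succ)
  qed
qed

lemma concat_nth_ex:
  "p < length (concat xss) \<Longrightarrow>
     \<exists>j i. j < length xss \<and> i < length (xss ! j) \<and> p = length (concat (take j xss)) + i"
proof (induction xss arbitrary: p)
  case (Cons xs xss)
  show ?case
  proof (cases "p < length xs")
    case True
    then show ?thesis by (intro exI[of _ 0] exI[of _ p]) simp
  next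
    case False
    then have "p - length xs < length (concat xss)"
      using Cons.prems by simp
    then obtain j i where "j < length xss" "i < length (xss ! j)"
      "p - length xs = length (concat (take j xss)) + i"
      using Cons.IH by blast
    then show ?thesis
      using False by (intro exI[of _ "Suc j"] exI[of _ i]) simp
  qed
qed simp

lemma nth_concat:
  assumes "j < length xss" "i < length (xss ! j)"
  shows "concat xss ! (length (concat (take j xss)) + i) = xss ! j ! i"
proof -
  have "concat xss = concat (take j xss) @ xss ! j @ concat (drop (Suc j) xss)"
    using id_take_nth_drop[OF assms(1)] by (metis concat.simps(2) concat_append)
  then show ?thesis
    using assms(2) by (simp add: nth_append)
qed

lemma length_concat_take_Suc:
  "j < length xss \<Longrightarrow> length (concat (take (Suc j) xss)) = length (concat (take j xss)) + length (xss ! j)"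
  by (simp add: take_Suc_conv_app_nth)

lemma length_concat_take_mono: "j \<le> j' \<Longrightarrow> length (concat (take j xss)) \<le> length (concat (take j' xss))"
  by (metis concat_append le_Suc_ex length_append le_add1 take_add)

lemma lenA:
  assumes "word_array x k A" "length x < N"
  shows "lenA A N = length x"
proof -
  have "(p < N \<and> (\<forall>i<N. i \<le> p \<longrightarrow> A (Suc i) \<noteq> 0)) \<longleftrightarrow> p < length x" for p
    using assms by (auto simp: word_array_def letter_code_def not_le)
  then show ?thesis
    by (simp add: lenA_def sum_of_bool_eq)
qed

lemma pow2: "e \<le> N \<Longrightarrow> pow2 N e = 2 ^ e"
proof -
  assume "e \<le> N"
  then have "pow2 N e = iter e (\<lambda>_ a. a + a) 1"
    by (simp add: pow2_def iter_guard)
  also have "\<dots> = 2 ^ e"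
    by (induction e) auto
  finally show ?thesis .
qed

section \<open>Reading a list of numbers\<close>

locale nats_array =
  fixes ns :: "nat list" and x :: word and k :: nat and A :: "nat \<Rightarrow> nat" and N :: nat
  assumes x: "x = encode_nats ns" and A: "word_array x k A" and N: "length x < N"
begin

definition start :: "nat \<Rightarrow> nat" where
  "start j = length (encode_nats (take j ns))"

lemma start_Suc: "j < length ns \<Longrightarrow> start (Suc j) = start j + 2 * length (bits (ns ! j)) + 1"
  using length_concat_take_Suc[of j "map encode_nat ns"]
  by (simp add: start_def encode_nats_def take_map length_encode_nat)

lemma start_mono: "j \<le> j' \<Longrightarrow> start j \<le> start j'"
  using length_concat_take_mono[of j j' "map encode_nat ns"]
  by (simp add: start_def encode_nats_def take_map)

lemma start_length: "start (length ns) = length x"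
  by (simp add: start_def x)

lemma letter:
  assumes "j < length ns" "i < 2 * length (bits (ns ! j)) + 1"
  shows "start j + i < length x" "A (Suc (start j + i)) = letter_code (encode_nat (ns ! j) ! i)"
proof -
  have "start (Suc j) \<le> length x"
    unfolding start_length[symmetric] by (rule start_mono) (use assms in simp)
  then show *: "start j + i < length x"
    using start_Suc[OF assms(1)] assms(2) by simp
  have "x ! (start j + i) = encode_nat (ns ! j) ! i"
    using nth_concat[of j "map encode_nat ns" i] assms
    by (simp add: x encode_nats_def start_def take_map length_encode_nat)
  with * A show "A (Suc (start j + i)) = letter_code (encode_nat (ns ! j) ! i)"
    by (simp add: word_array_def)
qed

lemma position:
  assumes "p < length x"
  obtains j i where "j < length ns" "i < 2 * length (bits (ns ! j)) + 1" "p = start j + i"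
  using concat_nth_ex[of p "map encode_nat ns"] assms
  by (auto simp: x encode_nats_def start_def take_map length_encode_nat)

definition mark :: "nat \<Rightarrow> nat" where
  "mark p = iter p (\<lambda>i a. if a = 1 \<and> A (Suc i) = 2 then 0 else 1) 1"

definition cnt :: "nat \<Rightarrow> nat" where
  "cnt p = (\<Sum>i<p. of_bool (mark i = 1 \<and> A (Suc i) = 1))"

lemma letter_cases:
  assumes "j < length ns" "i < length (bits (ns ! j))"
  shows "A (Suc (start j + 2 * i)) = 2" "A (Suc (start j + Suc (2 * i))) = (if bits (ns ! j) ! i then 2 else 1)"
  using letter[OF assms(1), of "2 * i"] letter[OF assms(1), of "Suc (2 * i)"] assms(2)
  by (simp_all add: nth_encode_nat letter_code_def)

lemma letter_last: "j < length ns \<Longrightarrow> A (Suc (start j + 2 * length (bits (ns ! j)))) = 1"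
  using letter[of j "2 * length (bits (ns ! j))"] by (simp add: nth_encode_nat letter_code_def)

text \<open>Induction over the pairs of marker and bit: the marker \<open>True\<close> leads to
  state \<open>0\<close> and any bit back to state \<open>1\<close>, so no letter within the number
  is mistaken for an end marker.\<close>

lemma mark_step:
  assumes "j < length ns" "mark (start j) = 1" "cnt (start j) = j" "i \<le> length (bits (ns ! j))"
  shows "mark (start j + 2 * i) = 1 \<and> cnt (start j + 2 * i) = j \<and>
    (i < length (bits (ns ! j)) \<longrightarrow> mark (start j + Suc (2 * i)) = 0 \<and> cnt (start j + Suc (2 * i)) = j)"
  using assms(4)
proof (induction i)
  case 0
  with assms show ?case
    using letter_cases(1)[OF assms(1), of 0] by (auto simp: mark_def cnt_def)
next
  case (Suc i)
  then have i: "i < length (bits (ns ! j))" by simp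
  then have *: "mark (start j + Suc (2 * i)) = 0" "cnt (start j + Suc (2 * i)) = j"
    using Suc.IH by auto
  have e: "start j + 2 * Suc i = Suc (start j + Suc (2 * i))" by simp
  have "mark (start j + 2 * Suc i) = 1" "cnt (start j + 2 * Suc i) = j"
    unfolding e using * by (simp_all add: mark_def cnt_def)
  moreover have "start j + Suc (2 * Suc i) = Suc (start j + 2 * Suc i)" by simp
  ultimately show ?case
    using letter_cases(1)[OF assms(1), of "Suc i"] by (auto simp: mark_def cnt_def)
qed

lemma mark_start: "j \<le> length ns \<Longrightarrow> mark (start j) = 1 \<and> cnt (start j) = j"
proof (induction j)
  case 0
  then show ?case by (simp add: start_def encode_nats_def mark_def cnt_def)
next
  case (Suc j)
  then have "mark (start j + 2 * length (bits (ns ! j))) = 1" "cnt (start j + 2 * length (bits (ns ! j))) = j"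
    using mark_step[of j "length (bits (ns ! j))"] by auto
  with Suc.prems letter_last[of j] show ?case
    by (simp add: start_Suc mark_def cnt_def)
qed

lemma cnt: "j < length ns \<Longrightarrow> i < 2 * length (bits (ns ! j)) + 1 \<Longrightarrow> cnt (start j + i) = j"
  using mark_step[of j "i div 2"] mark_start[of j]
  by (cases "even i") (auto elim!: evenE oddE)

lemma markA: "p \<le> N \<Longrightarrow> markA A N p = mark p"
  by (simp add: markA_def mark_def iter_guard)

lemma idxA:
  assumes "p \<le> N"
  shows "idxA A N p = cnt p"
proof -
  have "{i. i < N \<and> i < p \<and> markA A N i = 1 \<and> A (Suc i) = 1} = {i. i < p \<and> mark i = 1 \<and> A (Suc i) = 1}"
    using assms by (auto simp: markA)
  then show ?thesis
    by (simp only: idxA_def cnt_def sum_of_bool_eq)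
qed

lemma startA:
  assumes "j \<le> length ns"
  shows "startA A N j = start j"
proof -
  have "(p < N \<and> p < lenA A N \<and> idxA A N p < j) \<longleftrightarrow> p < start j" for p
  proof (cases "p < length x")
    case True
    then obtain j' i where p: "j' < length ns" "i < 2 * length (bits (ns ! j')) + 1" "p = start j' + i"
      by (rule position)
    have "idxA A N p = j'"
      using True N p cnt by (simp add: idxA)
    moreover have "j' < j \<longleftrightarrow> p < start j"
    proof
      assume "j' < j"
      then have "start (Suc j') \<le> start j" by (intro start_mono) simp
      then show "p < start j" using p by (simp add: start_Suc)
    next
      assume "p < start j"
      then show "j' < j" using start_mono[of j j'] p by (force simp: not_less)
    qed
    ultimately show ?thesis
      using True N A by (simp add: lenA)
  next
    case False
    moreover have "start j \<le> length x"
      unfolding start_length[symmetric] by (rule start_mono[OF assms])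
    ultimately show ?thesis
      using N A by (simp add: lenA)
  qed
  then show ?thesis
    by (simp add: startA_def sum_of_bool_eq)
qed

lemma num_toks: "idxA A N (lenA A N) = length ns"
  using N mark_start[of "length ns"] by (simp add: lenA[OF A N] idxA start_length)

lemma tokA:
  assumes j: "j < length ns"
  shows "tokA A N j = ns ! j"
proof -
  let ?b = "bits (ns ! j)"
  have bN: "length ?b < N"
    using letter(1)[OF j, of "2 * length ?b"] N by simp
  \<comment> \<open>The markers in front of the bits are \<open>2\<close>, and the end marker at
    offset \<open>2 * length ?b\<close> is the first one that is not.\<close>
  have 1: "(\<forall>h<N. h \<le> i \<longrightarrow> A (Suc (start j + 2 * h)) = 2) \<longleftrightarrow> i < length ?b" if "i < N" for i
    using letter_cases(1)[OF j] letter_last[OF j] bN that by (metis One_nat_def not_less numeral_2_eq_2 n_not_Suc_n order.strict_trans1)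
  have "tokA A N j = (\<Sum>i<N. if i < length ?b \<and> ?b ! i then 2 ^ i else 0)"
    unfolding tokA_def
  proof (rule sum.cong)
    fix i
    assume "i \<in> {..<N}"
    then have i: "i < N" by simp
    have "(i < length ?b \<and> A (Suc (Suc (start j + 2 * i))) = 2) \<longleftrightarrow> i < length ?b \<and> ?b ! i"
      using letter_cases(2)[OF j, of i] by (auto split: if_splits)
    with 1[OF i] i j show "(if (\<forall>h<N. h \<le> i \<longrightarrow> A (Suc (startA A N j + 2 * h)) = 2) \<and>
        A (Suc (Suc (startA A N j + 2 * i))) = 2 then pow2 N i else 0) =
        (if i < length ?b \<and> ?b ! i then 2 ^ i else 0)"
      by (simp add: startA pow2)
  qed simp
  also have "\<dots> = (\<Sum>i<length ?b. if i < length ?b \<and> ?b ! i then 2 ^ i else 0)"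
    by (rule sum.mono_neutral_right) (use bN in auto)
  also have "\<dots> = (\<Sum>i<length ?b. if ?b ! i then 2 ^ i else 0)"
    by (rule sum.cong) auto
  also have "\<dots> = ns ! j"
    by (rule sum_bits)
  finally show ?thesis .
qed

end

section \<open>Locating the gates in the list of numbers\<close>

locale circuit_array =
  fixes C :: circuit and x :: word and k :: nat and A :: "nat \<Rightarrow> nat" and N :: nat
  assumes x: "x = encode_circuit C" and A: "word_array x k A" and N: "length x < N"
begin

sublocale nats_array "concat (map encode_gate C)" x k A N
  by unfold_locales (use x A N in \<open>simp_all add: encode_circuit_def\<close>)

definition gate_start :: "nat \<Rightarrow> nat" where
  "gate_start g = length (concat (map encode_gate (take g C)))"

lemma length_encode_gate: "0 < length (encode_gate g)"
  by (cases g) auto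

lemma gate_start_Suc: "g < length C \<Longrightarrow> gate_start (Suc g) = gate_start g + length (encode_gate (C ! g))"
  using length_concat_take_Suc[of g "map encode_gate C"] by (simp add: gate_start_def take_map)

lemma gate_start_mono: "g \<le> g' \<Longrightarrow> gate_start g \<le> gate_start g'"
  using length_concat_take_mono[of g g' "map encode_gate C"] by (simp add: gate_start_def take_map)

lemma gate_tok:
  assumes "g < length C" "i < length (encode_gate (C ! g))"
  shows "gate_start g + i < length (concat (map encode_gate C))"
    "tokA A N (gate_start g + i) = encode_gate (C ! g) ! i"
proof -
  have "gate_start (Suc g) \<le> gate_start (length C)"
    by (rule gate_start_mono) (use assms in simp)
  also have "\<dots> = length (concat (map encode_gate C))"
    by (simp add: gate_start_def)
  finally show *: "gate_start g + i < length (concat (map encode_gate C))"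
    using gate_start_Suc[OF assms(1)] assms(2) by simp
  show "tokA A N (gate_start g + i) = encode_gate (C ! g) ! i"
    using nth_concat[of g "map encode_gate C" i] assms tokA[OF *]
    by (simp add: gate_start_def take_map)
qed

lemma length_C: "length C \<le> length x"
proof -
  have "length xs \<le> length (concat (map f xs))" if "\<And>y. 0 < length (f y)" for f :: "'a \<Rightarrow> 'b list" and xs
  proof (induction xs)
    case (Cons a xs)
    with that[of a] show ?case
      unfolding list.map concat.simps length_append list.size by linarith
  qed simp
  from this[of encode_gate C] this[of encode_nat "concat (map encode_gate C)"]
  show ?thesis
    using length_encode_gate by (simp add: x encode_circuit_def encode_nats_def encode_nat_def)
qed

lemma gate_lenA: "g < length C \<Longrightarrow> gate_lenA A N (gate_start g) = length (encode_gate (C ! g))"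
  using gate_tok(2)[of g 0] gate_tok(2)[of g 1] length_encode_gate[of "C ! g"]
  by (cases "C ! g") (simp_all add: gate_lenA_def)

lemma iter_gate_start: "g \<le> length C \<Longrightarrow> iter g (\<lambda>_ t. t + gate_lenA A N t) 0 = gate_start g"
  by (induction g) (simp_all add: gate_start_Suc gate_lenA, simp add: gate_start_def)

lemma gate_startA: "g \<le> length C \<Longrightarrow> gate_startA A N g = gate_start g"
  using length_C N by (simp add: gate_startA_def iter_guard iter_gate_start)

lemma num_gatesA: "num_gatesA A N = length C"
proof -
  have "gate_startA A N g < length (concat (map encode_gate C)) \<longleftrightarrow> g < length C" if g: "g < N" for g
  proof (cases "g < length C")
    case True
    then show ?thesis
      using gate_tok(1)[OF True, of 0] length_encode_gate by (simp add: gate_startA)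
  next
    case False
    then obtain d where d: "g = length C + d" by (metis le_Suc_ex not_less)
    \<comment> \<open>Behind the last gate the computed lengths mean nothing, but the position never
      decreases, so no further gate is counted.\<close>
    have "iter (length C) (\<lambda>_ t. t + gate_lenA A N t) 0 \<le> iter (length C + d) (\<lambda>_ t. t + gate_lenA A N t) 0"
      by (induction d) auto
    then show ?thesis
      using False g d by (simp add: gate_startA_def iter_guard iter_gate_start) (simp add: gate_start_def)
  qed
  then have "{g. g < N \<and> gate_startA A N g < length (concat (map encode_gate C))} = {g. g < length C}"
    using length_C N by auto
  then show ?thesis
    by (simp only: num_gatesA_def sum_of_bool_eq num_toks) simp
qed

lemma gtypA: "g < length C \<Longrightarrow>
    gtypA A N g = (case C ! g of Input \<Rightarrow> 0 | Neg _ \<Rightarrow> 1 | Conj _ \<Rightarrow> 2 | Disj _ \<Rightarrow> 3)"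
  using gate_tok(2)[of g 0] length_encode_gate[of "C ! g"]
  by (cases "C ! g") (simp_all add: gtypA_def gate_startA)

lemma garA: "g < length C \<Longrightarrow> garA A N g = length (preds (C ! g))"
  using gate_tok(2)[of g 1] by (cases "C ! g") (simp_all add: garA_def gtypA gate_startA)

lemma gpredA: "g < length C \<Longrightarrow> i < length (preds (C ! g)) \<Longrightarrow> gpredA A N g i = preds (C ! g) ! i"
  using gate_tok(2)[of g "Suc i"] gate_tok(2)[of g "Suc (Suc i)"]
  by (cases "C ! g") (simp_all add: gpredA_def gtypA gate_startA)

end

section \<open>Moebius inversion\<close>

lemma sum_Pow_insert:
  assumes "finite S" "x \<notin> S"
  shows "(\<Sum>T\<in>Pow (insert x S). f T) = (\<Sum>T\<in>Pow S. f T) + (\<Sum>T\<in>Pow S. f (insert x T))"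
proof -
  have "inj_on (insert x) (Pow S)"
    using assms(2) by (auto simp: inj_on_def)
  moreover have "Pow S \<inter> insert x ` Pow S = {}"
    using assms(2) by auto
  ultimately show ?thesis
    using assms(1) by (simp add: Pow_insert sum.union_disjoint sum.reindex)
qed

definition mob :: "('a set \<Rightarrow> int) \<Rightarrow> 'a set \<Rightarrow> int" where
  "mob F T = (\<Sum>U\<in>Pow T. (-1) ^ (card T - card U) * F U)"

text \<open>Splitting the subsets by whether they contain \<open>x\<close> exhibits
  \<open>mob\<close> as an iterated difference, with one difference for every element of the
  set.\<close>

lemma mob_insert:
  assumes "finite T" "x \<notin> T"
  shows "mob F (insert x T) = mob (\<lambda>U. F (insert x U)) T - mob F T"
proof -
  have 1: "(-1) ^ (Suc (card T) - card U) * F U = - ((-1) ^ (card T - card U) * F U)" if "U \<in> Pow T" for U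
    using that assms(1) by (simp add: Suc_diff_le card_mono)
  have 2: "(-1) ^ (Suc (card T) - card (insert x U)) * F (insert x U) = (-1) ^ (card T - card U) * F (insert x U)"
    if "U \<in> Pow T" for U
    using that assms by (subst card_insert_disjoint) (auto intro: finite_subset)
  have "mob F (insert x T) = (\<Sum>U\<in>Pow T. (-1) ^ (Suc (card T) - card U) * F U) +
      (\<Sum>U\<in>Pow T. (-1) ^ (Suc (card T) - card (insert x U)) * F (insert x U))"
    using assms by (simp add: mob_def sum_Pow_insert)
  also have "\<dots> = - mob F T + mob (\<lambda>U. F (insert x U)) T"
    unfolding mob_def sum_negf[symmetric] by (intro arg_cong2[of _ _ _ _ "(+)"] sum.cong refl 1 2)
  finally show ?thesis by simp
qed

text \<open>The induction is over all \<open>F\<close> at once: by \<open>mob_insert\<close> the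
  terms with and without \<open>x\<close> add up to the expansion of the function that always
  includes \<open>x\<close>.\<close>

lemma mob_inversion: "finite S \<Longrightarrow> F S = (\<Sum>T\<in>Pow S. mob F T)"
proof (induction S arbitrary: F rule: finite_induct)
  case empty
  then show ?case by (simp add: mob_def)
next
  case (insert x S)
  have "mob F (insert x T) = mob (\<lambda>U. F (insert x U)) T - mob F T" if "T \<in> Pow S" for T
    using that insert.hyps by (intro mob_insert) (auto intro: finite_subset)
  then have "(\<Sum>T\<in>Pow (insert x S). mob F T) = (\<Sum>T\<in>Pow S. mob (\<lambda>U. F (insert x U)) T)"
    using insert.hyps by (simp add: sum_Pow_insert sum_subtractf)
  also have "\<dots> = F (insert x S)"
    by (rule insert.IH[symmetric])
  finally show ?case ..
qed

text \<open>\<open>mob F T\<close> is the coefficient of the product of the variables in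
  \<open>T\<close> when \<open>F\<close> is written as a multilinear polynomial in the indicator
  variables of its argument.\<close>

definition degree_le :: "nat \<Rightarrow> ('a set \<Rightarrow> int) \<Rightarrow> bool" where
  "degree_le q F \<longleftrightarrow> (\<forall>T. finite T \<longrightarrow> q < card T \<longrightarrow> mob F T = 0)"

text \<open>A set with more than \<open>q\<close> elements contains one that \<open>F\<close>
  ignores, and the difference in its direction vanishes.\<close>

lemma degree_le_local:
  fixes V :: "'a set"
  assumes "finite V" "card V \<le> q" "\<And>U. F U = F (U \<inter> V)"
  shows "degree_le q F"
  unfolding degree_le_def
proof (intro allI impI)
  fix T :: "'a set"
  assume T: "finite T" "q < card T"
  then have "\<not> T \<subseteq> V"
    using assms(1,2) card_mono[of V T] by auto
  then obtain x where x: "x \<in> T" "x \<notin> V" by blast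
  have "F (insert x U) = F U" for U
    using assms(3)[of "insert x U"] assms(3)[of U] x(2) by simp
  then have "mob F (insert x (T - {x})) = 0"
    using T(1) by (subst mob_insert) auto
  then show "mob F T = 0"
    using x(1) by (simp add: insert_absorb)
qed

lemma degree_le_mono: "degree_le p F \<Longrightarrow> p \<le> q \<Longrightarrow> degree_le q F"
  by (simp add: degree_le_def)

lemma degree_le_add: "degree_le q F \<Longrightarrow> degree_le q G \<Longrightarrow> degree_le q (\<lambda>U. F U + G U)"
  by (simp add: degree_le_def mob_def distrib_left sum.distrib)

lemma degree_le_cmult: "degree_le q F \<Longrightarrow> degree_le q (\<lambda>U. c * F U)"
  by (simp add: degree_le_def mob_def mult.left_commute[of _ c] flip: sum_distrib_left)

lemma degree_le_zero: "degree_le q (\<lambda>U. 0)"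
  by (simp add: degree_le_def mob_def)

lemma degree_le_sum: "(\<And>i. i \<in> I \<Longrightarrow> degree_le q (F i)) \<Longrightarrow> degree_le q (\<lambda>U. \<Sum>i\<in>I. F i U)"
  by (induction I rule: infinite_finite_induct) (simp_all add: degree_le_zero degree_le_add)

section \<open>Evaluating circuits of weft one\<close>

text \<open>The radix exceeds \<open>k\<close>, every gate position and every in-degree. The minimum
  with \<open>N\<close> puts it into the form for which powers are computable.\<close>

definition betA :: "(nat \<Rightarrow> nat) \<Rightarrow> nat \<Rightarrow> nat" where
  "betA A N = min N (A 0 + lenA A N + 2)"

text \<open>Recursion on a fuel \<open>l\<close> instead of the gate: the nesting is fixed by
  \<open>d\<close>, so computability follows by induction on \<open>l\<close>. Depth
  \<open>d\<close> makes \<open>d + 1\<close> levels sufficient.\<close>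

fun valA :: "(nat \<Rightarrow> nat) \<Rightarrow> nat \<Rightarrow> (nat \<Rightarrow> bool) \<Rightarrow> nat \<Rightarrow> nat \<Rightarrow> bool" where
  "valA A N M 0 g \<longleftrightarrow> False"
| "valA A N M (Suc l) g \<longleftrightarrow>
     (if gtypA A N g = 0 then M g
      else if gtypA A N g = 1 then \<not> valA A N M l (gpredA A N g 0)
      else if gtypA A N g = 2 then \<forall>i<N. i < garA A N g \<longrightarrow> valA A N M l (gpredA A N g i)
      else \<exists>i<N. i < garA A N g \<and> valA A N M l (gpredA A N g i))"

definition divA :: "nat \<Rightarrow> nat \<Rightarrow> nat \<Rightarrow> nat" where
  "divA N x y = (\<Sum>i<N. of_bool (min N (Suc i) * y \<le> x))"

definition modA :: "nat \<Rightarrow> nat \<Rightarrow> nat \<Rightarrow> nat" where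
  "modA N x y = x - min N (divA N x y) * y"

text \<open>A digit of \<open>phiA\<close> in the mixed radix system belongs to an input gate or large gate that the
  output gate reaches through small gates only. It counts the true predecessors of that gate, and
  \<open>hhA\<close> recovers the value of the output gate from these counts.\<close>

fun phiA :: "(nat \<Rightarrow> nat) \<Rightarrow> nat \<Rightarrow> (nat \<Rightarrow> bool) \<Rightarrow> nat \<Rightarrow> nat \<Rightarrow> nat" where
  "phiA A N M 0 g = 0"
| "phiA A N M (Suc l) g =
     (if gtypA A N g = 0 then of_bool (M g)
      else if 2 < garA A N g then \<Sum>i<N. of_bool (i < garA A N g \<and> valA A N M l (gpredA A N g i))
      else if gtypA A N g = 1 then phiA A N M l (gpredA A N g 0)
      else phiA A N M l (gpredA A N g 0) + min N (phiA A N M l (gpredA A N g 1)) * betA A N ^ (2 ^ l))"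

fun hhA :: "(nat \<Rightarrow> nat) \<Rightarrow> nat \<Rightarrow> nat \<Rightarrow> nat \<Rightarrow> nat \<Rightarrow> bool" where
  "hhA A N 0 g b \<longleftrightarrow> False"
| "hhA A N (Suc l) g b \<longleftrightarrow>
     (if gtypA A N g = 0 then b \<noteq> 0
      else if 2 < garA A N g then (if gtypA A N g = 2 then b = garA A N g else b \<noteq> 0)
      else if gtypA A N g = 1 then \<not> hhA A N l (gpredA A N g 0) b
      else if gtypA A N g = 2 then hhA A N l (gpredA A N g 0) (modA N b (betA A N ^ (2 ^ l))) \<and>
        hhA A N l (gpredA A N g 1) (divA N b (betA A N ^ (2 ^ l)))
      else hhA A N l (gpredA A N g 0) (modA N b (betA A N ^ (2 ^ l))) \<or>
        hhA A N l (gpredA A N g 1) (divA N b (betA A N ^ (2 ^ l))))"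

lemma divA: "0 < y \<Longrightarrow> x < N \<Longrightarrow> divA N x y = x div y"
proof -
  assume *: "0 < y" "x < N"
  have "i < N \<and> min N (Suc i) * y \<le> x \<longleftrightarrow> i < x div y" for i
  proof -
    have "i < N \<Longrightarrow> min N (Suc i) = Suc i" by simp
    moreover have "Suc i * y \<le> x \<longleftrightarrow> i < x div y"
      using *(1) by (simp only: Suc_le_eq[symmetric] less_eq_div_iff_mult_less_eq)
    moreover have "i < x div y \<Longrightarrow> i < N"
      using * div_le_dividend[of x y] by linarith
    ultimately show ?thesis by metis
  qed
  then have "{i. i < N \<and> min N (Suc i) * y \<le> x} = {i. i < x div y}" by blast
  then show ?thesis by (simp only: divA_def sum_of_bool_eq) simp
qed

lemma modA:
  assumes "0 < y" "x < N"
  shows "modA N x y = x mod y"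
proof -
  have "min N (x div y) = x div y"
    using div_le_dividend[of x y] assms by linarith
  then show ?thesis
    using assms by (simp add: modA_def divA minus_div_mult_eq_mod)
qed

section \<open>Circuits of bounded depth and weft one\<close>

locale weft_one = circuit_array +
  fixes d :: nat
  assumes circ: "circuit C" and weft: "weft_at_most 1 C" and depth: "depth_at_most d C"
    and N_ge: "(k + length x + 2) ^ (2 ^ Suc d) \<le> N"
begin

abbreviation out :: nat where "out \<equiv> length C - 1"

definition bet :: nat where "bet = k + length x + 2"

lemma pred_less: "g < length C \<Longrightarrow> j \<in> set (preds (C ! g)) \<Longrightarrow> j < g"
  using circ unfolding circuit_def by blast

lemma out_less: "out < length C"
  using circ by (simp add: circuit_def)

lemma gar_le: "g < length C \<Longrightarrow> length (preds (C ! g)) \<le> g"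
proof -
  assume g: "g < length C"
  then have "length (preds (C ! g)) = card (set (preds (C ! g)))"
    using circ by (simp add: circuit_def distinct_card)
  also have "\<dots> \<le> card {..<g}"
    by (rule card_mono) (use pred_less[OF g] in auto)
  finally show ?thesis by simp
qed

lemma gar_less_N: "g < length C \<Longrightarrow> length (preds (C ! g)) < N"
  using gar_le[of g] length_C N by linarith

lemma bet_pow_le: "l \<le> Suc d \<Longrightarrow> bet ^ (2 ^ l) \<le> N"
proof -
  assume "l \<le> Suc d"
  then have "bet ^ (2 ^ l) \<le> bet ^ (2 ^ Suc d)"
    by (intro power_increasing) (simp_all add: bet_def del: power_Suc)
  then show ?thesis
    using N_ge unfolding bet_def by (rule order_trans)
qed

lemma betA: "betA A N = bet"
  using bet_pow_le[of 0] A N by (simp add: betA_def lenA[OF A N] bet_def word_array_def)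

text \<open>In contrast to an \<open>io_path\<close> it may begin at any gate, and so it follows a
  recursion that starts at the output gate and extends the path at its front.\<close>

definition upath :: "nat list \<Rightarrow> bool" where
  "upath qs \<longleftrightarrow> qs \<noteq> [] \<and> last qs = out \<and> set qs \<subseteq> {..<length C} \<and>
     (\<forall>i. Suc i < length qs \<longrightarrow> qs ! i \<in> set (preds (C ! (qs ! Suc i))))"

abbreviation large :: "nat \<Rightarrow> bool" where "large g \<equiv> length (preds (C ! g)) > 2"

lemma upath_out: "upath [out]"
  using out_less by (simp add: upath_def)

lemma upath_hd: "upath qs \<Longrightarrow> hd qs < length C"
  unfolding upath_def using hd_in_set by blast

lemma upath_Cons:
  assumes "upath qs" "j \<in> set (preds (C ! hd qs))"
  shows "upath (j # qs)"
proof -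
  have "j < length C"
    using pred_less[OF upath_hd[OF assms(1)] assms(2)] upath_hd[OF assms(1)] by simp
  then show ?thesis
    using assms by (auto simp: upath_def nth_Cons hd_conv_nth split: nat.splits)
qed

text \<open>A gate other than an input gate has a predecessor, whose position is smaller, so going
  backwards ends at an input gate. The bounds on depth and weft thereby hold for every path that
  ends at the output gate.\<close>

lemma upath_extend: "upath qs \<Longrightarrow> \<exists>ps. io_path C (ps @ qs)"
proof (induction "hd qs" arbitrary: qs rule: less_induct)
  case less
  show ?case
  proof (cases "C ! hd qs = Input")
    case True
    then have "io_path C ([] @ qs)"
      using less.prems upath_hd[OF less.prems] by (simp add: io_path_def upath_def input_gates_def)
    then show ?thesis by blast
  next
    case False
    have "preds (C ! hd qs) \<noteq> []"
      using circ upath_hd[OF less.prems] False unfolding circuit_def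
      by (cases "C ! hd qs") force+
    then obtain j where j: "j \<in> set (preds (C ! hd qs))" by (meson hd_in_set)
    have "\<exists>ps. io_path C (ps @ j # qs)"
      using less.hyps[of "j # qs"] pred_less[OF upath_hd[OF less.prems] j] upath_Cons[OF less.prems j]
      by simp
    then show ?thesis by (metis append.assoc append_Cons append_Nil)
  qed
qed

lemma upath_depth: "upath qs \<Longrightarrow> length qs \<le> Suc d"
  using upath_extend[of qs] depth unfolding depth_at_most_def by fastforce

lemma upath_weft: "upath qs \<Longrightarrow> length (filter large qs) \<le> 1"
  using upath_extend[of qs] weft unfolding weft_at_most_def by fastforce

text \<open>The bound \<open>d + 2 \<le> l + length qs\<close> says that the fuel lasts for the rest
  of the depth; at \<open>l = 0\<close> the path would be longer than the depth permits.\<close>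

lemma valA:
  assumes v: "valuation C v" "\<And>i. i \<in> input_gates C \<Longrightarrow> v i \<longleftrightarrow> M i"
  shows "upath qs \<Longrightarrow> d + 2 \<le> l + length qs \<Longrightarrow> valA A N M l (hd qs) \<longleftrightarrow> v (hd qs)"
proof (induction l arbitrary: qs)
  case 0
  then show ?case using upath_depth[of qs] by simp
next
  case (Suc l)
  let ?g = "hd qs"
  have g: "?g < length C" by (rule upath_hd[OF Suc.prems(1)])
  have IH: "valA A N M l j \<longleftrightarrow> v j" if "j \<in> set (preds (C ! ?g))" for j
    using Suc.IH[OF upath_Cons[OF Suc.prems(1) that]] Suc.prems(2) by simp
  have vg: "v ?g \<longleftrightarrow> gate_holds v ?g (C ! ?g)"
    using v(1) g by (simp add: valuation_def)
  have IH': "valA A N M l (gpredA A N ?g i) \<longleftrightarrow> v (preds (C ! ?g) ! i)" if "i < length (preds (C ! ?g))" for i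
    using IH[of "preds (C ! ?g) ! i"] that g by (simp add: gpredA)
  show ?case
  proof (cases "C ! ?g")
    case Input
    then show ?thesis
      using v(2)[of ?g] g by (simp add: gtypA input_gates_def)
  next
    case (Neg j)
    then show ?thesis
      using IH'[of 0] g vg by (simp add: gtypA)
  next
    case (Conj js)
    then have "valA A N M (Suc l) ?g \<longleftrightarrow> (\<forall>i<N. i < length js \<longrightarrow> v (js ! i))"
      using IH' g by (simp add: gtypA garA)
    also have "\<dots> \<longleftrightarrow> (\<forall>j\<in>set js. v j)"
      using gar_less_N[OF g] Conj by (auto simp: all_set_conv_all_nth)
    finally show ?thesis
      using vg Conj by simp
  next
    case (Disj js)
    then have "valA A N M (Suc l) ?g \<longleftrightarrow> (\<exists>i<N. i < length js \<and> v (js ! i))"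
      using IH' g by (auto simp: gtypA garA)
    also have "\<dots> \<longleftrightarrow> (\<exists>j\<in>set js. v j)"
    proof -
      have "length js < N" using gar_less_N[OF g] Disj by simp
      then show ?thesis by (metis in_set_conv_nth order.strict_trans)
    qed
    finally show ?thesis
      using vg Disj by simp
  qed
qed

text \<open>There is a large gate further on the path, so by the weft bound \<open>hd qs\<close> and
  everything below it is small. With at most two predecessors per gate, \<open>l\<close> levels
  reach at most \<open>2 ^ l\<close> input gates.\<close>

lemma valA_local:
  "upath qs \<Longrightarrow> d + 2 \<le> l + length qs \<Longrightarrow> filter large (tl qs) \<noteq> [] \<Longrightarrow>
     \<exists>V. finite V \<and> card V \<le> 2 ^ l \<and>
       (\<forall>M M'. (\<forall>i\<in>V. M i \<longleftrightarrow> M' i) \<longrightarrow> valA A N M l (hd qs) = valA A N M' l (hd qs))"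
proof (induction l arbitrary: qs)
  case 0
  then show ?case by (intro exI[of _ "{}"]) simp
next
  case (Suc l)
  let ?g = "hd qs"
  have g: "?g < length C" by (rule upath_hd[OF Suc.prems(1)])
  have qs: "qs = ?g # tl qs" using Suc.prems(1) by (simp add: upath_def)
  have small: "\<not> large ?g"
  proof
    assume "large ?g"
    then have "filter large qs = ?g # filter large (tl qs)"
      by (subst qs) simp
    then show False
      using upath_weft[OF Suc.prems(1)] Suc.prems(3) by simp
  qed
  have "filter large qs \<noteq> []"
    using Suc.prems(3) by (subst qs) simp
  then have "\<forall>j\<in>set (preds (C ! ?g)). \<exists>V. finite V \<and> card V \<le> 2 ^ l \<and>
       (\<forall>M M'. (\<forall>i\<in>V. M i \<longleftrightarrow> M' i) \<longrightarrow> valA A N M l j = valA A N M' l j)"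
    using Suc.IH[OF upath_Cons[OF Suc.prems(1)]] Suc.prems(2) by simp
  then obtain W where W: "\<And>j. j \<in> set (preds (C ! ?g)) \<Longrightarrow> finite (W j) \<and> card (W j) \<le> 2 ^ l \<and>
       (\<forall>M M'. (\<forall>i\<in>W j. M i \<longleftrightarrow> M' i) \<longrightarrow> valA A N M l j = valA A N M' l j)"
    by metis
  define V where "V = (if C ! ?g = Input then {?g} else \<Union>j\<in>set (preds (C ! ?g)). W j)"
  have "finite V" using W by (auto simp: V_def)
  moreover have "card V \<le> 2 ^ Suc l"
  proof (cases "C ! ?g = Input")
    case False
    have "card V \<le> (\<Sum>j\<in>set (preds (C ! ?g)). card (W j))"
      using False by (simp add: V_def card_UN_le)
    also have "\<dots> \<le> card (set (preds (C ! ?g))) * 2 ^ l"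
      using W by (intro sum_bounded_above[where 'a = nat, simplified]) auto
    also have "\<dots> \<le> 2 * 2 ^ l"
      using small card_length[of "preds (C ! ?g)"] by (intro mult_le_mono1) linarith
    finally show ?thesis by simp
  qed (simp add: V_def)
  moreover have "valA A N M (Suc l) ?g = valA A N M' (Suc l) ?g" if M: "\<forall>i\<in>V. M i \<longleftrightarrow> M' i" for M M'
  proof (cases "C ! ?g = Input")
    case True
    then show ?thesis using M g by (simp add: gtypA V_def)
  next
    case False
    have "valA A N M l j = valA A N M' l j" if "j \<in> set (preds (C ! ?g))" for j
    proof -
      have "\<forall>i\<in>W j. M i \<longleftrightarrow> M' i" using M that False by (auto simp: V_def)
      with W[OF that] show ?thesis by blast
    qed
    then have "valA A N M l (gpredA A N ?g i) = valA A N M' l (gpredA A N ?g i)"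
      if "i < length (preds (C ! ?g))" for i
      using that g by (simp add: gpredA)
    then show ?thesis
      using g False by (cases "C ! ?g") (auto simp: gtypA garA)
  qed
  ultimately show ?case by blast
qed

lemma phiA_large: "g < length C \<Longrightarrow> large g \<Longrightarrow> phiA A N M (Suc l) g =
    (\<Sum>i<length (preds (C ! g)). of_bool (valA A N M l (preds (C ! g) ! i)))"
proof -
  assume g: "g < length C" "large g"
  have "phiA A N M (Suc l) g = (\<Sum>i<N. of_bool (i < length (preds (C ! g)) \<and> valA A N M l (gpredA A N g i)))"
    using g by (cases "C ! g") (simp_all add: gtypA garA)
  also have "\<dots> = (\<Sum>i<length (preds (C ! g)). of_bool (i < length (preds (C ! g)) \<and> valA A N M l (gpredA A N g i)))"
    using gar_less_N[OF g(1)] by (intro sum.mono_neutral_right) auto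
  also have "\<dots> = (\<Sum>i<length (preds (C ! g)). of_bool (valA A N M l (preds (C ! g) ! i)))"
    using g by (intro sum.cong) (auto simp: gpredA)
  finally show ?thesis .
qed

lemma preds_small:
  assumes "g < length C" "\<not> large g"
  shows "C ! g = Conj js \<Longrightarrow> \<exists>a b. js = [a, b]" "C ! g = Disj js \<Longrightarrow> \<exists>a b. js = [a, b]"
proof -
  have "length js = 2 \<Longrightarrow> \<exists>a b. js = [a, b]"
    by (auto simp: numeral_2_eq_2 length_Suc_conv)
  moreover have "case C ! g of Input \<Rightarrow> True | Neg j \<Rightarrow> True
         | Conj js \<Rightarrow> length js \<ge> 2 | Disj js \<Rightarrow> length js \<ge> 2"
    using assms circ by (simp add: circuit_def)
  ultimately show "C ! g = Conj js \<Longrightarrow> \<exists>a b. js = [a, b]" "C ! g = Disj js \<Longrightarrow> \<exists>a b. js = [a, b]"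
    using assms(2) by auto
qed

text \<open>A binary small gate combines two numbers below \<open>bet ^ (2 ^ l)\<close> in this
  radix, which squares the bound; the count at a large gate is below \<open>bet\<close> in any
  case.\<close>

lemma phiA_less: "g < length C \<Longrightarrow> l \<le> Suc d \<Longrightarrow> phiA A N M l g < bet ^ (2 ^ l)"
proof (induction l arbitrary: g)
  case 0
  then show ?case by (simp add: bet_def)
next
  case (Suc l)
  note g = Suc.prems(1)
  have b: "bet ^ 1 \<le> bet ^ (2 ^ Suc l)"
    by (rule power_increasing) (simp_all add: bet_def)
  have b2: "2 \<le> bet" by (simp add: bet_def)
  have mono: "bet ^ (2 ^ l) \<le> bet ^ (2 ^ Suc l)"
    by (rule power_increasing) (simp_all add: bet_def)
  have IH: "phiA A N M l j < bet ^ (2 ^ l)" "phiA A N M l j < N" if "j \<in> set (preds (C ! g))" for j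
  proof -
    show 1: "phiA A N M l j < bet ^ (2 ^ l)"
      using Suc.IH[of j] pred_less[OF g that] Suc.prems by simp
    then show "phiA A N M l j < N"
      using bet_pow_le[of l] Suc.prems(2) by simp
  qed
  show ?case
  proof (cases "large g")
    case True
    have "phiA A N M (Suc l) g \<le> length (preds (C ! g))"
      unfolding phiA_large[OF g True]
      by simp (metis card_lessThan card_mono finite_lessThan inf_le1)
    also have "\<dots> < bet"
      using gar_le[OF g] g length_C by (simp add: bet_def)
    finally show ?thesis using b by simp
  next
    case False
    have pair: "phiA A N M l a + phiA A N M l b * bet ^ (2 ^ l) < bet ^ (2 ^ Suc l)"
      if "a \<in> set (preds (C ! g))" "b \<in> set (preds (C ! g))" for a b
    proof -
      have "phiA A N M l a + phiA A N M l b * bet ^ (2 ^ l) < (1 + phiA A N M l b) * bet ^ (2 ^ l)"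
        using IH(1)[OF that(1)] by (simp add: add_mult_distrib)
      also have "\<dots> \<le> bet ^ (2 ^ l) * bet ^ (2 ^ l)"
        using IH(1)[OF that(2)] by (intro mult_le_mono1) simp
      also have "\<dots> = bet ^ (2 ^ Suc l)"
        by (simp add: mult_2 flip: power_add)
      finally show ?thesis .
    qed
    show ?thesis
    proof (cases "C ! g")
      case Input
      then show ?thesis using g b b2 by (simp add: gtypA)
    next
      case (Neg j)
      then show ?thesis using g IH(1)[of j] mono by (simp add: gtypA garA gpredA)
    next
      case (Conj js)
      then obtain a b where "js = [a, b]" using preds_small(1)[OF g False] by blast
      with Conj False g pair[of a b] IH(2)[of b] show ?thesis
        by (simp add: gtypA garA gpredA betA)
    next
      case (Disj js)
      then obtain a b where "js = [a, b]" using preds_small(2)[OF g False] by blast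
      with Disj False g pair[of a b] IH(2)[of b] show ?thesis
        by (simp add: gtypA garA gpredA betA)
    qed
  qed
qed

lemma phiA_pair:
  assumes "g < length C" "C ! g = Conj [a, b] \<or> C ! g = Disj [a, b]" "l \<le> d"
  shows "phiA A N M (Suc l) g = phiA A N M l a + phiA A N M l b * bet ^ (2 ^ l)"
proof -
  have "b < length C" using pred_less[OF assms(1), of b] assms by auto
  then have "phiA A N M l b < N"
    using phiA_less[of b l M] bet_pow_le[of l] assms(3) by simp
  with assms show ?thesis by (auto simp: gtypA garA gpredA betA)
qed

text \<open>At a large gate the count decides: a conjunction needs all predecessors, a disjunction
  at least one. At a binary small gate the bound on the lower part lets division separate the
  numbers of the two predecessors.\<close>

lemma hhA:
  assumes v: "valuation C v" "\<And>i. i \<in> input_gates C \<Longrightarrow> v i \<longleftrightarrow> M i"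
  shows "upath qs \<Longrightarrow> d + 2 \<le> l + length qs \<Longrightarrow> l \<le> Suc d \<Longrightarrow>
    hhA A N l (hd qs) (phiA A N M l (hd qs)) \<longleftrightarrow> v (hd qs)"
proof (induction l arbitrary: qs)
  case 0
  then show ?case using upath_depth[of qs] by simp
next
  case (Suc l)
  let ?g = "hd qs"
  have g: "?g < length C" by (rule upath_hd[OF Suc.prems(1)])
  have IH: "hhA A N l j (phiA A N M l j) \<longleftrightarrow> v j" if "j \<in> set (preds (C ! ?g))" for j
    using Suc.IH[OF upath_Cons[OF Suc.prems(1) that]] Suc.prems(2,3) by simp
  have vg: "v ?g \<longleftrightarrow> gate_holds v ?g (C ! ?g)"
    using v(1) g by (simp add: valuation_def)
  show ?case
  proof (cases "large ?g")
    case True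
    let ?js = "preds (C ! ?g)"
    have "valA A N M l j \<longleftrightarrow> v j" if "j \<in> set ?js" for j
      using valA[OF v upath_Cons[OF Suc.prems(1) that], of l] Suc.prems(2) by simp
    then have phi: "phiA A N M (Suc l) ?g = (\<Sum>i<length ?js. of_bool (v (?js ! i)))"
      unfolding phiA_large[OF g True] by (intro sum.cong) auto
    have all: "(\<Sum>i<length ?js. of_bool (v (?js ! i))) = length ?js \<longleftrightarrow> (\<forall>j\<in>set ?js. v j)"
    proof -
      have "(\<Sum>i<length ?js. of_bool (v (?js ! i))) + (\<Sum>i<length ?js. of_bool (\<not> v (?js ! i))) =
          (\<Sum>i<length ?js. 1 :: nat)"
        unfolding sum.distrib[symmetric] by (rule sum.cong) auto
      moreover have "(\<Sum>i<length ?js. 1 :: nat) = length ?js" by simp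
      ultimately have "(\<Sum>i<length ?js. of_bool (v (?js ! i))) = length ?js \<longleftrightarrow>
          (\<Sum>i<length ?js. of_bool (\<not> v (?js ! i))) = (0 :: nat)"
        by linarith
      then show ?thesis by (simp add: all_set_conv_all_nth disjoint_iff)
    qed
    have ex: "(\<Sum>i<length ?js. of_bool (v (?js ! i))) \<noteq> (0 :: nat) \<longleftrightarrow> (\<exists>j\<in>set ?js. v j)"
      by (auto simp: in_set_conv_nth) (auto simp: disjoint_iff)
    show ?thesis
      unfolding phi using True g vg all ex
      by (cases "C ! ?g") (simp_all add: gtypA garA)
  next
    case False
    have pair: "modA N (phiA A N M l a + phiA A N M l b * bet ^ (2 ^ l)) (bet ^ (2 ^ l)) = phiA A N M l a"
      "divA N (phiA A N M l a + phiA A N M l b * bet ^ (2 ^ l)) (bet ^ (2 ^ l)) = phiA A N M l b"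
      if ab: "C ! ?g = Conj [a, b] \<or> C ! ?g = Disj [a, b]" for a b
    proof -
      have a: "a < length C" using pred_less[OF g, of a] g ab by auto
      then have a': "phiA A N M l a < bet ^ (2 ^ l)" using phiA_less[of a l M] Suc.prems(3) by simp
      have "phiA A N M (Suc l) ?g < N"
        using phiA_less[OF g, of "Suc l" M] bet_pow_le[of "Suc l"] Suc.prems(3) by linarith
      then have "phiA A N M l a + phiA A N M l b * bet ^ (2 ^ l) < N"
        using phiA_pair[OF g ab, of l M] Suc.prems(3) by simp
      with a' show "modA N (phiA A N M l a + phiA A N M l b * bet ^ (2 ^ l)) (bet ^ (2 ^ l)) = phiA A N M l a"
        "divA N (phiA A N M l a + phiA A N M l b * bet ^ (2 ^ l)) (bet ^ (2 ^ l)) = phiA A N M l b"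
        by (simp_all add: modA divA bet_def)
    qed
    show ?thesis
    proof (cases "C ! ?g")
      case Input
      then show ?thesis using v(2)[of ?g] g by (simp add: gtypA input_gates_def)
    next
      case (Neg j)
      then show ?thesis using IH[of j] g vg by (simp add: gtypA garA gpredA)
    next
      case (Conj js)
      then obtain a b where "js = [a, b]" using preds_small(1)[OF g False] by blast
      with Conj IH[of a] IH[of b] pair[of a b] phiA_pair[OF g, of a b l M] Suc.prems(3) g vg
      show ?thesis by (simp add: gtypA garA gpredA betA del: phiA.simps)
    next
      case (Disj js)
      then obtain a b where "js = [a, b]" using preds_small(2)[OF g False] by blast
      with Disj IH[of a] IH[of b] pair[of a b] phiA_pair[OF g, of a b l M] Suc.prems(3) g vg
      show ?thesis by (simp add: gtypA garA gpredA betA del: phiA.simps)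
    qed
  qed
qed

text \<open>A large gate itself may have a value of large degree, but its count is a sum of
  functions that depend on few inputs each. Packing two numbers in a fixed radix is linear and
  preserves the degree; this is why decoding is postponed to \<open>hhA\<close>.\<close>

lemma phiA_degree:
  "upath qs \<Longrightarrow> d + 2 \<le> l + length qs \<Longrightarrow> l \<le> Suc d \<Longrightarrow>
    degree_le (2 ^ l) (\<lambda>U. int (phiA A N (\<lambda>g. g \<in> U) l (hd qs)))"
proof (induction l arbitrary: qs)
  case 0
  then show ?case using upath_depth[of qs] by simp
next
  case (Suc l)
  let ?g = "hd qs"
  have g: "?g < length C" by (rule upath_hd[OF Suc.prems(1)])
  have qs: "qs = ?g # tl qs" using Suc.prems(1) by (simp add: upath_def)
  have pow: "(2 :: nat) ^ l \<le> 2 ^ Suc l" by simp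
  have IH: "degree_le (2 ^ Suc l) (\<lambda>U. int (phiA A N (\<lambda>g. g \<in> U) l j))" if "j \<in> set (preds (C ! ?g))" for j
    using Suc.IH[OF upath_Cons[OF Suc.prems(1) that]] Suc.prems(2,3)
    by (intro degree_le_mono[OF _ pow]) simp
  show ?case
  proof (cases "large ?g")
    case True
    have fl: "filter large qs \<noteq> []" using True by (subst qs) simp
    have "degree_le (2 ^ Suc l) (\<lambda>U. int (of_bool (valA A N (\<lambda>g. g \<in> U) l j)))"
      if j: "j \<in> set (preds (C ! ?g))" for j
    proof -
      obtain V where V: "finite V" "card V \<le> 2 ^ l"
        "\<And>M M'. (\<forall>i\<in>V. M i \<longleftrightarrow> M' i) \<Longrightarrow> valA A N M l j = valA A N M' l j"
        using valA_local[OF upath_Cons[OF Suc.prems(1) j], of l] fl Suc.prems(2) by auto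
      have "valA A N (\<lambda>g. g \<in> U) l j = valA A N (\<lambda>g. g \<in> U \<inter> V) l j" for U
        by (rule V(3)) simp
      then show ?thesis
        using V(1,2) pow by (intro degree_le_local[of V]) auto
    qed
    then show ?thesis
      unfolding phiA_large[OF g True] of_nat_sum by (intro degree_le_sum) simp
  next
    case False
    have pair: "degree_le (2 ^ Suc l) (\<lambda>U. int (phiA A N (\<lambda>g. g \<in> U) (Suc l) ?g))"
      if ab: "C ! ?g = Conj [a, b] \<or> C ! ?g = Disj [a, b]" for a b
    proof -
      have "degree_le (2 ^ Suc l) (\<lambda>U. int (phiA A N (\<lambda>g. g \<in> U) l a) +
          int (bet ^ (2 ^ l)) * int (phiA A N (\<lambda>g. g \<in> U) l b))"
        by (intro degree_le_add degree_le_cmult IH) (use ab in auto)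
      then show ?thesis
        using phiA_pair[OF g ab, of l] Suc.prems(3) by (simp add: mult.commute del: phiA.simps)
    qed
    show ?thesis
    proof (cases "C ! ?g")
      case Input
      then have "phiA A N (\<lambda>g. g \<in> U) (Suc l) ?g = of_bool (?g \<in> U)" for U
        using g by (simp add: gtypA)
      moreover have "degree_le (2 ^ Suc l) (\<lambda>U. int (of_bool (?g \<in> U)))"
        by (rule degree_le_local[of "{?g}"]) auto
      ultimately show ?thesis by (simp del: phiA.simps)
    next
      case (Neg j)
      then show ?thesis using IH[of j] g by (simp add: gtypA garA gpredA)
    next
      case (Conj js)
      then show ?thesis using preds_small(1)[OF g False] pair by blast
    next
      case (Disj js)
      then show ?thesis using preds_small(2)[OF g False] pair by blast
    qed
  qed
qed

definition Phi :: "nat set \<Rightarrow> nat" where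
  "Phi U = phiA A N (\<lambda>g. g \<in> U) (Suc d) out"

lemma Phi_less: "Phi U < bet ^ (2 ^ Suc d)"
  unfolding Phi_def by (rule phiA_less[OF out_less]) simp

lemma Phi_degree: "degree_le (2 ^ Suc d) (\<lambda>U. int (Phi U))"
  unfolding Phi_def using phiA_degree[OF upath_out, of "Suc d"] by (simp del: phiA.simps power_Suc)

section \<open>Weighted satisfiability in terms of Phi\<close>

lemma ex_valuation: "\<exists>v. valuation C v \<and> (\<forall>i\<in>input_gates C. v i \<longleftrightarrow> i \<in> S)"
proof -
  have "\<exists>v. \<forall>i<n. (v i \<longleftrightarrow> gate_holds v i (C ! i)) \<and> (C ! i = Input \<longrightarrow> (v i \<longleftrightarrow> i \<in> S))"
    if "n \<le> length C" for n
    using that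
  proof (induction n)
    case (Suc n)
    then obtain v where v: "\<And>i. i < n \<Longrightarrow> (v i \<longleftrightarrow> gate_holds v i (C ! i)) \<and> (C ! i = Input \<longrightarrow> (v i \<longleftrightarrow> i \<in> S))"
      by auto
    define v' where "v' = v(n := if C ! n = Input then n \<in> S else gate_holds v n (C ! n))"
    have eq: "gate_holds v' i (C ! i) \<longleftrightarrow> gate_holds v i (C ! i)" if "i \<le> n" "i < n \<or> C ! i \<noteq> Input" for i
    proof -
      have "v' j = v j" if "j \<in> set (preds (C ! i))" for j
        using pred_less[of i j] that \<open>i \<le> n\<close> Suc.prems by (simp add: v'_def)
      then show ?thesis
        using that by (cases "C ! i") (auto simp: v'_def)
    qed
    have "(v' i \<longleftrightarrow> gate_holds v' i (C ! i)) \<and> (C ! i = Input \<longrightarrow> (v' i \<longleftrightarrow> i \<in> S))" if "i < Suc n" for i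
    proof (cases "i = n")
      case True
      then show ?thesis using eq[of n] by (cases "C ! n = Input") (simp_all add: v'_def)
    next
      case False
      with that have i: "i < n" "i \<le> n" by simp_all
      from False have "v' i = v i" by (simp add: v'_def)
      with eq[OF i(2)] v[OF i(1)] i(1) show ?thesis by blast
    qed
    then show ?case by blast
  qed simp
  from this[of "length C"] show ?thesis
    unfolding valuation_def input_gates_def by blast
qed

lemma weighted_satisfiable_iff:
  "weighted_satisfiable C n \<longleftrightarrow> (\<exists>S \<subseteq> input_gates C. card S = n \<and> hhA A N (Suc d) out (Phi S))"
proof
  assume "weighted_satisfiable C n"
  then obtain v where v: "valuation C v" "card {i \<in> input_gates C. v i} = n" "v out"
    by (auto simp: weighted_satisfiable_def)
  let ?S = "{i \<in> input_gates C. v i}"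
  have M: "v i \<longleftrightarrow> i \<in> ?S" if "i \<in> input_gates C" for i
    using that by simp
  have "hhA A N (Suc d) (hd [out]) (phiA A N (\<lambda>g. g \<in> ?S) (Suc d) (hd [out])) \<longleftrightarrow> v (hd [out])"
    by (rule hhA[OF v(1) M upath_out]) simp_all
  then have "hhA A N (Suc d) out (Phi ?S)"
    unfolding Phi_def list.sel using v(3) by blast
  moreover have "?S \<subseteq> input_gates C" by simp
  ultimately show "\<exists>S \<subseteq> input_gates C. card S = n \<and> hhA A N (Suc d) out (Phi S)"
    using v(2) by (intro exI[of _ ?S] conjI)
next
  assume "\<exists>S \<subseteq> input_gates C. card S = n \<and> hhA A N (Suc d) out (Phi S)"
  then obtain S where S: "S \<subseteq> input_gates C" "card S = n" "hhA A N (Suc d) out (Phi S)"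
    by (elim exE conjE)
  obtain v where v: "valuation C v" "\<And>i. i \<in> input_gates C \<Longrightarrow> v i \<longleftrightarrow> i \<in> S"
    using ex_valuation[of S] by blast
  have "hhA A N (Suc d) (hd [out]) (phiA A N (\<lambda>g. g \<in> S) (Suc d) (hd [out])) \<longleftrightarrow> v (hd [out])"
    by (rule hhA[OF v upath_out]) simp_all
  then have "v out"
    using S(3) unfolding Phi_def list.sel by blast
  moreover have "{i \<in> input_gates C. v i} = S"
    using S(1) v(2) by auto
  ultimately show "weighted_satisfiable C n"
    using v(1) S(2) by (auto simp: weighted_satisfiable_def)
qed

end

section \<open>Items\<close>

text \<open>Bounds the degree of \<open>Phi\<close> and, as an exponent of the radix, also its
  values.\<close>

definition qq :: "nat \<Rightarrow> nat" where
  "qq d = 2 ^ Suc d"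

definition kA :: "(nat \<Rightarrow> nat) \<Rightarrow> nat \<Rightarrow> nat" where
  "kA A N = min N (A 0)"

definition digA :: "nat \<Rightarrow> nat \<Rightarrow> nat \<Rightarrow> nat \<Rightarrow> nat" where
  "digA N b a x = modA N (divA N x (b ^ a)) b"

text \<open>\<open>signedA\<close> consists of at most \<open>qq d\<close> sums with at most
  \<open>2 ^ qq d\<close> terms each, and every term is below
  \<open>betA A N ^ qq d\<close>.\<close>

definition offA :: "(nat \<Rightarrow> nat) \<Rightarrow> nat \<Rightarrow> nat \<Rightarrow> nat" where
  "offA A N d = (qq d * 2 ^ qq d) * betA A N ^ qq d"

text \<open>The first \<open>qq d\<close> digits of the number \<open>y\<close> of a tuple item form the index tuple, a tuple of
  numbers below \<open>k\<close>. The next \<open>qq d\<close> digits are input gates.\<close>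

definition idigA :: "(nat \<Rightarrow> nat) \<Rightarrow> nat \<Rightarrow> nat \<Rightarrow> nat \<Rightarrow> nat" where
  "idigA A N a y = digA N (betA A N) a y"

definition tdigA :: "(nat \<Rightarrow> nat) \<Rightarrow> nat \<Rightarrow> nat \<Rightarrow> nat \<Rightarrow> nat \<Rightarrow> nat" where
  "tdigA A N d a y = digA N (betA A N) (qq d + a) y"

definition memA :: "(nat \<Rightarrow> nat) \<Rightarrow> nat \<Rightarrow> nat \<Rightarrow> nat set \<Rightarrow> nat \<Rightarrow> nat \<Rightarrow> bool" where
  "memA A N d S y g \<longleftrightarrow> (\<exists>a\<in>S. tdigA A N d a y = g)"

definition outA :: "(nat \<Rightarrow> nat) \<Rightarrow> nat \<Rightarrow> nat" where
  "outA A N = num_gatesA A N - 1"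

definition phisA :: "(nat \<Rightarrow> nat) \<Rightarrow> nat \<Rightarrow> nat \<Rightarrow> nat set \<Rightarrow> nat \<Rightarrow> nat" where
  "phisA A N d S y = phiA A N (memA A N d S y) (Suc d) (outA A N)"

text \<open>A set of gates is listed by many tuples. Only the canonical one carries its weight, so
  that no set is counted twice.\<close>

definition canonA :: "(nat \<Rightarrow> nat) \<Rightarrow> nat \<Rightarrow> nat \<Rightarrow> nat \<Rightarrow> nat \<Rightarrow> bool" where
  "canonA A N d j y \<longleftrightarrow> (\<forall>a<qq d. Suc a < qq d \<longrightarrow>
     (if Suc a < j then tdigA A N d a y < tdigA A N d (Suc a) y else tdigA A N d a y = tdigA A N d (Suc a) y))"

text \<open>The terms of the Moebius sum with sign \<open>+\<close> for \<open>r = True\<close> and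
  with sign \<open>-\<close> otherwise; natural numbers force them apart.\<close>

definition signedA :: "(nat \<Rightarrow> nat) \<Rightarrow> nat \<Rightarrow> nat \<Rightarrow> bool \<Rightarrow> nat \<Rightarrow> nat" where
  "signedA A N d r y = (\<Sum>j\<in>{1..qq d}. if canonA A N d j y then
     \<Sum>S\<in>{S \<in> Pow {..<j}. even (j - card S) = r}. phisA A N d S y else 0)"

text \<open>The last condition compares gates within a single tuple. As \<open>qq d\<close> is at
  least \<open>2\<close>, any two indices occur together in some tuple, so over all items it forces
  the selected gates to increase with their index.\<close>

definition validA :: "(nat \<Rightarrow> nat) \<Rightarrow> nat \<Rightarrow> nat \<Rightarrow> nat \<Rightarrow> bool" where
  "validA A N d y \<longleftrightarrow> (\<forall>a<qq d. idigA A N a y < kA A N \<and> tdigA A N d a y < num_gatesA A N \<and>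
     gtypA A N (tdigA A N d a y) = 0 \<and>
     (\<forall>a'<qq d. idigA A N a y < idigA A N a' y \<longrightarrow> tdigA A N d a y < tdigA A N d a' y))"

definition matchA :: "(nat \<Rightarrow> nat) \<Rightarrow> nat \<Rightarrow> nat \<Rightarrow> nat \<Rightarrow> nat \<Rightarrow> bool" where
  "matchA A N d y J \<longleftrightarrow> (\<forall>a<qq d. idigA A N a y = digA N (kA A N) a J)"

definition diagA :: "(nat \<Rightarrow> nat) \<Rightarrow> nat \<Rightarrow> nat \<Rightarrow> nat \<Rightarrow> nat \<Rightarrow> nat \<Rightarrow> bool" where
  "diagA A N d a y J \<longleftrightarrow> (\<forall>a'<qq d. idigA A N a' y = digA N (kA A N) a J)"

text \<open>If the index tuple \<open>J\<close> is constant, the same item plays both roles, and the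
  sum compares its \<open>a\<close>-th gate with its own gate \<open>0\<close>.\<close>

definition consA :: "(nat \<Rightarrow> nat) \<Rightarrow> nat \<Rightarrow> nat \<Rightarrow> nat \<Rightarrow> nat \<Rightarrow> nat \<Rightarrow> nat" where
  "consA A N d a y J = (if a = qq d then of_bool (matchA A N d y J)
     else (if matchA A N d y J then betA A N - tdigA A N d a y else 0) +
       (if diagA A N d a y J then tdigA A N d 0 y else 0))"

definition weightA :: "(nat \<Rightarrow> nat) \<Rightarrow> nat \<Rightarrow> nat \<Rightarrow> nat \<Rightarrow> nat" where
  "weightA A N d y = offA A N d + signedA A N d True y - signedA A N d False y"

text \<open>Coordinate \<open>0\<close> adds up to the value of \<open>phiA\<close>, coordinate \<open>1\<close> forces the choice of exactly one
  guess of this value, and the coordinates \<open>2 + a * k ^ q + J\<close> force the choice of exactly one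
  tuple item with index tuple \<open>J\<close> (for \<open>a = q\<close>) and the consistency of its \<open>a\<close>-th gate with the
  item of the constant index tuple \<open>J\<^sub>a\<close> (for \<open>a < q\<close>).\<close>

definition tupleA :: "(nat \<Rightarrow> nat) \<Rightarrow> nat \<Rightarrow> nat \<Rightarrow> nat \<Rightarrow> nat \<Rightarrow> nat" where
  "tupleA A N d y c = (if \<not> validA A N d y then 0 else if c = 0 then weightA A N d y
     else \<Sum>a<Suc (qq d). if 2 + a * kA A N ^ qq d \<le> c \<and> c < 2 + Suc a * kA A N ^ qq d
       then consA A N d a y (c - (2 + a * kA A N ^ qq d)) else 0)"

definition guessA :: "(nat \<Rightarrow> nat) \<Rightarrow> nat \<Rightarrow> nat \<Rightarrow> nat \<Rightarrow> nat \<Rightarrow> nat" where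
  "guessA A N d b c = (if hhA A N (Suc d) (outA A N) b
     then (if c = 0 then betA A N ^ qq d - b else of_bool (c = 1)) else 0)"

text \<open>Two empty items come first. The graph takes from them a common neighbour for the
  leftover vertices and an isolated vertex.\<close>

definition contribA :: "(nat \<Rightarrow> nat) \<Rightarrow> nat \<Rightarrow> nat \<Rightarrow> nat \<Rightarrow> nat \<Rightarrow> nat" where
  "contribA A N d x c = (if x < 2 then 0 else if x - 2 < betA A N ^ (2 * qq d) then tupleA A N d (x - 2) c
     else guessA A N d (x - 2 - betA A N ^ (2 * qq d)) c)"

definition itemsA :: "(nat \<Rightarrow> nat) \<Rightarrow> nat \<Rightarrow> nat \<Rightarrow> nat" where
  "itemsA A N d = 2 + betA A N ^ (2 * qq d) + betA A N ^ qq d"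

definition coordsA :: "(nat \<Rightarrow> nat) \<Rightarrow> nat \<Rightarrow> nat \<Rightarrow> nat" where
  "coordsA A N d = 2 + Suc (qq d) * kA A N ^ qq d"

text \<open>The subtracted number is the value at the empty set, the only term of the Moebius
  expansion that no tuple represents.\<close>

definition targetA :: "(nat \<Rightarrow> nat) \<Rightarrow> nat \<Rightarrow> nat \<Rightarrow> nat \<Rightarrow> nat" where
  "targetA A N d c = (if c = 0 then
       min N (kA A N ^ qq d) * offA A N d + betA A N ^ qq d - phisA A N d {} 0
     else if c = 1 then 1 else if c < 2 + qq d * kA A N ^ qq d then betA A N else 1)"

subsection \<open>Computability\<close>

lemma cmpb_app2:
  assumes "cmpb 3 (\<lambda>A s. F A (s 0) (s 1) (s 2))" "cmp n a" "cmp n b" "0 < n"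
  shows "cmpb n (\<lambda>A s. F A (s 0) (a A s) (b A s))"
  using cmp_app2[where F = "\<lambda>A N x y. of_bool (F A N x y)"] assms by (simp add: cmpb_def)

lemma cmp_power:
  assumes "cmp n f" "0 < n"
  shows "cmp n (\<lambda>A s. min (s 0) (f A s) ^ a)"
proof (induction a)
  case (Suc a)
  show ?case
    unfolding power_Suc by (intro cmp_mult Suc assms)
qed (simp add: cmp_const)

lemma cmp_betA: "0 < n \<Longrightarrow> cmp n (\<lambda>A s. betA A (s 0))"
  unfolding betA_def by (rule cmp_intros cmp_lenA | (simp cong: if_cong; fail))+

lemma cmp_betA_power: "0 < n \<Longrightarrow> cmp n (\<lambda>A s. betA A (s 0) ^ a)"
  unfolding betA_def by (rule cmp_power) (rule cmp_intros cmp_lenA | (simp cong: if_cong; fail))+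

lemma cmp_kA: "0 < n \<Longrightarrow> cmp n (\<lambda>A s. kA A (s 0))"
  unfolding kA_def by (rule cmp_intros | (simp cong: if_cong; fail))+

lemma cmp_kA_power: "0 < n \<Longrightarrow> cmp n (\<lambda>A s. kA A (s 0) ^ a)"
  unfolding kA_def by (rule cmp_power) (rule cmp_intros | (simp cong: if_cong; fail))+

lemma cmp_divA: "cmp n a \<Longrightarrow> cmp n b \<Longrightarrow> 0 < n \<Longrightarrow> cmp n (\<lambda>A s. divA (s 0) (a A s) (b A s))"
  by (rule cmp_app2[where F = "\<lambda>A. divA"], unfold divA_def) (rule cmp_intros | (simp cong: if_cong; fail))+

lemma cmp_modA: "cmp n a \<Longrightarrow> cmp n b \<Longrightarrow> 0 < n \<Longrightarrow> cmp n (\<lambda>A s. modA (s 0) (a A s) (b A s))"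
  by (rule cmp_app2[where F = "\<lambda>A. modA"], unfold modA_def)
    (rule cmp_intros cmp_divA | (simp cong: if_cong; fail))+

lemma cmp_digA_bet: "cmp n x \<Longrightarrow> 0 < n \<Longrightarrow> cmp n (\<lambda>A s. digA (s 0) (betA A (s 0)) a (x A s))"
  unfolding digA_def by (intro cmp_modA cmp_divA cmp_betA cmp_betA_power)

lemma cmp_digA_k: "cmp n x \<Longrightarrow> 0 < n \<Longrightarrow> cmp n (\<lambda>A s. digA (s 0) (kA A (s 0)) a (x A s))"
  unfolding digA_def by (intro cmp_modA cmp_divA cmp_kA cmp_kA_power)

lemma cmp_idigA: "cmp n x \<Longrightarrow> 0 < n \<Longrightarrow> cmp n (\<lambda>A s. idigA A (s 0) a (x A s))"
  unfolding idigA_def by (rule cmp_digA_bet)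

lemma cmp_tdigA: "cmp n x \<Longrightarrow> 0 < n \<Longrightarrow> cmp n (\<lambda>A s. tdigA A (s 0) d a (x A s))"
  unfolding tdigA_def by (rule cmp_digA_bet)

lemma cmp_offA: "0 < n \<Longrightarrow> cmp n (\<lambda>A s. offA A (s 0) d)"
  unfolding offA_def by (intro cmp_cmult cmp_betA_power)

lemma cmp_outA: "0 < n \<Longrightarrow> cmp n (\<lambda>A s. outA A (s 0))"
  unfolding outA_def by (intro cmp_diff cmp_num_gatesA cmp_const)

lemma cmpb_memA:
  "finite S \<Longrightarrow> cmp n y \<Longrightarrow> cmp n g \<Longrightarrow> 0 < n \<Longrightarrow> cmpb n (\<lambda>A s. memA A (s 0) d S (y A s) (g A s))"
  unfolding memA_def by (intro cmpb_bex_finite cmpb_eq cmp_tdigA)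

lemma cmpb_valA:
  assumes S: "finite S"
  shows "cmp n y \<Longrightarrow> cmp n g \<Longrightarrow> 0 < n \<Longrightarrow> cmpb n (\<lambda>A s. valA A (s 0) (memA A (s 0) d S (y A s)) l (g A s))"
proof (induction l arbitrary: n y g)
  case 0
  then show ?case by (simp add: cmpb_const)
next
  case (Suc l)
  have if_bool: "(if P then Q else R) \<longleftrightarrow> (P \<and> Q) \<or> (\<not> P \<and> R)" for P Q R by simp
  have "cmpb 3 (\<lambda>A s. valA A (s 0) (memA A (s 0) d S (s 1)) (Suc l) (s 2))"
    unfolding valA.simps if_bool
    by (rule Suc.IH cmp_intros cmpb_memA[OF S] cmp_gtypA cmp_garA cmp_gpredA | (simp cong: if_cong; fail))+
  from cmpb_app2[where F = "\<lambda>A N y g. valA A N (memA A N d S y) (Suc l) g", OF this Suc.prems]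
  show ?case .
qed

lemma cmp_phiA:
  assumes S: "finite S"
  shows "cmp n y \<Longrightarrow> cmp n g \<Longrightarrow> 0 < n \<Longrightarrow> cmp n (\<lambda>A s. phiA A (s 0) (memA A (s 0) d S (y A s)) l (g A s))"
proof (induction l arbitrary: n y g)
  case 0
  then show ?case by (simp add: cmp_const)
next
  case (Suc l)
  have "cmp 3 (\<lambda>A s. phiA A (s 0) (memA A (s 0) d S (s 1)) (Suc l) (s 2))"
    unfolding phiA.simps
    by (rule Suc.IH cmp_intros cmpb_memA[OF S] cmpb_valA[OF S] cmp_gtypA cmp_garA cmp_gpredA cmp_betA_power |
        (simp cong: if_cong; fail))+
  from cmp_app2[where F = "\<lambda>A N y g. phiA A N (memA A N d S y) (Suc l) g", OF this Suc.prems]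
  show ?case .
qed

lemma cmpb_hhA: "cmp n g \<Longrightarrow> cmp n b \<Longrightarrow> 0 < n \<Longrightarrow> cmpb n (\<lambda>A s. hhA A (s 0) l (g A s) (b A s))"
proof (induction l arbitrary: n g b)
  case 0
  then show ?case by (simp add: cmpb_const)
next
  case (Suc l)
  have if_bool: "(if P then Q else R) \<longleftrightarrow> (P \<and> Q) \<or> (\<not> P \<and> R)" for P Q R by simp
  have "cmpb 3 (\<lambda>A s. hhA A (s 0) (Suc l) (s 1) (s 2))"
    unfolding hhA.simps if_bool
    by (rule Suc.IH cmp_intros cmp_gtypA cmp_garA cmp_gpredA cmp_betA_power cmp_modA cmp_divA |
        (simp cong: if_cong; fail))+
  from cmpb_app2[where F = "\<lambda>A N g b. hhA A N (Suc l) g b", OF this Suc.prems]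
  show ?case .
qed

lemma cmp_phisA: "finite S \<Longrightarrow> cmp n y \<Longrightarrow> 0 < n \<Longrightarrow> cmp n (\<lambda>A s. phisA A (s 0) d S (y A s))"
  unfolding phisA_def by (intro cmp_phiA cmp_outA)

lemma cmpb_canonA: "cmp n y \<Longrightarrow> 0 < n \<Longrightarrow> cmpb n (\<lambda>A s. canonA A (s 0) d j (y A s))"
proof -
  assume *: "cmp n y" "0 < n"
  have if_bool: "(if P then Q else R) \<longleftrightarrow> (P \<and> Q) \<or> (\<not> P \<and> R)" for P Q R by simp
  show ?thesis
    unfolding canonA_def if_bool
    by (intro cmpb_all_less cmpb_imp cmpb_disj cmpb_conj cmpb_const cmpb_less cmpb_eq cmp_tdigA *)
qed

lemma cmp_signedA: "cmp n y \<Longrightarrow> 0 < n \<Longrightarrow> cmp n (\<lambda>A s. signedA A (s 0) d r (y A s))"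
  unfolding signedA_def
  by (intro cmp_sum_finite cmp_if cmpb_canonA cmp_const cmp_phisA) (auto intro: finite_subset)

lemma cmpb_validA: "cmp n y \<Longrightarrow> 0 < n \<Longrightarrow> cmpb n (\<lambda>A s. validA A (s 0) d (y A s))"
  unfolding validA_def
  by (intro cmpb_all_less cmpb_imp cmpb_conj cmpb_less cmpb_eq cmp_tdigA cmp_idigA cmp_kA cmp_num_gatesA
      cmp_gtypA cmp_const)

lemma cmpb_matchA: "cmp n y \<Longrightarrow> cmp n J \<Longrightarrow> 0 < n \<Longrightarrow> cmpb n (\<lambda>A s. matchA A (s 0) d (y A s) (J A s))"
  unfolding matchA_def by (intro cmpb_all_less cmpb_eq cmp_idigA cmp_digA_k)

lemma cmpb_diagA: "cmp n y \<Longrightarrow> cmp n J \<Longrightarrow> 0 < n \<Longrightarrow> cmpb n (\<lambda>A s. diagA A (s 0) d a (y A s) (J A s))"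
  unfolding diagA_def by (intro cmpb_all_less cmpb_eq cmp_idigA cmp_digA_k)

lemma cmp_consA: "cmp n y \<Longrightarrow> cmp n J \<Longrightarrow> 0 < n \<Longrightarrow> cmp n (\<lambda>A s. consA A (s 0) d a (y A s) (J A s))"
  unfolding consA_def
  by (intro cmp_if[OF cmpb_const] cmp_of_bool cmpb_matchA cmp_add cmp_if[OF cmpb_matchA] cmp_if[OF cmpb_diagA]
      cmp_diff cmp_betA cmp_tdigA cmp_const)

lemma cmp_contribA:
  "cmp n x \<Longrightarrow> cmp n c \<Longrightarrow> 0 < n \<Longrightarrow> cmp n (\<lambda>A s. contribA A (s 0) d (x A s) (c A s))"
proof (rule cmp_app2[where F = "\<lambda>A N x c. contribA A N d x c"])
  have t: "cmp n y \<Longrightarrow> cmp n c \<Longrightarrow> 0 < n \<Longrightarrow> cmp n (\<lambda>A s. tupleA A (s 0) d (y A s) (c A s))" for n y c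
    unfolding tupleA_def weightA_def
    by (intro cmp_if cmpb_not cmpb_validA cmp_const cmpb_eq cmp_add cmp_diff cmp_offA cmp_signedA cmp_sum_finite
        cmpb_conj cmpb_le cmpb_less cmp_consA cmp_cmult cmp_kA_power finite_lessThan)
  have g: "cmp n b \<Longrightarrow> cmp n c \<Longrightarrow> 0 < n \<Longrightarrow> cmp n (\<lambda>A s. guessA A (s 0) d (b A s) (c A s))" for n b c
    unfolding guessA_def
    by (intro cmp_if cmpb_hhA cmp_outA cmpb_eq cmp_const cmp_diff cmp_betA_power cmp_of_bool)
  show "cmp 3 (\<lambda>A s. contribA A (s 0) d (s 1) (s 2))"
    unfolding contribA_def
    by (rule t g cmp_if cmp_const cmpb_less cmp_diff cmp_betA_power cmp_var | (simp; fail))+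
qed

lemma cmp_itemsA: "0 < n \<Longrightarrow> cmp n (\<lambda>A s. itemsA A (s 0) d)"
  unfolding itemsA_def by (intro cmp_add cmp_const cmp_betA_power)

lemma cmp_coordsA: "0 < n \<Longrightarrow> cmp n (\<lambda>A s. coordsA A (s 0) d)"
  unfolding coordsA_def by (intro cmp_add cmp_const cmp_cmult cmp_kA_power)

lemma cmp_targetA: "cmp n c \<Longrightarrow> 0 < n \<Longrightarrow> cmp n (\<lambda>A s. targetA A (s 0) d (c A s))"
  unfolding targetA_def
  by (intro cmp_if cmpb_eq cmp_const cmp_diff cmp_add cmp_mult cmp_kA_power cmp_offA cmp_betA_power
      cmp_phisA cmpb_less cmp_cmult cmp_betA finite.emptyI)

subsection \<open>Digits\<close>

lemma digits_eqI:
  fixes x y b :: nat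
  shows "x < b ^ n \<Longrightarrow> y < b ^ n \<Longrightarrow> (\<And>a. a < n \<Longrightarrow> x div b ^ a mod b = y div b ^ a mod b) \<Longrightarrow> x = y"
proof (induction n arbitrary: x y)
  case (Suc n)
  have b: "0 < b" using Suc.prems(1) by (cases b) auto
  have "x div b = y div b"
  proof (rule Suc.IH)
    show "x div b < b ^ n" "y div b < b ^ n"
      using Suc.prems(1,2) by (simp_all add: less_mult_imp_div_less mult.commute)
    show "x div b div b ^ a mod b = y div b div b ^ a mod b" if "a < n" for a
      using Suc.prems(3)[of "Suc a"] that by (simp add: div_mult2_eq)
  qed
  moreover have "x mod b = y mod b"
    using Suc.prems(3)[of 0] by simp
  ultimately show ?case by (metis div_mult_mod_eq)
qed simp

lemma digits_ex:
  fixes b :: nat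
  shows "(\<And>a. a < n \<Longrightarrow> f a < b) \<Longrightarrow> \<exists>x<b ^ n. \<forall>a<n. x div b ^ a mod b = f a"
proof (induction n arbitrary: f)
  case (Suc n)
  obtain x where x: "x < b ^ n" "\<And>a. a < n \<Longrightarrow> x div b ^ a mod b = f (Suc a)"
    using Suc.IH[of "\<lambda>a. f (Suc a)"] Suc.prems by auto
  have f0: "f 0 < b" using Suc.prems by simp
  have d: "(f 0 + b * x) div b = x" "(f 0 + b * x) mod b = f 0"
    using f0 by simp_all
  have "f 0 + b * x < b * Suc x" using f0 by simp
  also have "\<dots> \<le> b * b ^ n" using x(1) by (intro mult_le_mono2) simp
  finally have "f 0 + b * x < b ^ Suc n" by simp
  moreover have "(f 0 + b * x) div b ^ a mod b = f a" if "a < Suc n" for a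
    using that d x(2) by (cases a) (simp_all only: power_0 div_by_1 power_Suc div_mult2_eq Suc_less_eq)
  ultimately show ?case by blast
qed simp

lemma digA: "x < N \<Longrightarrow> 0 < b \<Longrightarrow> digA N b a x = x div b ^ a mod b"
proof -
  assume *: "x < N" "0 < b"
  then have "x div b ^ a < N"
    using div_le_dividend[of x "b ^ a"] by linarith
  with * show ?thesis by (simp add: digA_def divA modA)
qed

subsection \<open>Canonical tuples\<close>

text \<open>A set of \<open>j\<close> numbers is represented by the tuple that lists its elements in increasing order
  and then repeats the last one.\<close>

definition canon :: "nat \<Rightarrow> nat \<Rightarrow> (nat \<Rightarrow> nat) \<Rightarrow> bool" where
  "canon q j t \<longleftrightarrow> (\<forall>a. Suc a < q \<longrightarrow> (if Suc a < j then t a < t (Suc a) else t a = t (Suc a)))"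

lemma canon_cong: "(\<And>a. a < q \<Longrightarrow> t a = u a) \<Longrightarrow> canon q j t \<longleftrightarrow> canon q j u"
  by (auto simp: canon_def)

lemma canon_sorted: "canon q j t \<Longrightarrow> j \<le> q \<Longrightarrow> sorted_wrt (<) (map t [0..<j])"
  by (auto simp: canon_def sorted_wrt_iff_nth_Suc_transp)

lemma canon_inj: "canon q j t \<Longrightarrow> j \<le> q \<Longrightarrow> inj_on t {..<j}"
  using canon_sorted[of q j t] by (auto simp: strict_sorted_iff distinct_map atLeast0LessThan)

lemma canon_tail: "canon q j t \<Longrightarrow> 1 \<le> j \<Longrightarrow> j \<le> a \<Longrightarrow> a < q \<Longrightarrow> t a = t (j - 1)"
proof (induction a)
  case (Suc a)
  have "t a = t (Suc a)"
    using Suc.prems by (simp add: canon_def not_less)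
  then show ?case
    using Suc by (cases "j = Suc a") simp_all
qed simp

lemma canon_eqI:
  assumes "canon q j t" "canon q j u" "1 \<le> j" "j \<le> q" "t ` {..<j} = u ` {..<j}" "a < q"
  shows "t a = u a"
proof -
  have "map t [0..<j] = map u [0..<j]"
    using assms by (intro strict_sorted_equal canon_sorted[of q]) (auto simp: atLeast0LessThan)
  then have eq: "t b = u b" if "b < j" for b
    using that by (auto simp: list_eq_iff_nth_eq)
  show ?thesis
    using eq[of a] eq[of "j - 1"] canon_tail[OF assms(1), of a] canon_tail[OF assms(2), of a] assms(3,6)
    by (cases "a < j") auto
qed

lemma canon_ex:
  assumes "finite K" "card K = j" "1 \<le> j" "j \<le> q"
  obtains t where "canon q j t" "t ` {..<j} = K" "\<And>a. t a \<in> K"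
proof
  define xs where "xs = sorted_list_of_set K"
  have xs: "sorted_wrt (<) xs" "length xs = j" "set xs = K"
    using assms(1,2) by (simp_all add: xs_def)
  define t where "t a = xs ! (min a (j - 1))" for a
  show "canon q j t"
    unfolding canon_def
  proof (intro allI impI)
    fix a
    have "Suc a < j \<Longrightarrow> min a (j - 1) = a \<and> min (Suc a) (j - 1) = Suc a"
      "\<not> Suc a < j \<Longrightarrow> min a (j - 1) = min (Suc a) (j - 1)"
      by linarith+
    then show "if Suc a < j then t a < t (Suc a) else t a = t (Suc a)"
      using xs(1,2) by (simp add: t_def sorted_wrt_nth_less)
  qed
  show mem: "t a \<in> K" for a
  proof -
    have "min a (j - 1) < length xs" using xs(2) assms(3) by linarith
    then show ?thesis using xs(3) nth_mem unfolding t_def by blast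
  qed
  have "x \<in> t ` {..<j}" if "x \<in> K" for x
  proof -
    have "x \<in> set xs" by (simp add: xs(3) that)
    then obtain i where i: "i < length xs" "xs ! i = x" by (auto simp: in_set_conv_nth)
    then have "i < j" "min i (j - 1) = i" using xs(2) by linarith+
    then have "t i = x" using i(2) by (simp add: t_def)
    with \<open>i < j\<close> show ?thesis by blast
  qed
  then show "t ` {..<j} = K" using mem by blast
qed

text \<open>On canonical tuples, passing to the set of the first \<open>j\<close> digits is a
  bijection onto the sets of \<open>j\<close> indices: the set determines its increasing list, and
  the list the remaining digits.\<close>

lemma sum_canon:
  fixes F :: "nat set \<Rightarrow> int"
  assumes "1 \<le> j" "j \<le> q"
  shows "(\<Sum>J<k ^ q. if canon q j (\<lambda>a. J div k ^ a mod k) then F ((\<lambda>a. J div k ^ a mod k) ` {..<j}) else 0) =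
    (\<Sum>K\<in>{K. K \<subseteq> {..<k} \<and> card K = j}. F K)"
proof -
  let ?t = "\<lambda>J a. J div k ^ a mod k"
  let ?A = "{J. J < k ^ q \<and> canon q j (?t J)}"
  let ?f = "\<lambda>J. ?t J ` {..<j}"
  have k: "0 < k" if "J < k ^ q" for J
    using that assms by (cases k) (auto simp: zero_power)
  have inj: "inj_on ?f ?A"
  proof (rule inj_onI)
    fix J J'
    assume J: "J \<in> ?A" "J' \<in> ?A" "?f J = ?f J'"
    then have c: "canon q j (?t J)" "canon q j (?t J')" by simp_all
    show "J = J'"
      by (rule digits_eqI[of J k q J', OF _ _ canon_eqI[OF c assms J(3)]]) (use J in simp_all)
  qed
  have "?f ` ?A = {K. K \<subseteq> {..<k} \<and> card K = j}"
  proof (intro equalityI subsetI)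
    fix K assume "K \<in> ?f ` ?A"
    then obtain J where J: "J < k ^ q" "canon q j (?t J)" "K = ?f J" by blast
    then show "K \<in> {K. K \<subseteq> {..<k} \<and> card K = j}"
      using k[OF J(1)] canon_inj[OF J(2) assms(2)] by (auto simp: card_image)
  next
    fix K assume "K \<in> {K. K \<subseteq> {..<k} \<and> card K = j}"
    then have K: "K \<subseteq> {..<k}" "card K = j" "finite K"
      by (auto intro: finite_subset)
    obtain t where t: "canon q j t" "t ` {..<j} = K" "\<And>a. t a \<in> K"
      using canon_ex[OF K(3,2) assms] by metis
    have "t a < k" for a using t(3) K(1) by blast
    then obtain J where J: "J < k ^ q" "\<And>a. a < q \<Longrightarrow> ?t J a = t a"
      using digits_ex[of q t k] by blast
    have "canon q j (?t J)"
      using t(1) canon_cong[of q "?t J" t j] J(2) by simp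
    moreover have "?f J = K"
      using t(2) J(2) assms(2) by (auto simp: image_def)
    ultimately show "K \<in> ?f ` ?A" using J(1) by blast
  qed
  then have "(\<Sum>K\<in>{K. K \<subseteq> {..<k} \<and> card K = j}. F K) = (\<Sum>J\<in>?A. F (?f J))"
    using sum.reindex[OF inj, of F] by simp
  also have "\<dots> = (\<Sum>J<k ^ q. if canon q j (?t J) then F (?f J) else 0)"
    by (rule sum.mono_neutral_cong_left) auto
  finally show ?thesis ..
qed

section \<open>Selecting items\<close>

declare valA.simps [simp del] phiA.simps [simp del] hhA.simps [simp del]

lemma sum_sign:
  fixes f :: "'b \<Rightarrow> nat"
  assumes "finite B"
  shows "(\<Sum>x\<in>B. (-1) ^ n x * int (f x)) =
    int (\<Sum>x\<in>{x \<in> B. even (n x) = True}. f x) - int (\<Sum>x\<in>{x \<in> B. even (n x) = False}. f x)"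
proof -
  have "int (\<Sum>x\<in>{x \<in> B. even (n x) = True}. f x) - int (\<Sum>x\<in>{x \<in> B. even (n x) = False}. f x) =
      (\<Sum>x\<in>B. (if even (n x) then int (f x) else 0) - (if odd (n x) then int (f x) else 0))"
    by (simp add: of_nat_sum sum.inter_filter[OF assms] sum_subtractf if_distrib[of int] cong: if_cong)
  also have "\<dots> = (\<Sum>x\<in>B. (-1) ^ n x * int (f x))"
    by (rule sum.cong) auto
  finally show ?thesis ..
qed

text \<open>By \<open>N_big\<close> the loop bound exceeds all numbers of tuple items and of index
  tuples, so that the bounded division yields their true digits.\<close>

locale reduction = weft_one +
  assumes N_big: "2 + bet ^ (2 * qq d) + bet ^ qq d \<le> N"
begin

abbreviation q :: nat where "q \<equiv> qq d"

abbreviation I :: "nat \<Rightarrow> nat \<Rightarrow> nat" where "I y a \<equiv> idigA A N a y"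

abbreviation T :: "nat \<Rightarrow> nat \<Rightarrow> nat" where "T y a \<equiv> tdigA A N d a y"

abbreviation dig :: "nat \<Rightarrow> nat \<Rightarrow> nat" where "dig J a \<equiv> J div k ^ a mod k"

lemma q_ge: "2 \<le> q"
  by (simp add: qq_def)

lemma bet_pos: "0 < bet"
  by (simp add: bet_def)

lemma bet_q_pos: "0 < bet ^ n"
  using bet_pos by simp

lemma k_less: "k < bet"
  by (simp add: bet_def)

lemma kA: "kA A N = k"
  using k_less bet_pow_le[of 0] A by (simp add: kA_def word_array_def)

lemma kq_le: "k ^ q \<le> bet ^ q"
  using k_less by (intro power_mono) auto

lemma k_pos: "J < k ^ q \<Longrightarrow> 0 < k"
  using q_ge by (cases k) (auto simp: zero_power)

lemma idig: "y < bet ^ (2 * q) \<Longrightarrow> I y a = y div bet ^ a mod bet"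
  using N_big bet_pos by (simp add: idigA_def betA digA)

lemma tdig: "y < bet ^ (2 * q) \<Longrightarrow> T y a = y div bet ^ (q + a) mod bet"
  using N_big bet_pos by (simp add: tdigA_def betA digA)

lemma tdig_less: "y < bet ^ (2 * q) \<Longrightarrow> T y a < bet"
  using bet_pos by (simp add: tdig)

lemma digK: "J < k ^ q \<Longrightarrow> digA N (kA A N) a J = dig J a"
  using N_big kq_le k_pos[of J] unfolding kA by (intro digA) linarith+

lemma dig_less: "J < k ^ q \<Longrightarrow> dig J a < k"
  using k_pos[of J] by simp

lemma ex_item:
  assumes "\<And>a. a < q \<Longrightarrow> i a < bet" "\<And>a. a < q \<Longrightarrow> t a < bet"
  obtains y where "y < bet ^ (2 * q)" "\<And>a. a < q \<Longrightarrow> I y a = i a" "\<And>a. a < q \<Longrightarrow> T y a = t a"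
proof -
  have "(if a < q then i a else t (a - q)) < bet" if "a < 2 * q" for a
    using assms(1)[of a] assms(2)[of "a - q"] that by simp
  then obtain y where y: "y < bet ^ (2 * q)"
    "\<forall>a<2 * q. y div bet ^ a mod bet = (if a < q then i a else t (a - q))"
    using digits_ex[of "2 * q" "\<lambda>a. if a < q then i a else t (a - q)" bet] by blast
  show thesis
  proof
    show "y < bet ^ (2 * q)" by (rule y(1))
    show "I y a = i a" if "a < q" for a
      using y(2)[rule_format, of a] that idig[OF y(1)] by simp
    show "T y a = t a" if "a < q" for a
      using y(2)[rule_format, of "q + a"] that tdig[OF y(1)] by simp
  qed
qed

lemma phisA: "phisA A N d S y = Phi (T y ` S)"
proof -
  have "memA A N d S y = (\<lambda>g. g \<in> T y ` S)"
    by (auto simp: memA_def fun_eq_iff)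
  then show ?thesis
    by (simp only: phisA_def Phi_def outA_def num_gatesA)
qed

lemma Phi_less_q: "Phi U < bet ^ q"
  using Phi_less[of U] by (simp only: qq_def)

lemma Phi_degree_q: "degree_le q (\<lambda>U. int (Phi U))"
  using Phi_degree by (simp only: qq_def)

section \<open>Moebius weights of tuples\<close>

lemma canonA: "canonA A N d j y \<longleftrightarrow> canon q j (T y)"
  by (auto simp: canonA_def canon_def)

text \<open>The Moebius coefficient of the set that the tuple represents canonically, and
  \<open>0\<close> if there is none; at most one \<open>j\<close> contributes.\<close>

definition mus :: "(nat \<Rightarrow> nat) \<Rightarrow> int" where
  "mus t = (\<Sum>j\<in>{1..q}. if canon q j t then mob (\<lambda>U. int (Phi U)) (t ` {..<j}) else 0)"

lemma mus_cong:
  assumes "\<And>a. a < q \<Longrightarrow> t a = u a"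
  shows "mus t = mus u"
  unfolding mus_def
proof (rule sum.cong)
  fix j
  assume "j \<in> {1..q}"
  then have "t ` {..<j} = u ` {..<j}"
    using assms by (intro image_cong) auto
  then show "(if canon q j t then mob (\<lambda>U. int (Phi U)) (t ` {..<j}) else 0) =
      (if canon q j u then mob (\<lambda>U. int (Phi U)) (u ` {..<j}) else 0)"
    using canon_cong[of q t u j] assms by simp
qed simp

text \<open>The computation runs over sets of positions, Moebius inversion over sets of gates. A
  canonical tuple is injective on its first \<open>j\<close> positions, so both range over the same
  sets with the same cardinalities.\<close>

lemma signedA: "int (signedA A N d True y) - int (signedA A N d False y) = mus (T y)"
proof -
  have *: "int (\<Sum>S\<in>{S \<in> Pow {..<j}. even (j - card S) = True}. phisA A N d S y) -
      int (\<Sum>S\<in>{S \<in> Pow {..<j}. even (j - card S) = False}. phisA A N d S y) =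
      mob (\<lambda>U. int (Phi U)) (T y ` {..<j})" if "j \<le> q" "canon q j (T y)" for j
  proof -
    have inj: "inj_on (T y) {..<j}" by (rule canon_inj[OF that(2,1)])
    have "mob (\<lambda>U. int (Phi U)) (T y ` {..<j}) =
        (\<Sum>U\<in>(`) (T y) ` Pow {..<j}. (-1) ^ (card (T y ` {..<j}) - card U) * int (Phi U))"
      unfolding mob_def by (simp add: image_Pow_surj)
    also have "\<dots> = (\<Sum>S\<in>Pow {..<j}. (-1) ^ (card (T y ` {..<j}) - card (T y ` S)) * int (Phi (T y ` S)))"
      using inj_on_image_Pow[OF inj] by (simp add: sum.reindex)
    also have "\<dots> = (\<Sum>S\<in>Pow {..<j}. (-1) ^ (j - card S) * int (phisA A N d S y))"
    proof (rule sum.cong)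
      fix S assume "S \<in> Pow {..<j}"
      then have "card (T y ` S) = card S"
        using inj by (intro card_image) (auto intro: inj_on_subset)
      then show "(-1) ^ (card (T y ` {..<j}) - card (T y ` S)) * int (Phi (T y ` S)) =
          (-1) ^ (j - card S) * int (phisA A N d S y)"
        using card_image[OF inj] by (simp add: phisA)
    qed simp
    finally show ?thesis
      by (simp only: sum_sign[OF finite_Pow_iff[THEN iffD2, OF finite_lessThan]])
  qed
  have "int (signedA A N d True y) - int (signedA A N d False y) =
     (\<Sum>j\<in>{1..q}. if canon q j (T y) then
        int (\<Sum>S\<in>{S \<in> Pow {..<j}. even (j - card S) = True}. phisA A N d S y) -
        int (\<Sum>S\<in>{S \<in> Pow {..<j}. even (j - card S) = False}. phisA A N d S y) else 0)"
    unfolding signedA_def canonA of_nat_sum[of _ "{1..q}"] sum_subtractf[symmetric]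
    by (rule sum.cong) simp_all
  also have "\<dots> = mus (T y)"
    unfolding mus_def by (rule sum.cong) (use * in auto)
  finally show ?thesis .
qed

lemma offA: "offA A N d = q * 2 ^ q * bet ^ q"
  by (simp add: offA_def betA)

lemma signedA_less: "signedA A N d r y < offA A N d"
proof -
  let ?M = "bet ^ q - 1"
  have "(if canonA A N d j y then \<Sum>S\<in>{S \<in> Pow {..<j}. even (j - card S) = r}. phisA A N d S y else 0)
      \<le> 2 ^ q * ?M" if "j \<in> {1..q}" for j
  proof -
    have "phisA A N d S y \<le> ?M" for S
      using Phi_less_q[of "T y ` S"] unfolding phisA by linarith
    then have "(\<Sum>S\<in>{S \<in> Pow {..<j}. even (j - card S) = r}. phisA A N d S y) \<le>
        of_nat (card {S \<in> Pow {..<j}. even (j - card S) = r}) * ?M"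
      by (rule sum_bounded_above)
    moreover have "card {S \<in> Pow {..<j}. even (j - card S) = r} \<le> card (Pow {..<j})"
      by (intro card_mono) auto
    moreover have "card (Pow {..<j}) \<le> 2 ^ q"
      using that by (simp add: card_Pow power_increasing)
    ultimately show ?thesis
      by (simp add: mult_le_mono1 order_trans[OF _ mult_le_mono1])
  qed
  then have "signedA A N d r y \<le> of_nat (card {1..q}) * (2 ^ q * ?M)"
    unfolding signedA_def by (rule sum_bounded_above)
  also have "\<dots> = (q * 2 ^ q) * ?M" by simp
  also have "\<dots> < (q * 2 ^ q) * bet ^ q"
    using q_ge bet_q_pos[of q] by (intro mult_strict_left_mono) auto
  finally show ?thesis by (simp add: offA)
qed

lemma weightA: "int (weightA A N d y) = int (offA A N d) + mus (T y)"
  using signedA[of y] signedA_less[of False y] by (simp add: weightA_def of_nat_diff)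

text \<open>As \<open>v\<close> is increasing, a tuple of gates is canonical exactly if its index
  tuple is. The sum over tuples therefore becomes a sum over nonempty sets of at most
  \<open>q\<close> indices; larger sets contribute nothing by the degree bound, and Moebius
  inversion evaluates the rest.\<close>

lemma sum_mus:
  assumes v: "\<And>i i'. i < i' \<Longrightarrow> i' < k \<Longrightarrow> v i < v i'"
  shows "(\<Sum>J<k ^ q. mus (\<lambda>a. v (dig J a))) = int (Phi (v ` {..<k})) - int (Phi {})"
proof -
  let ?F = "mob (\<lambda>U. int (Phi U))"
  have vless: "v i < v i' \<longleftrightarrow> i < i'" if "i < k" "i' < k" for i i'
    using v[of i i'] v[of i' i] that by (cases i i' rule: linorder_cases) auto
  have inj: "inj_on v {..<k}"
  proof (rule inj_onI)
    fix i i' assume "i \<in> {..<k}" "i' \<in> {..<k}" "v i = v i'"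
    then show "i = i'"
      using vless[of i i'] vless[of i' i] by (cases i i' rule: linorder_cases) simp_all
  qed
  have canon: "canon q j (\<lambda>a. v (dig J a)) \<longleftrightarrow> canon q j (dig J)" if "J < k ^ q" for J j
    using vless[OF dig_less[OF that] dig_less[OF that]] inj_on_eq_iff[OF inj] dig_less[OF that]
    unfolding canon_def by (simp del: power_Suc)
  have "(\<Sum>J<k ^ q. mus (\<lambda>a. v (dig J a))) =
      (\<Sum>j\<in>{1..q}. \<Sum>J<k ^ q. if canon q j (\<lambda>a. v (dig J a)) then ?F ((\<lambda>a. v (dig J a)) ` {..<j}) else 0)"
    unfolding mus_def by (rule sum.swap)
  also have "\<dots> = (\<Sum>j\<in>{1..q}. \<Sum>J<k ^ q. if canon q j (dig J) then ?F (v ` dig J ` {..<j}) else 0)"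
    by (intro sum.cong refl) (simp add: canon image_image)
  also have "\<dots> = (\<Sum>j\<in>{1..q}. \<Sum>K\<in>{K. K \<subseteq> {..<k} \<and> card K = j}. ?F (v ` K))"
    by (intro sum.cong refl sum_canon[where F = "\<lambda>K. ?F (v ` K)"]) auto
  also have "\<dots> = (\<Sum>j\<in>{1..q}. \<Sum>K\<in>{K \<in> {K \<in> Pow {..<k}. card K \<in> {1..q}}. card K = j}. ?F (v ` K))"
    by (intro sum.cong refl) auto
  also have "\<dots> = (\<Sum>K\<in>{K \<in> Pow {..<k}. card K \<in> {1..q}}. ?F (v ` K))"
    by (rule sum.group) auto
  also have "\<dots> = (\<Sum>K\<in>Pow {..<k} - {{}}. ?F (v ` K))"
  proof (rule sum.mono_neutral_left)
    show "{K \<in> Pow {..<k}. card K \<in> {1..q}} \<subseteq> Pow {..<k} - {{}}" by auto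
    show "\<forall>K\<in>Pow {..<k} - {{}} - {K \<in> Pow {..<k}. card K \<in> {1..q}}. ?F (v ` K) = 0"
    proof
      fix K assume K: "K \<in> Pow {..<k} - {{}} - {K \<in> Pow {..<k}. card K \<in> {1..q}}"
      then have "finite K" by (auto intro: finite_subset)
      with K have "q < card K" by (auto simp: Suc_le_eq card_gt_0_iff not_le)
      moreover have "card (v ` K) = card K"
        using K inj by (intro card_image) (auto intro: inj_on_subset)
      ultimately show "?F (v ` K) = 0"
        using Phi_degree_q \<open>finite K\<close> by (simp add: degree_le_def)
    qed
  qed simp
  also have "\<dots> = (\<Sum>K\<in>Pow {..<k}. ?F (v ` K)) - ?F {}"
    by (simp add: sum_diff1)
  also have "(\<Sum>K\<in>Pow {..<k}. ?F (v ` K)) = (\<Sum>U\<in>(`) v ` Pow {..<k}. ?F U)"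
    using inj_on_image_Pow[OF inj] by (simp add: sum.reindex)
  also have "\<dots> = int (Phi (v ` {..<k}))"
    using mob_inversion[of "v ` {..<k}" "\<lambda>U. int (Phi U)"] by (simp add: image_Pow_surj)
  also have "?F {} = int (Phi {})"
    by (simp add: mob_def)
  finally show ?thesis .
qed

lemma targetA_0: "targetA A N d 0 = k ^ q * offA A N d + bet ^ q - Phi {}"
proof -
  have "k ^ q \<le> N" using kq_le N_big by linarith
  then show ?thesis by (simp add: targetA_def kA betA phisA)
qed

section \<open>One item for every index tuple\<close>

definition family :: "(nat \<Rightarrow> nat) \<Rightarrow> bool" where
  "family y \<longleftrightarrow> (\<forall>J<k ^ q. y J < bet ^ (2 * q) \<and> (\<forall>a<q. I (y J) a = dig J a))"

lemma match_family:
  assumes "family y" "J < k ^ q" "J' < k ^ q"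
  shows "matchA A N d (y J') J \<longleftrightarrow> J' = J"
proof
  assume "matchA A N d (y J') J"
  then show "J' = J"
    using assms by (intro digits_eqI[of J' k q J]) (auto simp: matchA_def family_def digK)
qed (use assms in \<open>auto simp: matchA_def family_def digK\<close>)

lemma inj_family: "family y \<Longrightarrow> inj_on y {..<k ^ q}"
  using match_family[of y] by (intro inj_onI) (metis lessThan_iff)

lemma cons_family_q:
  assumes y: "family y" and J: "J < k ^ q"
  shows "(\<Sum>J'<k ^ q. consA A N d q (y J') J) = 1"
proof -
  have "(\<Sum>J'<k ^ q. consA A N d q (y J') J) = (\<Sum>J'<k ^ q. if J' = J then 1 else 0)"
    using match_family[OF y J] by (intro sum.cong) (simp_all add: consA_def)
  then show ?thesis using J by simp
qed

text \<open>\<open>D\<close> is the constant index tuple with entry \<open>dig J a\<close>. Only the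
  items of \<open>J\<close> and \<open>D\<close> contribute to this coordinate, and the formula
  remains correct when they coincide.\<close>

lemma cons_family:
  assumes y: "family y" and J: "J < k ^ q" and a: "a < q"
    and D: "D < k ^ q" "\<And>a'. a' < q \<Longrightarrow> dig D a' = dig J a"
  shows "(\<Sum>J'<k ^ q. consA A N d a (y J') J) = (bet - T (y J) a) + T (y D) 0"
proof -
  have "diagA A N d a (y J') J \<longleftrightarrow> J' = D" if "J' < k ^ q" for J'
  proof -
    have "diagA A N d a (y J') J \<longleftrightarrow> matchA A N d (y J') D"
      using J D by (simp add: diagA_def matchA_def digK)
    then show ?thesis using match_family[OF y D(1) that] by simp
  qed
  then have "(\<Sum>J'<k ^ q. consA A N d a (y J') J) =
      (\<Sum>J'<k ^ q. (if J' = J then bet - T (y J) a else 0) + (if J' = D then T (y D) 0 else 0))"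
    using match_family[OF y J] a by (intro sum.cong) (auto simp: consA_def betA)
  then show ?thesis using J D(1) by (simp add: sum.distrib)
qed

lemma weight_family:
  assumes y: "family y" "\<And>J a. J < k ^ q \<Longrightarrow> a < q \<Longrightarrow> T (y J) a = v (dig J a)"
    and v: "\<And>i i'. i < i' \<Longrightarrow> i' < k \<Longrightarrow> v i < v i'"
  shows "int (\<Sum>J<k ^ q. weightA A N d (y J)) =
    int (k ^ q * offA A N d) + int (Phi (v ` {..<k})) - int (Phi {})"
proof -
  have "mus (T (y J)) = mus (\<lambda>a. v (dig J a))" if "J < k ^ q" for J
    by (rule mus_cong) (use y(2) that in simp)
  then have "int (\<Sum>J<k ^ q. weightA A N d (y J)) = (\<Sum>J<k ^ q. int (offA A N d) + mus (\<lambda>a. v (dig J a)))"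
    by (simp add: weightA)
  also have "\<dots> = int (k ^ q * offA A N d) + int (Phi (v ` {..<k})) - int (Phi {})"
    using sum_mus[OF v] by (simp add: sum.distrib)
  finally show ?thesis .
qed

lemma ex_diag:
  obtains D where "\<And>i. i < k \<Longrightarrow> D i < k ^ q" "\<And>i a. i < k \<Longrightarrow> a < q \<Longrightarrow> dig (D i) a = i"
proof -
  have "\<forall>i. \<exists>D. i < k \<longrightarrow> D < k ^ q \<and> (\<forall>a<q. dig D a = i)"
    using digits_ex[of q "\<lambda>_. i" k for i] by blast
  then show thesis using that by metis
qed

lemma gate_input: "g < length C \<Longrightarrow> gtypA A N g = 0 \<longleftrightarrow> g \<in> input_gates C"
  by (cases "C ! g") (simp_all add: gtypA input_gates_def)

lemma validA:
  "validA A N d y \<longleftrightarrow> (\<forall>a<q. I y a < k \<and> T y a \<in> input_gates C \<and> (\<forall>a'<q. I y a < I y a' \<longrightarrow> T y a < T y a'))"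
  unfolding validA_def kA num_gatesA using gate_input by (auto simp: input_gates_def)

definition solution :: "nat set \<Rightarrow> nat set \<Rightarrow> bool" where
  "solution Y Z \<longleftrightarrow> Y \<subseteq> {y. y < bet ^ (2 * q) \<and> validA A N d y} \<and>
     Z \<subseteq> {b. b < bet ^ q \<and> hhA A N (Suc d) out b} \<and>
     (\<Sum>y\<in>Y. weightA A N d y) + (\<Sum>b\<in>Z. bet ^ q - b) = targetA A N d 0 \<and> card Z = 1 \<and>
     (\<forall>a\<le>q. \<forall>J<k ^ q. (\<Sum>y\<in>Y. consA A N d a y J) = (if a < q then bet else 1))"

lemma input_less: "g \<in> input_gates C \<Longrightarrow> g < bet"
  using length_C by (auto simp: input_gates_def bet_def)

lemma solution_if_satisfiable:
  assumes S: "S \<subseteq> input_gates C" "card S = k" "hhA A N (Suc d) out (Phi S)"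
  shows "\<exists>Y Z. solution Y Z"
proof -
  have finS: "finite S"
    using S(1) by (rule finite_subset) (simp add: input_gates_def)
  define v where "v i = sorted_list_of_set S ! i" for i
  have v: "v i < v i'" if "i < i'" "i' < k" for i i'
    unfolding v_def using strict_sorted_list_of_set[of S] that S(2) by (simp add: sorted_wrt_nth_less)
  have vS: "v ` {..<k} = S"
  proof -
    have "v ` {..<k} = set (sorted_list_of_set S)"
      unfolding v_def[abs_def] set_conv_nth using S(2) by auto
    then show ?thesis using finS by simp
  qed
  then have v_in: "v i \<in> input_gates C" if "i < k" for i
    using that S(1) by auto
  have "\<exists>y. J < k ^ q \<longrightarrow> y < bet ^ (2 * q) \<and> (\<forall>a<q. I y a = dig J a) \<and> (\<forall>a<q. T y a = v (dig J a))" for J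
  proof (cases "J < k ^ q")
    case True
    have 1: "dig J a < bet" for a
      using dig_less[OF True, of a] k_less by linarith
    have 2: "v (dig J a) < bet" for a
      by (intro input_less v_in dig_less True)
    obtain y where "y < bet ^ (2 * q)" "\<And>a. a < q \<Longrightarrow> I y a = dig J a" "\<And>a. a < q \<Longrightarrow> T y a = v (dig J a)"
      by (rule ex_item[of "dig J" "\<lambda>a. v (dig J a)", OF 1 2]) blast
    then show ?thesis by blast
  qed blast
  then obtain y where y: "\<And>J. J < k ^ q \<Longrightarrow>
      y J < bet ^ (2 * q) \<and> (\<forall>a<q. I (y J) a = dig J a) \<and> (\<forall>a<q. T (y J) a = v (dig J a))"
    by metis
  then have fam: "family y" "\<And>J a. J < k ^ q \<Longrightarrow> a < q \<Longrightarrow> T (y J) a = v (dig J a)"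
    by (simp_all add: family_def)
  obtain D where D: "\<And>i. i < k \<Longrightarrow> D i < k ^ q" "\<And>i a. i < k \<Longrightarrow> a < q \<Longrightarrow> dig (D i) a = i"
    by (rule ex_diag) blast
  have reidx: "(\<Sum>y\<in>y ` {..<k ^ q}. f y) = (\<Sum>J<k ^ q. f (y J))" for f :: "nat \<Rightarrow> nat"
    using inj_family[OF fam(1)] by (simp add: sum.reindex)
  have "solution (y ` {..<k ^ q}) {Phi S}"
    unfolding solution_def
  proof (intro conjI)
    have "validA A N d (y J)" if "J < k ^ q" for J
      unfolding validA using y[OF that] dig_less[OF that] v v_in by auto
    then show "y ` {..<k ^ q} \<subseteq> {y. y < bet ^ (2 * q) \<and> validA A N d y}"
      using y by auto
    show "{Phi S} \<subseteq> {b. b < bet ^ q \<and> hhA A N (Suc d) out b}"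
      using Phi_less_q S(3) by simp
    show "(\<Sum>y\<in>y ` {..<k ^ q}. weightA A N d y) + (\<Sum>b\<in>{Phi S}. bet ^ q - b) = targetA A N d 0"
    proof -
      have "int (\<Sum>J<k ^ q. weightA A N d (y J)) =
          int (k ^ q * offA A N d) + int (Phi S) - int (Phi {})"
        using weight_family[OF fam v] unfolding vS .
      then have "(\<Sum>J<k ^ q. weightA A N d (y J)) + (bet ^ q - Phi S) = k ^ q * offA A N d + bet ^ q - Phi {}"
        using Phi_less_q[of S] Phi_less_q[of "{}"] by linarith
      then show ?thesis unfolding reidx targetA_0 by simp
    qed
    show "\<forall>a\<le>q. \<forall>J<k ^ q. (\<Sum>y\<in>y ` {..<k ^ q}. consA A N d a y J) = (if a < q then bet else 1)"
    proof (intro allI impI)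
      fix a J assume a: "a \<le> q" and J: "J < k ^ q"
      show "(\<Sum>y\<in>y ` {..<k ^ q}. consA A N d a y J) = (if a < q then bet else 1)"
      proof (cases "a < q")
        case True
        let ?D = "D (dig J a)"
        have D': "?D < k ^ q" "\<And>a'. a' < q \<Longrightarrow> dig ?D a' = dig J a"
          using D dig_less[OF J] by simp_all
        have "T (y J) a = v (dig J a)" "T (y ?D) 0 = v (dig J a)"
          using fam(2)[OF J True] fam(2)[OF D'(1), of 0] D'(2)[of 0] q_ge by simp_all
        moreover have "v (dig J a) < bet"
          using input_less v_in dig_less[OF J] by simp
        ultimately show ?thesis
          unfolding reidx using cons_family[OF fam(1) J True D'] True by simp
      next
        case False
        then show ?thesis
          unfolding reidx using cons_family_q[OF fam(1) J] a by simp
      qed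
    qed
  qed simp
  then show ?thesis by blast
qed

text \<open>The coordinates with \<open>a = q\<close> give one item for every index tuple, and a
  valid item belongs to some index tuple, so there are no others. The coordinates with
  \<open>a < q\<close> make the gates depend on their index only, validity makes them increase, and
  coordinate \<open>0\<close> then identifies the guess with the value of
  \<open>Phi\<close>.\<close>

lemma satisfiable_if_solution:
  assumes sol: "solution Y Z"
  shows "\<exists>S\<subseteq>input_gates C. card S = k \<and> hhA A N (Suc d) out (Phi S)"
proof -
  have Y: "\<And>y. y \<in> Y \<Longrightarrow> y < bet ^ (2 * q)" "\<And>y. y \<in> Y \<Longrightarrow> validA A N d y"
    and cons: "\<And>a J. a \<le> q \<Longrightarrow> J < k ^ q \<Longrightarrow> (\<Sum>y\<in>Y. consA A N d a y J) = (if a < q then bet else 1)"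
    using sol by (auto simp: solution_def)
  have finY: "finite Y"
    using Y(1) by (intro finite_subset[of Y "{..<bet ^ (2 * q)}"]) auto
  have "\<exists>y. {y \<in> Y. matchA A N d y J} = {y}" if "J < k ^ q" for J
  proof -
    have "(\<Sum>y\<in>Y. of_bool (matchA A N d y J)) = (1 :: nat)"
      using cons[of q J] that by (simp add: consA_def)
    moreover have "card {y \<in> Y. matchA A N d y J} = (\<Sum>y\<in>Y. of_bool (matchA A N d y J))"
      using sum.inter_filter[OF finY, of "\<lambda>_. 1 :: nat" "\<lambda>y. matchA A N d y J"]
      unfolding of_bool_def by simp
    ultimately have "card {y \<in> Y. matchA A N d y J} = Suc 0" by simp
    then show ?thesis unfolding card_1_singleton_iff .
  qed
  then obtain y where y: "\<And>J. J < k ^ q \<Longrightarrow> {y \<in> Y. matchA A N d y J} = {y J}"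
    by metis
  then have yY: "y J \<in> Y" "matchA A N d (y J) J" if "J < k ^ q" for J
    using that by blast+
  have fam: "family y"
    unfolding family_def using yY Y(1) digK by (auto simp: matchA_def)
  have Y_eq: "Y = y ` {..<k ^ q}"
  proof (intro equalityI subsetI)
    fix z assume z: "z \<in> Y"
    have "\<And>a. a < q \<Longrightarrow> I z a < k"
      using Y(2)[OF z] by (simp add: validA)
    then obtain J where J: "J < k ^ q" "\<forall>a<q. dig J a = I z a"
      using digits_ex[of q "I z" k] by blast
    then have "matchA A N d z J"
      by (simp add: matchA_def digK)
    then have "z = y J"
      using z y[OF J(1)] by blast
    with J(1) show "z \<in> y ` {..<k ^ q}" by blast
  qed (use yY in blast)
  have reidx: "(\<Sum>y\<in>Y. f y) = (\<Sum>J<k ^ q. f (y J))" for f :: "nat \<Rightarrow> nat"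
    unfolding Y_eq using inj_family[OF fam] by (simp add: sum.reindex)
  obtain D where D: "\<And>i. i < k \<Longrightarrow> D i < k ^ q" "\<And>i a. i < k \<Longrightarrow> a < q \<Longrightarrow> dig (D i) a = i"
    by (rule ex_diag) blast
  define v where "v i = T (y (D i)) 0" for i
  have Tv: "T (y J) a = v (dig J a)" if J: "J < k ^ q" and a: "a < q" for J a
  proof -
    \<comment> \<open>Since gates are below \<open>bet\<close>, the subtraction is not truncated,
      and filling up to \<open>bet\<close> means equality.\<close>
    have "(bet - T (y J) a) + v (dig J a) = bet"
      using cons_family[OF fam J a, of "D (dig J a)"] cons[of a J] D dig_less[OF J] J a
      unfolding reidx v_def by simp
    moreover have "T (y J) a < bet"
      using tdig_less Y(1) yY(1)[OF J] by blast
    ultimately show ?thesis by linarith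
  qed
  have v: "v i < v i'" if i: "i < i'" "i' < k" for i i'
  proof -
    \<comment> \<open>The index tuple \<open>(i, i', i', ...)\<close> contains both indices, so the
      validity of its item compares their gates.\<close>
    have "(if a = (0 :: nat) then i else i') < k" for a
      using i by simp
    then obtain J where J: "J < k ^ q" "\<forall>a<q. dig J a = (if a = 0 then i else i')"
      using digits_ex[of q "\<lambda>a. if a = 0 then i else i'" k] by blast
    have d: "dig J 0 = i" "dig J 1 = i'"
      using J(2)[rule_format, of 0] J(2)[rule_format, of 1] q_ge by simp_all
    have "I (y J) 0 = i" "I (y J) 1 = i'"
      using fam J(1) d q_ge by (simp_all add: family_def)
    then have "T (y J) 0 < T (y J) 1"
      using Y(2)[OF yY(1)[OF J(1)]] i(1) q_ge unfolding validA by fastforce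
    then show ?thesis
      using Tv[OF J(1), of 0] Tv[OF J(1), of 1] d q_ge by simp
  qed
  have v_in: "v i \<in> input_gates C" if "i < k" for i
    using Y(2)[OF yY(1)[OF D(1)[OF that]]] q_ge unfolding validA v_def by fastforce
  have inj: "inj_on v {..<k}"
  proof (rule inj_onI)
    fix i i' assume "i \<in> {..<k}" "i' \<in> {..<k}" "v i = v i'"
    then show "i = i'"
      using v[of i i'] v[of i' i] by (cases i i' rule: linorder_cases) simp_all
  qed
  obtain b where b: "Z = {b}"
    using sol by (auto simp: solution_def card_1_singleton_iff)
  then have b': "b < bet ^ q" "hhA A N (Suc d) out b"
    "(\<Sum>J<k ^ q. weightA A N d (y J)) + (bet ^ q - b) = k ^ q * offA A N d + bet ^ q - Phi {}"
    using sol by (simp_all add: solution_def reidx targetA_0)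
  \<comment> \<open>The offsets and \<open>Phi {}\<close> cancel against the target of coordinate
    \<open>0\<close>.\<close>
  have "int b = int (Phi (v ` {..<k}))"
    using weight_family[OF fam Tv v] b'(1,3) Phi_less_q[of "{}"] by linarith
  then have "hhA A N (Suc d) out (Phi (v ` {..<k}))"
    using b'(2) by simp
  moreover have "card (v ` {..<k}) = k"
    using inj by (simp add: card_image)
  moreover have "v ` {..<k} \<subseteq> input_gates C"
    using v_in by auto
  ultimately show ?thesis by blast
qed

lemma solution_iff: "(\<exists>Y Z. solution Y Z) \<longleftrightarrow> weighted_satisfiable C k"
  unfolding weighted_satisfiable_iff using solution_if_satisfiable satisfiable_if_solution by blast

end

section \<open>The graph of an instance\<close>

lemma upt_mult:
  "concat (map F [0..<a * b]) = concat (map (\<lambda>i. concat (map (\<lambda>j. F (i * b + j)) [0..<b])) [0..<a])"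
proof (induction a)
  case (Suc a)
  have "[0..<Suc a * b] = [0..<a * b] @ map (\<lambda>j. a * b + j) [0..<b]"
    using upt_add_eq_append[of 0 "a * b" b] map_add_upt[of "a * b" b] by (simp add: add.commute)
  then show ?case
    using Suc.IH by (simp add: comp_def)
qed simp

text \<open>Item \<open>x\<close> consists of \<open>H\<close> vertices for each of the coordinates \<open>c < m\<close>, of which \<open>contrib x c\<close>
  have colour \<open>c + 1\<close> and form a star around the first vertex of the item. The remaining vertices
  have the junk colour \<open>m + 1\<close> and are adjacent to vertex \<open>0\<close>, except for the first vertices of
  items without contribution.\<close>

locale item_graph =
  fixes X m H :: nat and contrib :: "nat \<Rightarrow> nat \<Rightarrow> nat" and tgt :: "nat \<Rightarrow> nat"
  assumes X: "2 \<le> X" and m: "1 \<le> m" and H: "2 \<le> H"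
    and null: "\<And>c. contrib 0 c = 0" "\<And>c. contrib (Suc 0) c = 0"
    and root: "\<And>x c. x < X \<Longrightarrow> contrib x 0 = 0 \<Longrightarrow> contrib x c = 0"
    and bound: "\<And>x c. x < X \<Longrightarrow> c < m \<Longrightarrow> contrib x c \<le> H"
    and tgt: "\<And>c. c < m \<Longrightarrow> 1 \<le> tgt c"
begin

definition W :: nat where "W = m * H"

definition col :: "nat \<Rightarrow> nat" where
  "col v = (let c = v mod W div H in if v mod W mod H < contrib (v div W) c then Suc c else Suc m)"

definition par :: "nat \<Rightarrow> nat" where
  "par v = (if col v = Suc m then 0 else v div W * W)"

definition edge_list :: "(nat \<times> nat) list" where
  "edge_list = map (\<lambda>v. (par v, v)) (filter (\<lambda>v. v mod W \<noteq> 0) [0..<X * W])"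

text \<open>Targets have to be positive, so one vertex of the junk colour \<open>m + 1\<close> must
  be selected as well.\<close>

definition inst :: fb_instance where
  "inst = \<lparr>nverts = X * W, edges = edge_list, cut_size = 0, ncolors = Suc m, color = col,
     target = (\<lambda>i. if i \<le> m then tgt (i - 1) else 1)\<rparr>"

lemma W_pos: "0 < W"
  using m H by (simp add: W_def)

lemma offset_less: "c < m \<Longrightarrow> h < H \<Longrightarrow> c * H + h < W"
proof -
  assume *: "c < m" "h < H"
  then have "c * H + h < Suc c * H" by simp
  also have "\<dots> \<le> m * H" using * by (intro mult_le_mono1) simp
  finally show ?thesis by (simp add: W_def)
qed

lemma vert_div:
  assumes "c < m" "h < H"
  shows "(x * W + (c * H + h)) div W = x" "(x * W + (c * H + h)) mod W = c * H + h"
    "(c * H + h) div H = c" "(c * H + h) mod H = h"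
  using offset_less[OF assms] assms(2) by simp_all

lemma vert_ex:
  assumes "v < X * W"
  obtains x c h where "x < X" "c < m" "h < H" "v = x * W + (c * H + h)"
proof
  show "v div W < X" using assms by (simp add: less_mult_imp_div_less)
  have "v mod W < m * H" using W_pos by (simp add: W_def)
  then show "v mod W div H < m" by (simp add: less_mult_imp_div_less)
  show "v mod W mod H < H" using H by simp
  show "v = v div W * W + (v mod W div H * H + v mod W mod H)"
    by (simp only: div_mult_mod_eq)
qed

lemma vert_less: "x < X \<Longrightarrow> c < m \<Longrightarrow> h < H \<Longrightarrow> x * W + (c * H + h) < X * W"
proof -
  assume *: "x < X" "c < m" "h < H"
  then have "x * W + (c * H + h) < Suc x * W"
    using offset_less[of c h] by simp
  also have "\<dots> \<le> X * W" using * by (intro mult_le_mono1) simp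
  finally show ?thesis .
qed

lemma col_vert: "c < m \<Longrightarrow> h < H \<Longrightarrow>
    col (x * W + (c * H + h)) = (if h < contrib x c then Suc c else Suc m)"
  by (simp only: col_def Let_def vert_div)

lemma col_range: "v < X * W \<Longrightarrow> col v \<in> {1..Suc m}"
  by (erule vert_ex) (simp add: col_vert)

lemma col_root: "col (x * W) = (if contrib x 0 = 0 then Suc m else 1)"
  using col_vert[of 0 0 x] m H by simp

lemma edge_listD: "(u, v) \<in> set edge_list \<longleftrightarrow> v < X * W \<and> v mod W \<noteq> 0 \<and> u = par v"
  by (auto simp: edge_list_def)

lemma par_less: "v mod W \<noteq> 0 \<Longrightarrow> par v < v"
proof -
  assume v: "v mod W \<noteq> 0"
  then have "0 < v" by (cases v) auto
  moreover have "v div W * W < v"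
    using v div_mult_mod_eq[of v W] by linarith
  ultimately show ?thesis by (simp add: par_def)
qed

lemma fb_valid_inst: "fb_valid inst"
proof -
  have "distinct edge_list"
    by (auto simp: edge_list_def distinct_map intro: inj_onI)
  moreover have "u < v \<and> v < X * W" if "(u, v) \<in> set edge_list" for u v
    using that par_less by (auto simp: edge_listD)
  ultimately show ?thesis
    using col_range tgt by (auto simp: fb_valid_def inst_def)
qed

lemma card_color:
  assumes P: "P \<subseteq> {..<X}" and c: "c < m"
  shows "card {v. v < X * W \<and> col v = Suc c \<and> v div W \<in> P} = (\<Sum>x\<in>P. contrib x c)"
proof -
  let ?S = "Sigma P (\<lambda>x. {..<contrib x c})"
  let ?f = "\<lambda>(x, h). x * W + (c * H + h)"
  have fin: "finite P" using P by (rule finite_subset) simp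
  have h: "h < H" if "x \<in> P" "h < contrib x c" for x h
    using that P bound[of x c] c by auto
  have inj: "inj_on ?f ?S"
  proof (rule inj_onI, clarify)
    fix x h x' h'
    assume a: "x \<in> P" "h < contrib x c" "x' \<in> P" "h' < contrib x' c"
      and eq: "x * W + (c * H + h) = x' * W + (c * H + h')"
    have "x = x'"
      using vert_div(1)[OF c h[OF a(1,2)], of x] vert_div(1)[OF c h[OF a(3,4)], of x'] eq by simp
    with eq show "x = x' \<and> h = h'" by simp
  qed
  have "{v. v < X * W \<and> col v = Suc c \<and> v div W \<in> P} = ?f ` ?S"
  proof (intro equalityI subsetI)
    fix v assume "v \<in> {v. v < X * W \<and> col v = Suc c \<and> v div W \<in> P}"
    then have v: "v < X * W" "col v = Suc c" "v div W \<in> P" by auto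
    obtain x c' h' where *: "x < X" "c' < m" "h' < H" "v = x * W + (c' * H + h')"
      by (rule vert_ex[OF v(1)])
    then have "x \<in> P" "c' = c" "h' < contrib x c"
      using v(2,3) c col_vert[OF *(2,3), of x] vert_div(1)[OF *(2,3), of x] by (auto split: if_splits)
    then show "v \<in> ?f ` ?S" using *(4) by force
  next
    fix v assume "v \<in> ?f ` ?S"
    then obtain x h' where *: "x \<in> P" "h' < contrib x c" "v = x * W + (c * H + h')" by auto
    then show "v \<in> {v. v < X * W \<and> col v = Suc c \<and> v div W \<in> P}"
      using h[OF *(1,2)] P c vert_less[of x c h'] col_vert[of c h' x] vert_div(1)[of c h' x] by auto
  qed
  then have "card {v. v < X * W \<and> col v = Suc c \<and> v div W \<in> P} = card ?S"
    by (simp add: card_image[OF inj])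
  also have "\<dots> = (\<Sum>x\<in>P. contrib x c)"
    using fin by (simp add: card_SigmaI)
  finally show ?thesis .
qed

abbreviation edge_set :: "nat set set" where
  "edge_set \<equiv> {{u, v} | u v. (u, v) \<in> set edge_list}"

lemma cut_order_0:
  "cut_order edge_set A B \<le> 0 \<longleftrightarrow>
     (\<forall>v<X * W. v mod W \<noteq> 0 \<longrightarrow> \<not> (v \<in> A \<and> par v \<in> B) \<and> \<not> (v \<in> B \<and> par v \<in> A))"
proof -
  have "edge_set = (\<lambda>(u, v). {u, v}) ` set edge_list"
    by auto
  then have "finite edge_set"
    by simp
  then have "cut_order edge_set A B \<le> 0 \<longleftrightarrow> {e \<in> edge_set. \<exists>a\<in>A. \<exists>b\<in>B. e = {a, b}} = {}"
    by (simp add: cut_order_def)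
  also have "\<dots> \<longleftrightarrow> (\<forall>u v. (u, v) \<in> set edge_list \<longrightarrow> \<not> (\<exists>a\<in>A. \<exists>b\<in>B. {u, v} = {a, b}))"
    by blast
  also have "\<dots> \<longleftrightarrow> (\<forall>v<X * W. v mod W \<noteq> 0 \<longrightarrow> \<not> (v \<in> A \<and> par v \<in> B) \<and> \<not> (v \<in> B \<and> par v \<in> A))"
    unfolding edge_listD by (auto simp: doubleton_eq_iff)
  finally show ?thesis .
qed

lemma fb_yes_iff: "fb_yes inst \<longleftrightarrow> (\<exists>A B. A \<union> B = {..<X * W} \<and> A \<inter> B = {} \<and>
    cut_order edge_set A B \<le> 0 \<and>
    (\<forall>i\<in>{1..Suc m}. card {v \<in> A. col v = i} = (if i \<le> m then tgt (i - 1) else 1)))"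
  by (simp only: fb_yes_def has_fair_bisection_def edge_cut_def inst_def fb_instance.select_convs conj_assoc)

text \<open>Without cut edges, all coloured vertices of an item lie on the side of its first vertex;
  \<open>root\<close> ensures that this vertex is coloured when any other is. So the coloured part
  of a bisection is a selection of items, and every selection extends to a bisection.\<close>

lemma fb_yes_inst:
  "fb_yes inst \<longleftrightarrow> (\<exists>P \<subseteq> {x. x < X \<and> contrib x 0 \<noteq> 0}. \<forall>c<m. (\<Sum>x\<in>P. contrib x c) = tgt c)"
  (is "_ \<longleftrightarrow> ?R")
proof
  assume "fb_yes inst"
  then obtain A B where AB: "A \<union> B = {..<X * W}" "A \<inter> B = {}" "cut_order edge_set A B \<le> 0"
    "\<forall>i\<in>{1..Suc m}. card {v \<in> A. col v = i} = (if i \<le> m then tgt (i - 1) else 1)"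
    unfolding fb_yes_iff by (elim exE conjE)
  have par_A: "v \<in> A \<longleftrightarrow> par v \<in> A" if "v < X * W" "v mod W \<noteq> 0" for v
  proof -
    have "par v < X * W" using par_less[OF that(2)] that(1) by simp
    then show ?thesis using AB(1,2,3) that unfolding cut_order_0 by blast
  qed
  define P where "P = {x. x < X \<and> contrib x 0 \<noteq> 0 \<and> x * W \<in> A}"
  have "(\<Sum>x\<in>P. contrib x c) = tgt c" if c: "c < m" for c
  proof -
    have mem: "v \<in> A \<longleftrightarrow> v div W \<in> P" if v: "v < X * W" "col v = Suc c" for v
    proof -
      obtain x c' h where *: "x < X" "c' < m" "h < H" "v = x * W + (c' * H + h)"
        by (rule vert_ex[OF v(1)])
      have "h < contrib x c'"
      proof (rule ccontr)
        assume "\<not> h < contrib x c'"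
        then have "col v = Suc m"
          using col_vert[OF *(2,3), of x] unfolding *(4)[symmetric] by simp
        then show False using v(2) c by simp
      qed
      then have "contrib x c' \<noteq> 0" by simp
      then have "contrib x 0 \<noteq> 0" using root[OF *(1), of c'] by (rule contrapos_nn)
      moreover have x: "v div W = x" unfolding *(4) by (rule vert_div(1)[OF *(2,3)])
      moreover have "v \<in> A \<longleftrightarrow> x * W \<in> A"
      proof (cases "v mod W = 0")
        case True
        have "v = x * W" using div_mult_mod_eq[of v W] unfolding x True by simp
        then show ?thesis by simp
      next
        case False
        then show ?thesis using par_A[OF v(1) False] v(2) c x by (simp add: par_def)
      qed
      ultimately show ?thesis using *(1) by (simp add: P_def)
    qed
    have "{v \<in> A. col v = Suc c} = {v. v < X * W \<and> col v = Suc c \<and> v div W \<in> P}"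
      using mem AB(1) by auto
    moreover have "card {v \<in> A. col v = Suc c} = tgt c"
      using AB(4)[rule_format, of "Suc c"] c by simp
    ultimately show ?thesis
      using card_color[of P c] c by (simp add: P_def subset_iff)
  qed
  then show ?R
    by (intro exI[of _ P]) (auto simp: P_def)
next
  assume ?R
  then obtain P where P: "P \<subseteq> {x. x < X \<and> contrib x 0 \<noteq> 0}" "\<And>c. c < m \<Longrightarrow> (\<Sum>x\<in>P. contrib x c) = tgt c"
    by blast
  \<comment> \<open>Vertex \<open>W\<close> is the first one of the empty item \<open>1\<close>. It
    has the junk colour and no neighbours, so adding it meets the target of that colour without
    cutting an edge.\<close>
  define A where "A = insert W {v. v < X * W \<and> col v \<noteq> Suc m \<and> v div W \<in> P}"
  have W_less: "W < X * W"
    using X W_pos by simp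
  have W_div: "W div W = 1" "W mod W = 0" using W_pos by simp_all
  have colW: "col W = Suc m" using col_root[of 1] null(2)[of 0] by simp
  have col0: "col 0 = Suc m" using col_root[of 0] null(1)[of 0] by simp
  have "A \<union> ({..<X * W} - A) = {..<X * W}" "A \<inter> ({..<X * W} - A) = {}"
    using W_less by (auto simp: A_def)
  moreover have "cut_order edge_set A ({..<X * W} - A) \<le> 0"
  proof -
    have "v \<in> A \<longleftrightarrow> par v \<in> A" if v: "v < X * W" "v mod W \<noteq> 0" for v
    proof (cases "col v = Suc m")
      case True
      then have "v \<notin> A" using v W_div by (auto simp: A_def)
      moreover have "par v \<notin> A"
        using True W_pos col0 by (simp add: A_def par_def)
      ultimately show ?thesis by simp
    next
      case False
      let ?r = "v div W * W"
      obtain x c h where *: "x < X" "c < m" "h < H" "v = x * W + (c * H + h)"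
        by (rule vert_ex[OF v(1)])
      have x: "v div W = x" using vert_div(1)[OF *(2,3)] *(4) by simp
      have "contrib x c \<noteq> 0"
        using False *(4) col_vert[OF *(2,3), of x] by (auto split: if_splits)
      then have nz: "contrib x 0 \<noteq> 0" using root[OF *(1), of c] by (rule contrapos_nn)
      then have "x \<noteq> 1" using null(2) by auto
      then have "x * W \<noteq> W" using W_pos by simp
      moreover have "x * W < X * W" using *(1) W_pos by simp
      moreover have "x * W div W = x" using W_pos by simp
      moreover have "col (x * W) \<noteq> Suc m" using nz m by (simp add: col_root)
      moreover have "v \<noteq> W" using v(2) W_div by auto
      ultimately show ?thesis
        using False v(1) x by (simp add: A_def par_def)
    qed
    then show ?thesis unfolding cut_order_0 by auto
  qed
  moreover have "card {v \<in> A. col v = i} = (if i \<le> m then tgt (i - 1) else 1)" if i: "i \<in> {1..Suc m}" for i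
  proof (cases "i \<le> m")
    case True
    then obtain c where c: "i = Suc c" "c < m" using i by (cases i) auto
    then have "{v \<in> A. col v = i} = {v. v < X * W \<and> col v = Suc c \<and> v div W \<in> P}"
      using colW by (auto simp: A_def)
    then show ?thesis
      using card_color[of P c] P c True by (simp add: subset_iff)
  next
    case False
    then have "{v \<in> A. col v = i} = {W}"
      using i colW by (auto simp: A_def)
    then show ?thesis using False by simp
  qed
  ultimately show "fb_yes inst"
    unfolding fb_yes_iff by (intro exI[of _ A] exI[of _ "{..<X * W} - A"] conjI ballI)
qed

end

section \<open>The graph of the circuit\<close>

context reduction
begin

abbreviation X :: nat where "X \<equiv> itemsA A N d"

abbreviation m :: nat where "m \<equiv> coordsA A N d"

text \<open>Weights are below \<open>2 * offA A N d\<close>, and all other contributions are at most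
  \<open>2 * bet\<close> or \<open>bet ^ q\<close>, so every contribution fits into this
  height.\<close>

abbreviation H :: nat where "H \<equiv> 8 * offA A N d"

lemma items_eq: "X = 2 + bet ^ (2 * q) + bet ^ q"
  by (simp add: itemsA_def betA)

lemma coords_eq: "m = 2 + Suc q * k ^ q"
  by (simp add: coordsA_def kA)

lemma contrib_tuple: "y < bet ^ (2 * q) \<Longrightarrow> contribA A N d (2 + y) c = tupleA A N d y c"
  by (simp add: contribA_def betA)

lemma contrib_guess: "contribA A N d (2 + bet ^ (2 * q) + b) c = guessA A N d b c"
  by (simp add: contribA_def betA)

lemma guessA: "guessA A N d b c = (if hhA A N (Suc d) out b then (if c = 0 then bet ^ q - b else of_bool (c = 1)) else 0)"
  by (simp only: guessA_def outA_def num_gatesA betA)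

lemma tupleA_coord:
  assumes "validA A N d y" "a \<le> q" "J < k ^ q"
  shows "tupleA A N d y (2 + (a * k ^ q + J)) = consA A N d a y J"
proof -
  have "(2 + a' * k ^ q \<le> 2 + (a * k ^ q + J) \<and> 2 + (a * k ^ q + J) < 2 + Suc a' * k ^ q) \<longleftrightarrow> a' = a" for a'
  proof
    assume *: "2 + a' * k ^ q \<le> 2 + (a * k ^ q + J) \<and> 2 + (a * k ^ q + J) < 2 + Suc a' * k ^ q"
    have "a' * k ^ q < Suc a * k ^ q" using * assms(3) by simp
    then have "a' < Suc a" using mult_less_cancel2 by blast
    moreover have "a * k ^ q < Suc a' * k ^ q" using * by simp
    then have "a < Suc a'" using mult_less_cancel2 by blast
    ultimately show "a' = a" by simp
  qed (use assms(3) in simp)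
  then have "tupleA A N d y (2 + (a * k ^ q + J)) =
      (\<Sum>a'<Suc q. if a' = a then consA A N d a' y (2 + (a * k ^ q + J) - (2 + a' * k ^ q)) else 0)"
    using assms(1) by (simp only: tupleA_def kA) simp
  then show ?thesis
    using assms(2) by simp
qed

lemma tupleA_1: "tupleA A N d y 1 = 0"
  by (simp add: tupleA_def)

lemma weightA_pos: "0 < weightA A N d y"
  using signedA_less[of False y] by (simp add: weightA_def)

lemma bet_le_off: "bet ^ q \<le> offA A N d" "bet \<le> offA A N d"
proof -
  show "bet ^ q \<le> offA A N d" using q_ge by (simp add: offA)
  moreover have "bet \<le> bet ^ q" using bet_pos q_ge by (intro self_le_power) auto
  ultimately show "bet \<le> offA A N d" by simp
qed

lemma coord_cases:
  assumes "c < m"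
  obtains "c = 0" | "c = 1" | a J where "a \<le> q" "J < k ^ q" "c = 2 + (a * k ^ q + J)"
proof -
  consider "c = 0" | "c = 1" | "2 \<le> c" by linarith
  then show thesis
  proof cases
    case 3
    with assms have c: "c - 2 < Suc q * k ^ q" unfolding coords_eq by linarith
    then have "0 < k ^ q" by (cases "k ^ q") simp_all
    with c have "(c - 2) div k ^ q \<le> q" "(c - 2) mod k ^ q < k ^ q"
      using less_mult_imp_div_less[OF c] by simp_all
    moreover have "c = 2 + ((c - 2) div k ^ q * k ^ q + (c - 2) mod k ^ q)"
      using 3 div_mult_mod_eq[of "c - 2" "k ^ q"] by linarith
    ultimately show thesis using that(3) by blast
  qed (use that in blast)+
qed

lemma targetA_coord:
  assumes "a \<le> q" "J < k ^ q"
  shows "targetA A N d (2 + (a * k ^ q + J)) = (if a < q then bet else 1)"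
proof -
  have "a * k ^ q + J < q * k ^ q \<longleftrightarrow> a < q"
  proof
    assume "a * k ^ q + J < q * k ^ q"
    then have "a * k ^ q < q * k ^ q" by linarith
    then show "a < q" by simp
  next
    assume "a < q"
    have "a * k ^ q + J < Suc a * k ^ q" using assms(2) by simp
    also have "\<dots> \<le> q * k ^ q" using \<open>a < q\<close> by (intro mult_le_mono1) simp
    finally show "a * k ^ q + J < q * k ^ q" .
  qed
  then show ?thesis by (simp add: targetA_def kA betA)
qed

lemma tupleA_le:
  assumes "c < m" "y < bet ^ (2 * q)"
  shows "tupleA A N d y c \<le> H"
proof (cases "validA A N d y")
  case valid: True
  from assms(1) show ?thesis
  proof (cases c rule: coord_cases)
    case 1
    then show ?thesis
      using signedA_less[of True y] valid by (simp add: tupleA_def weightA_def)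
  next
    case 2
    then show ?thesis using tupleA_1 by simp
  next
    case (3 a J)
    have "consA A N d a y J \<le> bet + bet"
      using tdig_less[OF assms(2), of 0] bet_pos
      by (auto simp: consA_def betA of_bool_def intro: add_mono)
    with 3 show ?thesis
      using tupleA_coord[OF valid 3(1,2)] bet_le_off(2) by simp
  qed
qed (simp add: tupleA_def)

lemma item_cases:
  fixes z :: nat
  obtains "z < 2" | y where "z = 2 + y" "y < bet ^ (2 * q)" | b where "z = 2 + bet ^ (2 * q) + b"
proof -
  consider "z < 2" | "2 \<le> z" "z < 2 + bet ^ (2 * q)" | "2 + bet ^ (2 * q) \<le> z" by linarith
  then show thesis
  proof cases
    case 2
    then have "z = 2 + (z - 2)" "z - 2 < bet ^ (2 * q)" by linarith+
    then show ?thesis by (rule that(2))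
  next
    case 3
    then have "z = 2 + bet ^ (2 * q) + (z - (2 + bet ^ (2 * q)))" by linarith
    then show ?thesis by (rule that(3))
  qed (rule that(1))
qed

sublocale ig: item_graph X m H "contribA A N d" "targetA A N d"
proof
  show "2 \<le> X" by (simp add: items_eq)
  show "1 \<le> m" by (simp add: coords_eq)
  show H: "2 \<le> H" using bet_le_off(2) bet_pos by linarith
  show null: "contribA A N d 0 c = 0" "contribA A N d (Suc 0) c = 0" for c
    by (simp_all add: contribA_def)
  show "contribA A N d x c = 0" if "x < X" "contribA A N d x 0 = 0" for x c
  proof (cases x rule: item_cases)
    case 1
    then show ?thesis by (simp add: contribA_def)
  next
    case (2 y)
    then show ?thesis
      using that(2) weightA_pos[of y] unfolding 2(1) contrib_tuple[OF 2(2)] by (auto simp: tupleA_def split: if_splits)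
  next
    case (3 b)
    then have "b < bet ^ q" using that(1) unfolding items_eq by linarith
    then show ?thesis
      using that(2) unfolding 3 contrib_guess by (auto simp: guessA split: if_splits)
  qed
  show "contribA A N d x c \<le> H" if "x < X" "c < m" for x c
  proof (cases x rule: item_cases)
    case 1
    then show ?thesis by (simp add: contribA_def)
  next
    case (2 y)
    then show ?thesis using tupleA_le[OF that(2) 2(2)] unfolding 2(1) contrib_tuple[OF 2(2)] by simp
  next
    case (3 b)
    have "guessA A N d b c \<le> bet ^ q"
      using bet_q_pos[of q] by (simp add: guessA Suc_le_eq)
    then show ?thesis using bet_le_off(1) unfolding 3 contrib_guess by linarith
  qed
  show "1 \<le> targetA A N d c" if "c < m" for c
    using that
  proof (cases c rule: coord_cases)
    case 1
    then show ?thesis using Phi_less_q[of "{}"] targetA_0 by simp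
  next
    case 2
    then show ?thesis by (simp add: targetA_def)
  next
    case (3 a J)
    then show ?thesis using bet_pos by (simp only: targetA_coord) simp
  qed
qed

lemma sum_items:
  assumes Y: "Y \<subseteq> {..<bet ^ (2 * q)}" and Z: "Z \<subseteq> {..<bet ^ q}"
  shows "(\<Sum>x\<in>(+) 2 ` Y \<union> (+) (2 + bet ^ (2 * q)) ` Z. contribA A N d x c) =
    (\<Sum>y\<in>Y. tupleA A N d y c) + (\<Sum>b\<in>Z. guessA A N d b c)"
proof -
  have fin: "finite Y" "finite Z"
    using Y Z by (auto intro: finite_subset)
  have disj: "(+) 2 ` Y \<inter> (+) (2 + bet ^ (2 * q)) ` Z = {}"
    using Y by fastforce
  have "(\<Sum>y\<in>Y. contribA A N d (2 + y) c) = (\<Sum>y\<in>Y. tupleA A N d y c)"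
    by (rule sum.cong) (use Y contrib_tuple in auto)
  moreover have "(\<Sum>b\<in>Z. contribA A N d (2 + bet ^ (2 * q) + b) c) = (\<Sum>b\<in>Z. guessA A N d b c)"
    by (rule sum.cong) (simp_all only: contrib_guess)
  ultimately show ?thesis
    unfolding sum.union_disjoint[OF finite_imageI[OF fin(1)] finite_imageI[OF fin(2)] disj]
    by (simp only: sum.reindex[OF inj_on_add] comp_def)
qed

lemma solution_iff_sums:
  assumes Y: "Y \<subseteq> {y. y < bet ^ (2 * q) \<and> validA A N d y}"
    and Z: "Z \<subseteq> {b. b < bet ^ q \<and> hhA A N (Suc d) out b}"
  shows "solution Y Z \<longleftrightarrow>
    (\<forall>c<m. (\<Sum>y\<in>Y. tupleA A N d y c) + (\<Sum>b\<in>Z. guessA A N d b c) = targetA A N d c)"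
proof -
  have 0: "(\<Sum>y\<in>Y. tupleA A N d y 0) = (\<Sum>y\<in>Y. weightA A N d y)"
    "(\<Sum>b\<in>Z. guessA A N d b 0) = (\<Sum>b\<in>Z. bet ^ q - b)"
    by (rule sum.cong, use Y Z in \<open>auto simp: tupleA_def guessA\<close>)+
  have 1: "(\<Sum>y\<in>Y. tupleA A N d y 1) = 0" "(\<Sum>b\<in>Z. guessA A N d b 1) = card Z"
  proof -
    have "(\<Sum>b\<in>Z. guessA A N d b 1) = (\<Sum>b\<in>Z. 1)"
      by (rule sum.cong) (use Z in \<open>auto simp: guessA\<close>)
    then show "(\<Sum>b\<in>Z. guessA A N d b 1) = card Z" by simp
  qed (simp only: tupleA_1 sum.neutral_const)
  have 2: "(\<Sum>y\<in>Y. tupleA A N d y (2 + (a * k ^ q + J))) = (\<Sum>y\<in>Y. consA A N d a y J)"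
    "(\<Sum>b\<in>Z. guessA A N d b (2 + (a * k ^ q + J))) = 0" if "a \<le> q" "J < k ^ q" for a J
    by (rule sum.cong, use Y tupleA_coord that in auto)[1] (rule sum.neutral, auto simp: guessA)
  have t1: "targetA A N d 1 = 1" by (simp add: targetA_def)
  have less: "0 < m" "1 < m" "a \<le> q \<Longrightarrow> J < k ^ q \<Longrightarrow> 2 + (a * k ^ q + J) < m" for a J
  proof -
    show "0 < m" "1 < m" unfolding coords_eq by simp_all
    assume "a \<le> q" "J < k ^ q"
    then have "a * k ^ q + J < Suc a * k ^ q" by simp
    also have "\<dots> \<le> Suc q * k ^ q" using \<open>a \<le> q\<close> by (intro mult_le_mono1) simp
    finally show "2 + (a * k ^ q + J) < m" unfolding coords_eq by simp
  qed
  show ?thesis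
  proof
    assume sol: "solution Y Z"
    show "\<forall>c<m. (\<Sum>y\<in>Y. tupleA A N d y c) + (\<Sum>b\<in>Z. guessA A N d b c) = targetA A N d c"
    proof (intro allI impI)
      fix c assume "c < m"
      then show "(\<Sum>y\<in>Y. tupleA A N d y c) + (\<Sum>b\<in>Z. guessA A N d b c) = targetA A N d c"
      proof (cases c rule: coord_cases)
        case 1
        then show ?thesis using sol 0 by (simp only: solution_def)
      next
        case 2
        then show ?thesis using sol 1 t1 by (simp only: solution_def)
      next
        case (3 a J)
        then show ?thesis using sol 2[OF 3(1,2)] targetA_coord[OF 3(1,2)] by (simp only: solution_def)
      qed
    qed
  next
    assume *: "\<forall>c<m. (\<Sum>y\<in>Y. tupleA A N d y c) + (\<Sum>b\<in>Z. guessA A N d b c) = targetA A N d c"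
    have "(\<Sum>y\<in>Y. consA A N d a y J) = (if a < q then bet else 1)" if "a \<le> q" "J < k ^ q" for a J
      using *[rule_format, OF less(3)[OF that]] 2[OF that] targetA_coord[OF that] by simp
    then show "solution Y Z"
      unfolding solution_def using Y Z *[rule_format, OF less(1)] *[rule_format, OF less(2)] 0 1 t1 by simp
  qed
qed

lemma fb_yes_iff_satisfiable: "fb_yes ig.inst \<longleftrightarrow> weighted_satisfiable C k"
proof -
  have "(\<exists>P \<subseteq> {x. x < X \<and> contribA A N d x 0 \<noteq> 0}. \<forall>c<m. (\<Sum>x\<in>P. contribA A N d x c) = targetA A N d c) \<longleftrightarrow>
      (\<exists>Y Z. solution Y Z)"
  proof
    assume "\<exists>P \<subseteq> {x. x < X \<and> contribA A N d x 0 \<noteq> 0}. \<forall>c<m. (\<Sum>x\<in>P. contribA A N d x c) = targetA A N d c"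
    then obtain P where P: "P \<subseteq> {x. x < X \<and> contribA A N d x 0 \<noteq> 0}"
      "\<forall>c<m. (\<Sum>x\<in>P. contribA A N d x c) = targetA A N d c"
      by (elim exE conjE)
    \<comment> \<open>A selected item contributes to coordinate \<open>0\<close>, so it is neither
      of the two empty items and splits off as a valid tuple item or an accepted guess.\<close>
    define Y where "Y = {y. y < bet ^ (2 * q) \<and> 2 + y \<in> P}"
    define Z where "Z = {b. 2 + bet ^ (2 * q) + b \<in> P}"
    have Z_less: "b < bet ^ q" if "b \<in> Z" for b
      using that P(1) unfolding Z_def items_eq by force
    have Y: "Y \<subseteq> {y. y < bet ^ (2 * q) \<and> validA A N d y}"
    proof
      fix y assume "y \<in> Y"
      then have y: "y < bet ^ (2 * q)" "contribA A N d (2 + y) 0 \<noteq> 0" using P(1) by (auto simp: Y_def)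
      then show "y \<in> {y. y < bet ^ (2 * q) \<and> validA A N d y}"
        unfolding contrib_tuple[OF y(1)] by (auto simp: tupleA_def split: if_splits)
    qed
    have Z: "Z \<subseteq> {b. b < bet ^ q \<and> hhA A N (Suc d) out b}"
    proof
      fix b assume b: "b \<in> Z"
      then have "contribA A N d (2 + bet ^ (2 * q) + b) 0 \<noteq> 0" using P(1) by (auto simp: Z_def)
      then show "b \<in> {b. b < bet ^ q \<and> hhA A N (Suc d) out b}"
        unfolding contrib_guess using Z_less[OF b] by (auto simp: guessA split: if_splits)
    qed
    have "P = (+) 2 ` Y \<union> (+) (2 + bet ^ (2 * q)) ` Z"
    proof (intro equalityI subsetI)
      fix x assume x: "x \<in> P"
      show "x \<in> (+) 2 ` Y \<union> (+) (2 + bet ^ (2 * q)) ` Z"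
      proof (cases x rule: item_cases)
        case 1
        then show ?thesis using x P(1) by (auto simp: contribA_def)
      next
        case (2 y)
        then show ?thesis using x by (auto simp: Y_def)
      next
        case (3 b)
        then have "b \<in> Z" using x by (simp add: Z_def)
        then show ?thesis using 3 by blast
      qed
    next
      fix x assume "x \<in> (+) 2 ` Y \<union> (+) (2 + bet ^ (2 * q)) ` Z"
      then show "x \<in> P" by (auto simp: Y_def Z_def)
    qed
    then have "solution Y Z"
      using P(2) sum_items[of Y Z] Y Z_less unfolding solution_iff_sums[OF Y Z] by (simp add: subset_iff)
    then show "\<exists>Y Z. solution Y Z" by blast
  next
    assume "\<exists>Y Z. solution Y Z"
    then obtain Y Z where sol: "solution Y Z" by blast
    then have Y: "Y \<subseteq> {y. y < bet ^ (2 * q) \<and> validA A N d y}"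
      and Z: "Z \<subseteq> {b. b < bet ^ q \<and> hhA A N (Suc d) out b}"
      unfolding solution_def by blast+
    define P where "P = (+) 2 ` Y \<union> (+) (2 + bet ^ (2 * q)) ` Z"
    have "x < X \<and> contribA A N d x 0 \<noteq> 0" if xP: "x \<in> P" for x
    proof -
      consider y where "y \<in> Y" "x = 2 + y" | b where "b \<in> Z" "x = 2 + bet ^ (2 * q) + b"
        using xP unfolding P_def by blast
      then show ?thesis
      proof cases
        case 1
        then have y: "y < bet ^ (2 * q)" "validA A N d y" using Y by auto
        then show ?thesis
          unfolding 1(2) contrib_tuple[OF y(1)] items_eq using weightA_pos[of y] by (simp add: tupleA_def)
      next
        case 2
        then have b: "b < bet ^ q" "hhA A N (Suc d) out b" using Z by auto
        then show ?thesis
          unfolding 2(2) contrib_guess items_eq by (simp add: guessA)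
      qed
    qed
    moreover have "\<forall>c<m. (\<Sum>x\<in>P. contribA A N d x c) = targetA A N d c"
      using sol sum_items[of Y Z] Y Z unfolding solution_iff_sums[OF Y Z] P_def by (simp add: subset_iff)
    ultimately show "\<exists>P \<subseteq> {x. x < X \<and> contribA A N d x 0 \<noteq> 0}. \<forall>c<m. (\<Sum>x\<in>P. contribA A N d x c) = targetA A N d c"
      by (intro exI[of _ P] conjI subsetI) simp_all
  qed
  then show ?thesis
    by (simp only: ig.fb_yes_inst solution_iff)
qed

end

section \<open>Emitting the instance\<close>

lemma concat_guard:
  assumes "j \<le> N"
  shows "concat (map (\<lambda>i. if i < j then f i else []) [0..<N]) = concat (map f [0..<j])"
proof -
  have "[0..<N] = [0..<j] @ [j..<N]"
    using upt_add_eq_append[of 0 j "N - j"] assms by simp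
  moreover have "concat (map (\<lambda>i. if i < j then f i else []) [j..<N]) = []"
    by simp
  moreover have "map (\<lambda>i. if i < j then f i else []) [0..<j] = map f [0..<j]"
    by (rule map_cong) auto
  ultimately show ?thesis by (simp only: map_append concat_append append_Nil2)
qed

lemma emits_loop:
  assumes F: "emits (Suc n) (\<lambda>A s. F A s (s n))"
    and inv: "\<And>A s x i. F A (s(n := x)) i = F A s i" and c: "cmp n c" and n: "0 < n"
  shows "emits n (\<lambda>A s. concat (map (F A s) [0..<min (s 0) (c A s)]))"
proof -
  have "emits (Suc n) (\<lambda>A s. if s n < min (s 0) (c A s) then F A s (s n) else [])"
    by (intro emits_if emits_Nil F cmpb_less cmp_min cmp_var cmp_weaken[OF c]) (use n in auto)
  from emits_for[where F = "\<lambda>A s i. if i < min (s 0) (c A s) then F A s i else []", OF this] inv c n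
  have "emits n (\<lambda>A s. concat (map (\<lambda>i. if i < min (s 0) (c A s) then F A s i else []) [0..<s 0]))"
    by (simp cong: if_cong)
  then show ?thesis
    by (simp only: concat_guard[OF min.cobounded1])
qed

text \<open>A number has a bit at position \<open>i\<close> exactly if \<open>2 ^ i\<close> does not
  exceed it, so a loop over all \<open>i < N\<close> can emit the bits without knowing how many
  there are.\<close>

definition encA :: "nat \<Rightarrow> nat \<Rightarrow> nat list" where
  "encA N t = concat (map (\<lambda>i. if pow2 N i \<le> t then [2, Suc (modA N (divA N t (pow2 N i)) 2)] else [])
     [0..<N]) @ [1]"

lemma emits_encA:
  assumes t: "cmp n t" and n: "0 < n"
  shows "emits n (\<lambda>A s. encA (s 0) (t A s))"
proof -
  have t': "cmp (Suc n) t" by (rule cmp_weaken[OF t]) simp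
  have pair: "emits (Suc n) (\<lambda>A s. [2, Suc (modA (s 0) (divA (s 0) (t A s) (pow2 (s 0) (s n))) 2)])"
    using emits_append[OF emits_single[OF cmp_const[of "Suc n" 2]]
        emits_single[OF cmp_Suc[OF cmp_modA[OF cmp_divA[OF t' cmp_pow2[OF cmp_var]] cmp_const]]]]
    by simp
  have "emits (Suc n) (\<lambda>A s. if pow2 (s 0) (s n) \<le> t A s
      then [2, Suc (modA (s 0) (divA (s 0) (t A s) (pow2 (s 0) (s n))) 2)] else [])"
    by (intro emits_if emits_Nil pair cmpb_le t' cmp_pow2 cmp_var) auto
  from emits_for[where F = "\<lambda>A s i. if pow2 (s 0) i \<le> t A s
      then [2, Suc (modA (s 0) (divA (s 0) (t A s) (pow2 (s 0) i)) 2)] else []", OF this]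
  have "emits n (\<lambda>A s. concat (map (\<lambda>i. if pow2 (s 0) i \<le> t A s
      then [2, Suc (modA (s 0) (divA (s 0) (t A s) (pow2 (s 0) i)) 2)] else []) [0..<s 0]))"
    using t n by (simp cong: if_cong)
  from emits_append[OF this emits_single[OF cmp_const]] show ?thesis
    unfolding encA_def .
qed

lemma bits_less: "i < length (bits n) \<longleftrightarrow> 2 ^ i \<le> n"
proof (induction n arbitrary: i rule: bits.induct)
  case (1 n)
  show ?case
  proof (cases "n = 0")
    case True
    then show ?thesis by (simp add: bits.simps)
  next
    case False
    then have b: "bits n = odd n # bits (n div 2)" by (simp add: bits.simps)
    show ?thesis
    proof (cases i)
      case (Suc j)
      have "2 ^ j \<le> n div 2 \<longleftrightarrow> 2 ^ Suc j \<le> n"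
        by (simp add: less_eq_div_iff_mult_less_eq mult.commute)
      then show ?thesis using 1[OF False, of j] by (simp add: b Suc)
    qed (use False b in simp)
  qed
qed

lemma nth_bits: "i < length (bits n) \<Longrightarrow> bits n ! i \<longleftrightarrow> odd (n div 2 ^ i)"
proof (induction n arbitrary: i rule: bits.induct)
  case (1 n)
  show ?case
  proof (cases "n = 0")
    case True
    with 1(2) show ?thesis by (simp add: bits.simps)
  next
    case False
    then have b: "bits n = odd n # bits (n div 2)" by (simp add: bits.simps)
    with 1(1)[OF False, of "i - 1"] 1(2) show ?thesis
      by (cases i) (simp_all add: div_mult2_eq)
  qed
qed

lemma encA:
  assumes "t < N"
  shows "encA N t = map letter_code (encode_nat t)"
proof -
  let ?l = "length (bits t)"
  have l: "?l \<le> N"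
  proof (rule ccontr)
    assume "\<not> ?l \<le> N"
    then have "2 ^ N \<le> t" using bits_less[of N t] by simp
    moreover have "N < 2 ^ N" by (rule less_exp)
    ultimately show False using assms by simp
  qed
  have e: "(if pow2 N i \<le> t then [2, Suc (modA N (divA N t (pow2 N i)) 2)] else []) =
      (if i < ?l then [2, letter_code (bits t ! i)] else [])" if "i < N" for i
  proof -
    have "t div 2 ^ i < N" using div_le_dividend[of t "2 ^ i"] assms by linarith
    then have "modA N (divA N t (2 ^ i)) 2 = t div 2 ^ i mod 2"
      using assms by (simp add: divA modA)
    then show ?thesis
      using that bits_less[of i t] nth_bits[of i t] by (simp add: pow2 letter_code_def odd_iff_mod_2_eq_one)
  qed
  have "map (\<lambda>i. if pow2 N i \<le> t then [2, Suc (modA N (divA N t (pow2 N i)) 2)] else []) [0..<N] =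
      map (\<lambda>i. if i < ?l then [2, letter_code (bits t ! i)] else []) [0..<N]"
    by (rule map_cong) (use e in auto)
  then have "encA N t = concat (map (\<lambda>i. if i < ?l then [2, letter_code (bits t ! i)] else []) [0..<N]) @ [1]"
    by (simp only: encA_def)
  also have "\<dots> = concat (map (\<lambda>i. [2, letter_code (bits t ! i)]) [0..<?l]) @ [1]"
    by (simp only: concat_guard[OF l])
  also have "map (\<lambda>i. [2, letter_code (bits t ! i)]) [0..<?l] = map (\<lambda>b. [2, letter_code b]) (bits t)"
    by (rule nth_equalityI) simp_all
  also have "concat \<dots> @ [1] = map letter_code (encode_nat t)"
    by (simp add: encode_nat_def map_concat comp_def letter_code_def)
  finally show ?thesis .
qed

text \<open>The factor \<open>8\<close> ensures that the number of vertices, which is the first number of the output,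
  has three trailing zero bits. This fixes the first six letters of the output.\<close>

definition heightA :: "(nat \<Rightarrow> nat) \<Rightarrow> nat \<Rightarrow> nat \<Rightarrow> nat" where
  "heightA A N d = 8 * offA A N d"

definition widthA :: "(nat \<Rightarrow> nat) \<Rightarrow> nat \<Rightarrow> nat \<Rightarrow> nat" where
  "widthA A N d = min N (coordsA A N d) * heightA A N d"

definition verticesA ::
  "(nat \<Rightarrow> nat) \<Rightarrow> nat \<Rightarrow> nat \<Rightarrow> (nat \<Rightarrow> nat \<Rightarrow> nat \<Rightarrow> nat list) \<Rightarrow> nat list" where
  "verticesA A N d F = concat (map (\<lambda>x. concat (map (\<lambda>c. concat (map (\<lambda>h. F x c h)
     [0..<min N (heightA A N d)])) [0..<min N (coordsA A N d)])) [0..<min N (itemsA A N d)])"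

definition color_outA :: "(nat \<Rightarrow> nat) \<Rightarrow> nat \<Rightarrow> nat \<Rightarrow> nat \<Rightarrow> nat \<Rightarrow> nat \<Rightarrow> nat list" where
  "color_outA A N d x c h = encA N (if h < contribA A N d x c then Suc c else Suc (coordsA A N d))"

definition edge_outA :: "(nat \<Rightarrow> nat) \<Rightarrow> nat \<Rightarrow> nat \<Rightarrow> nat \<Rightarrow> nat \<Rightarrow> nat \<Rightarrow> nat list" where
  "edge_outA A N d x c h = (if min N c * heightA A N d + h = 0 then [] else
     encA N (if h < contribA A N d x c then min N x * widthA A N d else 0) @
     encA N (min N x * widthA A N d + (min N c * heightA A N d + h)))"

text \<open>The isolated \<open>encA N 0\<close> is the cut size and \<open>encA N 1\<close> the
  target of the junk colour. The final \<open>0\<close> is the blank that ends the word, in a memory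
  that need not be blank.\<close>

definition fbA :: "(nat \<Rightarrow> nat) \<Rightarrow> nat \<Rightarrow> nat \<Rightarrow> nat list" where
  "fbA A N d = encA N (min N (itemsA A N d) * widthA A N d) @ encA N 0 @
     verticesA A N d (color_outA A N d) @
     concat (map (\<lambda>c. encA N (targetA A N d c)) [0..<min N (coordsA A N d)]) @ encA N 1 @
     verticesA A N d (edge_outA A N d) @ [0]"

lemma emits_fbA: "emits 1 (\<lambda>A s. fbA A (s 0) d)"
proof -
  have h: "0 < n \<Longrightarrow> cmp n (\<lambda>A s. heightA A (s 0) d)" for n
    unfolding heightA_def by (intro cmp_cmult cmp_offA)
  have w: "0 < n \<Longrightarrow> cmp n (\<lambda>A s. widthA A (s 0) d)" for n
    unfolding widthA_def by (intro cmp_mult cmp_coordsA h)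
  have v: "emits 1 (\<lambda>A s. verticesA A (s 0) d (F A (s 0)))"
    if F: "emits (Suc (Suc (Suc 1))) (\<lambda>A s. F A (s 0) (s 1) (s (Suc 1)) (s (Suc (Suc 1))))" for F
    unfolding verticesA_def
    by (rule emits_loop cmp_itemsA cmp_coordsA h F | (simp; fail))+
  have c: "emits (Suc (Suc (Suc 1))) (\<lambda>A s. color_outA A (s 0) d (s 1) (s (Suc 1)) (s (Suc (Suc 1))))"
    unfolding color_outA_def
    by (rule emits_encA cmp_if cmpb_less cmp_contribA cmp_Suc cmp_coordsA cmp_var | (simp; fail))+
  have e: "emits (Suc (Suc (Suc 1))) (\<lambda>A s. edge_outA A (s 0) d (s 1) (s (Suc 1)) (s (Suc (Suc 1))))"
    unfolding edge_outA_def
    by (rule emits_if emits_Nil emits_append emits_encA cmp_if cmpb_less cmpb_eq cmp_contribA cmp_mult cmp_add w h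
        cmp_const cmp_var | (simp; fail))+
  show ?thesis
    unfolding fbA_def
    by (rule emits_append emits_loop emits_encA emits_single v[of "\<lambda>A N. color_outA A N d", OF c]
        v[of "\<lambda>A N. edge_outA A N d", OF e] cmp_mult w cmp_itemsA cmp_coordsA cmp_targetA cmp_const cmp_var |
        (simp; fail))+
qed

lemma code_nats:
  "(\<And>t. t \<in> set ts \<Longrightarrow> t < N) \<Longrightarrow> map letter_code (encode_nats ts) = concat (map (encA N) ts)"
  by (induction ts) (simp_all add: encode_nats_def encA)

lemma concat_map_filter: "concat (map f (filter P xs)) = concat (map (\<lambda>x. if P x then f x else []) xs)"
  by (induction xs) simp_all

lemma concat_map_concat: "concat (map f (concat (map g xs))) = concat (map (\<lambda>x. concat (map f (g x))) xs)"
  by (induction xs) simp_all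

lemma take_code:
  assumes "8 dvd n" "0 < n"
  shows "take 6 (map letter_code (encode_nat n) @ r) = [2, 1, 2, 1, 2, 1]"
proof -
  obtain l where n: "n = 8 * l" "0 < l" using assms by auto
  have "bits n = False # bits (4 * l)" using n by (subst bits.simps) simp
  moreover have "bits (4 * l) = False # bits (2 * l)" using n by (subst bits.simps) simp
  moreover have "bits (2 * l) = False # bits l" using n by (subst bits.simps) simp
  ultimately show ?thesis by (simp add: encode_nat_def letter_code_def)
qed

section \<open>The emitted word encodes the instance\<close>

context reduction
begin

text \<open>Vertices are numbered lexicographically by item, coordinate and height, so the three
  nested loops visit them in increasing order; below \<open>N\<close> none of the minima cuts a loop
  short.\<close>

lemma vertices:
  assumes nv: "X * (m * H) < N"
    and F: "\<And>x c h. x < X \<Longrightarrow> c < m \<Longrightarrow> h < H \<Longrightarrow> F x c h = G (x * (m * H) + (c * H + h))"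
  shows "verticesA A N d F = concat (map G [0..<X * (m * H)])"
proof -
  have X: "0 < X" "0 < m" "0 < H" using ig.X ig.m ig.H by linarith+
  have "H \<le> m * H" "m \<le> m * H" "m * H \<le> X * (m * H)" "X \<le> X * (m * H)"
    using X by simp_all
  then have min: "min N X = X" "min N m = m" "min N H = H"
    using nv by linarith+
  have "concat (map G [0..<X * (m * H)]) =
      concat (map (\<lambda>x. concat (map (\<lambda>c. concat (map (\<lambda>h. G (x * (m * H) + (c * H + h))) [0..<H])) [0..<m])) [0..<X])"
    by (simp only: upt_mult[of _ X "m * H"] upt_mult[of _ m H])
  also have "\<dots> = concat (map (\<lambda>x. concat (map (\<lambda>c. concat (map (\<lambda>h. F x c h) [0..<H])) [0..<m])) [0..<X])"
    by (intro arg_cong[of _ _ concat] map_cong refl) (simp add: F)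
  finally show ?thesis
    unfolding verticesA_def heightA_def min by (rule sym)
qed

lemma fbA:
  assumes nv: "X * (m * H) < N"
  shows "fbA A N d = map letter_code (encode_fb ig.inst) @ [0]"
proof -
  have X: "0 < X" "2 \<le> X" "0 < m" "0 < H" "2 \<le> H" using ig.X ig.m ig.H by linarith+
  have le: "H \<le> m * H" "m \<le> m * H" "m * H \<le> X * (m * H)" "X \<le> X * (m * H)" "2 * m \<le> m * H"
    using X by simp_all
  then have min: "min N X = X" "min N m = m" "min N H = H"
    using nv by linarith+
  have W: "ig.W = m * H" by (rule ig.W_def)
  have width: "widthA A N d = ig.W" "heightA A N d = H"
    by (simp_all add: widthA_def heightA_def min W)
  have mN: "Suc m < N" using le X nv by linarith
  have col: "ig.col v < N" if "v < X * (m * H)" for v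
    using ig.col_range[of v] that mN unfolding W by simp
  have tgt: "targetA A N d c < N" if "c < m" for c
    using that
  proof (cases c rule: coord_cases)
    case 1
    \<comment> \<open>\<open>m\<close> exceeds \<open>k ^ q\<close> by at least \<open>2\<close>:
      the offsets fit into \<open>(m - 2) * H\<close>, and one further \<open>H\<close> has room for
      \<open>bet ^ q\<close>.\<close>
    have "bet ^ q \<le> H" using bet_le_off(1) by simp
    moreover have "k ^ q \<le> m - 2" unfolding coords_eq by simp
    then have "k ^ q * offA A N d \<le> (m - 2) * H" by (intro mult_le_mono) simp_all
    moreover have "(m - 2) * H + H \<le> m * H"
      using mult_le_mono1[of "Suc (m - 2)" m H] coords_eq by simp
    ultimately show ?thesis
      unfolding 1 targetA_0 using le(3) nv by linarith
  next
    case 2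
    then show ?thesis using mN X(3) by (simp add: targetA_def)
  next
    case (3 a J)
    have "bet \<le> H" using bet_le_off(2) by simp
    then have "bet < N" "1 < N" using le(1,3) nv mN X(3) by linarith+
    then show ?thesis unfolding 3(3) targetA_coord[OF 3(1,2)] by simp
  qed
  have colors: "verticesA A N d (color_outA A N d) = map letter_code (encode_nats (map ig.col [0..<X * ig.W]))"
  proof -
    have "verticesA A N d (color_outA A N d) = concat (map (\<lambda>v. encA N (ig.col v)) [0..<X * (m * H)])"
      by (rule vertices[OF nv]) (simp add: color_outA_def ig.col_vert[unfolded W])
    also have "\<dots> = map letter_code (encode_nats (map ig.col [0..<X * (m * H)]))"
      using col by (subst code_nats[of _ N]) (auto simp: comp_def)
    finally show ?thesis by (simp only: W)
  qed
  have targets: "concat (map (\<lambda>c. encA N (targetA A N d c)) [0..<m]) @ encA N 1 =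
      map letter_code (encode_nats (map (\<lambda>i. if i \<le> m then targetA A N d (i - 1) else 1) [1..<Suc (Suc m)]))"
  proof -
    have "map (\<lambda>i. if i \<le> m then targetA A N d (i - 1) else 1) [1..<Suc (Suc m)] =
        map (targetA A N d) [0..<m] @ [1]"
    proof -
      have "[1..<Suc (Suc m)] = map Suc [0..<Suc m]"
        by (simp only: map_Suc_upt One_nat_def)
      then show ?thesis by (simp add: comp_def)
    qed
    then show ?thesis
      using tgt mN by (simp only: code_nats[of _ N] encode_nats_def) (subst code_nats[of _ N, unfolded encode_nats_def], auto simp: comp_def)
  qed
  have edges: "verticesA A N d (edge_outA A N d) =
      map letter_code (encode_nats (concat (map (\<lambda>(u, v). [u, v]) ig.edge_list)))"
  proof -
    let ?G = "\<lambda>v. if v mod ig.W \<noteq> 0 then encA N (ig.par v) @ encA N v else []"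
    have "verticesA A N d (edge_outA A N d) = concat (map ?G [0..<X * (m * H)])"
    proof (rule vertices[OF nv])
      fix x c h assume a: "x < X" "c < m" "h < H"
      have "min N x = x" "min N c = c" using a le nv by linarith+
      moreover have "ig.par (x * ig.W + (c * H + h)) = (if h < contribA A N d x c then x * ig.W else 0)"
        using ig.col_vert[OF a(2,3), of x] ig.vert_div(1)[OF a(2,3), of x] a(2) unfolding ig.par_def by simp
      ultimately show "edge_outA A N d x c h = ?G (x * (m * H) + (c * H + h))"
        unfolding W[symmetric] edge_outA_def width ig.vert_div(2)[OF a(2,3)] by simp
    qed
    also have "\<dots> = concat (map (encA N) (concat (map (\<lambda>(u, v). [u, v]) ig.edge_list)))"
      unfolding ig.edge_list_def concat_map_concat map_map comp_def W[symmetric]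
      by (simp add: concat_map_filter)
    also have "\<dots> = map letter_code (encode_nats (concat (map (\<lambda>(u, v). [u, v]) ig.edge_list)))"
    proof (rule code_nats[symmetric])
      fix t assume "t \<in> set (concat (map (\<lambda>(u, v). [u, v]) ig.edge_list))"
      then obtain u v where uv: "(u, v) \<in> set ig.edge_list" "t = u \<or> t = v" by auto
      then have "v < X * (m * H)" "v mod ig.W \<noteq> 0" "u = ig.par v" by (simp_all add: ig.edge_listD W)
      then show "t < N" using ig.par_less[of v] uv(2) nv by auto
    qed
    finally show ?thesis .
  qed
  have "fbA A N d = map letter_code (encode_nat (X * ig.W)) @ map letter_code (encode_nat 0) @
      map letter_code (encode_nats (map ig.col [0..<X * ig.W])) @
      map letter_code (encode_nats (map (\<lambda>i. if i \<le> m then targetA A N d (i - 1) else 1) [1..<Suc (Suc m)])) @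
      map letter_code (encode_nats (concat (map (\<lambda>(u, v). [u, v]) ig.edge_list))) @ [0]"
    unfolding fbA_def colors edges targets[symmetric] width min
    using nv by (simp add: encA W)
  then show ?thesis
    by (simp add: encode_fb_def ig.inst_def encode_nats_def del: upt_Suc)
qed

lemma take_fbA:
  assumes nv: "X * (m * H) < N"
  shows "take 6 (fbA A N d) = [2, 1, 2, 1, 2, 1]"
proof -
  have "8 dvd X * ig.W" by (simp add: ig.W_def)
  moreover have "0 < X * ig.W" using ig.X ig.W_pos by simp
  ultimately show ?thesis
    unfolding fbA[OF nv] by (simp add: encode_fb_def ig.inst_def encode_nats_def take_code del: take_append)
qed

end

section \<open>Hardness\<close>

text \<open>For \<open>b \<ge> 2\<close> both the constant factor and the passage from
  \<open>b\<close> to \<open>b + 1\<close> are absorbed by a larger exponent, which does not depend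
  on \<open>b\<close>.\<close>

lemma exponent_exists:
  assumes "poly_bd f"
  obtains e where "\<And>b. 2 \<le> b \<Longrightarrow> f b < b ^ Suc e"
proof -
  obtain c where c: "\<And>N. f N \<le> c * (N + 1) ^ c"
    using assms unfolding poly_bd_def by blast
  have "f b < b ^ Suc (c + 2 * c)" if b: "2 \<le> b" for b
  proof -
    have "b + 1 \<le> 2 * b" using b by simp
    also have "\<dots> \<le> b * b" using b by (rule mult_le_mono1)
    finally have "(b + 1) ^ c \<le> (b ^ 2) ^ c" by (intro power_mono) (simp_all add: power2_eq_square)
    moreover have "c \<le> b ^ c"
      using less_exp[of c] power_mono[OF b, of c] by linarith
    ultimately have "c * (b + 1) ^ c \<le> b ^ c * (b ^ 2) ^ c"
      by (intro mult_le_mono)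
    also have "\<dots> = b ^ (c + 2 * c)" by (simp only: power_add power_mult)
    also have "\<dots> < b ^ Suc (c + 2 * c)" using b by (intro power_strict_increasing) auto
    finally show ?thesis using c[of b] by linarith
  qed
  then show thesis by (rule that)
qed

text \<open>The first gate has no predecessors, so it is an input gate. Its code is the number
  \<open>0\<close>, whose encoding is the single letter \<open>False\<close>: the letter that the
  relocation takes for granted.\<close>

lemma circuit_first:
  assumes "circuit C"
  shows "encode_circuit C \<noteq> []" "\<not> hd (encode_circuit C)"
proof -
  have "C \<noteq> []" using assms by (simp add: circuit_def)
  then obtain g D where C: "C = g # D" by (cases C) auto
  have "(\<forall>j\<in>set (preds (C ! 0)). j < 0) \<and> (case C ! 0 of Input \<Rightarrow> True | Neg j \<Rightarrow> True
         | Conj js \<Rightarrow> length js \<ge> 2 | Disj js \<Rightarrow> length js \<ge> 2)"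
    using assms C unfolding circuit_def by auto
  then have "g = Input" unfolding C by (cases g) auto
  then show "encode_circuit C \<noteq> []" "\<not> hd (encode_circuit C)"
    by (simp_all add: C encode_circuit_def encode_nats_def encode_nat_def bits.simps[of 0])
qed

theorem reduction_program:
  obtains p r where "\<And>C k s. circuit C \<Longrightarrow> weft_at_most 1 C \<Longrightarrow> depth_at_most d C \<Longrightarrow>
    is_output s (encode_circuit C) k \<Longrightarrow>
    wp p (\<lambda>s' t. t \<le> ((k + 2) * (length (encode_circuit C) + 1)) ^ r \<and>
      (\<exists>I. is_output s' (encode_fb I) (ncolors I) \<and> fb_valid I \<and> cut_size I = 0 \<and> ncolors I \<le> (k + 2) ^ r \<and>
        (fb_yes I \<longleftrightarrow> weighted_satisfiable C k))) s 0"
proof -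
  define q where "q = qq d"
  \<comment> \<open>An upper bound for the number of vertices, with \<open>k\<close> replaced by the
    larger \<open>b\<close>. The exponent \<open>e\<close> is chosen so that the loop bound
    \<open>b ^ Suc e\<close> exceeds it.\<close>
  let ?f = "\<lambda>b. (2 + b ^ (2 * q) + b ^ q) * ((2 + Suc q * b ^ q) * (8 * (q * 2 ^ q * b ^ q)))"
  have "poly_bd ?f" by (intro poly_bd_intros)
  then obtain e where e: "\<And>b. 2 \<le> b \<Longrightarrow> ?f b < b ^ Suc e"
    using exponent_exists by blast
  have g: "cmp 1 (\<lambda>A s. Suc (coordsA A (s 0) d))"
    by (intro cmp_Suc cmp_coordsA) simp_all
  obtain p T where T: "poly_bd T" and p: "\<And>s x k. is_output s x k \<Longrightarrow> x \<noteq> [] \<Longrightarrow> \<not> hd x \<Longrightarrow>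
    wp p (\<lambda>s' t'. t' \<le> T ((k + length x + 2) ^ Suc e) \<and> (\<exists>A. word_array x k A \<and>
      (let N = (k + length x + 2) ^ Suc e; L = fbA A N d in
        take 6 L = [2, 1, 2, 1, 2, 1] \<longrightarrow> s' 0 = Suc (coordsA A N d) \<and> (\<forall>i<length L. s' (Suc i) = L ! i)))) s 0"
    by (rule emitting_program[OF emits_fbA[of d] g, of e]) (rule that; assumption)
  obtain e' where e': "\<And>b. 2 \<le> b \<Longrightarrow> T b < b ^ Suc e'"
    using exponent_exists[OF T] by blast
  \<comment> \<open>The first summand is for the running time \<open>T N \<le> N ^ Suc e'\<close>,
    the second for the number \<open>3 + Suc q * k ^ q\<close> of colours.\<close>
  define r where "r = Suc e * Suc e' + (q + 4 + q)"
  show thesis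
  proof (rule that[of p r])
    fix C k s
    assume C: "circuit C" "weft_at_most 1 C" "depth_at_most d C" and s: "is_output s (encode_circuit C) k"
    let ?x = "encode_circuit C"
    define b where "b = k + length ?x + 2"
    define N where "N = b ^ Suc e"
    have b: "2 \<le> b" by (simp add: b_def)
    have fN: "?f b < N" using e[OF b] by (simp add: N_def)
    show "wp p (\<lambda>s' t. t \<le> ((k + 2) * (length ?x + 1)) ^ r \<and>
      (\<exists>I. is_output s' (encode_fb I) (ncolors I) \<and> fb_valid I \<and> cut_size I = 0 \<and> ncolors I \<le> (k + 2) ^ r \<and>
        (fb_yes I \<longleftrightarrow> weighted_satisfiable C k))) s 0"
    proof (rule wp_mono[OF p[OF s circuit_first[OF C(1)]]], elim conjE exE, intro conjI)
      fix s' t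
      assume "t \<le> T ((k + length ?x + 2) ^ Suc e)"
      then have "t \<le> T N" by (simp only: N_def b_def)
      also have "T N \<le> N ^ Suc e'"
      proof (rule less_imp_le[OF e'])
        have "b \<le> b ^ Suc e" by (rule self_le_power) (use b in auto)
        with b show "2 \<le> N" unfolding N_def by linarith
      qed
      also have "N ^ Suc e' = b ^ (Suc e * Suc e')" by (simp only: N_def power_mult)
      also have "\<dots> \<le> ((k + 2) * (length ?x + 1)) ^ (Suc e * Suc e')"
        by (rule power_mono) (simp_all add: b_def)
      also have "\<dots> \<le> ((k + 2) * (length ?x + 1)) ^ r"
        by (rule power_increasing) (simp_all add: r_def)
      finally show "t \<le> ((k + 2) * (length ?x + 1)) ^ r" .
    next
      fix s' A
      assume A: "word_array ?x k A" and L: "let N = (k + length ?x + 2) ^ Suc e; L = fbA A N d in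
        take 6 L = [2, 1, 2, 1, 2, 1] \<longrightarrow> s' 0 = Suc (coordsA A N d) \<and> (\<forall>i<length L. s' (Suc i) = L ! i)"
      have pos: "0 < q" by (simp add: q_def qq_def)
      have "0 < (2 + Suc q * b ^ q) * (8 * (q * 2 ^ q * b ^ q))"
        using b pos by (intro mult_pos_pos) simp_all
      then have "(2 + b ^ (2 * q) + b ^ q) * 1 \<le> ?f b"
        by (intro mult_le_mono2) linarith
      then have "2 + b ^ (2 * q) + b ^ q \<le> ?f b" by (simp only: mult_1_right)
      then have big: "2 + b ^ (2 * q) + b ^ q \<le> N" using fN by linarith
      have "b \<le> N" using self_le_power[of b "Suc e"] b by (simp add: N_def)
      then have len: "length ?x < N" unfolding b_def by linarith
      interpret weft_one C ?x k A N d
      proof unfold_locales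
        have "b ^ q \<le> N" using big by linarith
        then show "(k + length ?x + 2) ^ (2 ^ Suc d) \<le> N" by (simp only: b_def q_def qq_def)
      qed (use A C len in simp_all)
      interpret reduction C ?x k A N d
        by unfold_locales (use big in \<open>simp only: bet_def b_def q_def\<close>)
      have bq: "itemsA A N d = 2 + b ^ (2 * q) + b ^ q" "coordsA A N d = 2 + Suc q * k ^ q"
        "offA A N d = q * 2 ^ q * b ^ q"
        using items_eq coords_eq offA by (simp_all only: bet_def b_def q_def)
      have kb: "k ^ q \<le> b ^ q" by (rule power_mono) (simp_all add: b_def)
      have "itemsA A N d * (coordsA A N d * (8 * offA A N d)) \<le> ?f b"
        unfolding bq using kb by (intro mult_le_mono2 mult_le_mono1 add_left_mono)
      then have nv: "itemsA A N d * (coordsA A N d * (8 * offA A N d)) < N"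
        using fN by linarith
      let ?I = "ig.inst"
      have out: "s' 0 = ncolors ?I" "\<And>i. i < length (fbA A N d) \<Longrightarrow> s' (Suc i) = fbA A N d ! i"
        using L take_fbA[OF nv] unfolding Let_def b_def[symmetric] N_def[symmetric] by (simp_all add: ig.inst_def)
      have "is_output s' (encode_fb ?I) (ncolors ?I)"
        using out unfolding is_output_def fbA[OF nv] by (simp add: nth_append less_Suc_eq)
      moreover have "ncolors ?I \<le> (k + 2) ^ r"
      proof -
        have "1 \<le> (k + 2) ^ q" "k ^ q \<le> (k + 2) ^ q"
          by (simp_all add: power_mono)
        then have "3 + Suc q * k ^ q \<le> 3 * (k + 2) ^ q + Suc q * (k + 2) ^ q"
          by (intro add_mono mult_le_mono2) simp_all
        also have "\<dots> = (q + 4) * (k + 2) ^ q"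
          by (simp add: algebra_simps)
        also have "q + 4 \<le> (k + 2) ^ (q + 4)"
          using less_exp[of "q + 4"] power_mono[of 2 "k + 2" "q + 4"] by linarith
        then have "(q + 4) * (k + 2) ^ q \<le> (k + 2) ^ (q + 4) * (k + 2) ^ q"
          by (rule mult_le_mono1)
        also have "\<dots> \<le> (k + 2) ^ r"
          unfolding power_add[symmetric] by (rule power_increasing) (simp_all add: r_def)
        finally have "Suc (2 + Suc q * k ^ q) \<le> (k + 2) ^ r" by simp
        moreover have "ncolors ?I = Suc (coordsA A N d)"
          by (simp only: ig.inst_def fb_instance.select_convs)
        ultimately show ?thesis unfolding bq(2)[symmetric] by (rule ord_eq_le_trans[rotated])
      qed
      moreover have "fb_valid ?I" "cut_size ?I = 0"
        by (rule ig.fb_valid_inst) (simp add: ig.inst_def)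
      ultimately show "\<exists>I. is_output s' (encode_fb I) (ncolors I) \<and> fb_valid I \<and> cut_size I = 0 \<and>
          ncolors I \<le> (k + 2) ^ r \<and> (fb_yes I \<longleftrightarrow> weighted_satisfiable C k)"
        using fb_yes_iff_satisfiable by blast
    qed
  qed
qed

subsection \<open>Injectivity of the encodings\<close>

lemma encode_nat_append_inj:
  assumes "encode_nat a @ u = encode_nat b @ v"
  shows "a = b \<and> u = v"
proof -
  have *: "concat (map (\<lambda>b. [True, b]) bs) @ False # u = concat (map (\<lambda>b. [True, b]) cs) @ False # v \<Longrightarrow>
      bs = cs \<and> u = v" for bs cs
  proof (induction bs arbitrary: cs)
    case Nil
    then show ?case by (cases cs) auto
  next
    case (Cons b bs)
    then show ?case by (cases cs) auto
  qed
  have "bits a = bits b \<and> u = v"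
    using assms by (intro *) (simp add: encode_nat_def)
  then show ?thesis
    using sum_bits[of a] sum_bits[of b] by metis
qed

lemma encode_nats_inj: "encode_nats ns = encode_nats ms \<Longrightarrow> ns = ms"
proof (induction ns arbitrary: ms)
  case Nil
  then show ?case by (cases ms) (simp_all add: encode_nats_def encode_nat_def)
next
  case (Cons n ns)
  then obtain l ls where ms: "ms = l # ls"
    by (cases ms) (auto simp: encode_nats_def encode_nat_def)
  with Cons.prems have "n = l \<and> encode_nats ns = encode_nats ls"
    by (intro encode_nat_append_inj) (simp add: encode_nats_def)
  with Cons.IH ms show ?case by blast
qed

lemma encode_gate_append_inj: "encode_gate g @ u = encode_gate h @ v \<Longrightarrow> g = h \<and> u = v"
  by (cases g; cases h) auto

text \<open>A word is a yes-instance if some circuit encoded by it is satisfiable; injectivity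
  identifies that circuit with the given one.\<close>

lemma encode_circuit_inj:
  assumes "encode_circuit C = encode_circuit D"
  shows "C = D"
proof -
  have "concat (map encode_gate C) = concat (map encode_gate D) \<Longrightarrow> C = D"
  proof (induction C arbitrary: D)
    case Nil
    have "encode_gate g \<noteq> []" for g by (cases g) auto
    with Nil show ?case by (cases D) auto
  next
    case (Cons g C)
    have "encode_gate g \<noteq> []" by (cases g) auto
    with Cons.prems obtain h D' where D: "D = h # D'"
      by (cases D) auto
    with Cons.prems have "g = h \<and> concat (map encode_gate C) = concat (map encode_gate D')"
      by (intro encode_gate_append_inj) simp
    with Cons.IH D show ?case by blast
  qed
  then show ?thesis
    using assms encode_nats_inj unfolding encode_circuit_def by blast
qed

lemma has_fair_bisection_cong:
  assumes "\<And>v. v \<in> V \<Longrightarrow> \<chi> v = \<chi>' v" "\<And>i. i \<in> {1..c} \<Longrightarrow> r i = r' i"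
  shows "has_fair_bisection V E k c \<chi> r \<longleftrightarrow> has_fair_bisection V E k c \<chi>' r'"
proof -
  have "has_fair_bisection V E k c \<chi>' r'"
    if h: "has_fair_bisection V E k c \<chi> r"
      and e: "\<And>v. v \<in> V \<Longrightarrow> \<chi> v = \<chi>' v" "\<And>i. i \<in> {1..c} \<Longrightarrow> r i = r' i" for \<chi> \<chi>' r r'
  proof -
    from h obtain A B where AB: "edge_cut V A B" "cut_order E A B \<le> k"
      "\<And>i. i \<in> {1..c} \<Longrightarrow> card {v \<in> A. \<chi> v = i} = r i"
      unfolding has_fair_bisection_def by blast
    have "A \<subseteq> V" using AB(1) by (auto simp: edge_cut_def)
    then have "{v \<in> A. \<chi>' v = i} = {v \<in> A. \<chi> v = i}" for i
      using e(1) by auto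
    then show ?thesis
      unfolding has_fair_bisection_def using AB e(2) by (intro exI[of _ A] exI[of _ B]) simp
  qed
  from this[of \<chi> r \<chi>' r'] this[of \<chi>' r' \<chi> r] assms show ?thesis by metis
qed

text \<open>The word records colours and targets on the actual vertices and colours only, so two
  instances with the same word may differ as records. The number of colours has to be supplied by
  the parameter, which also separates the targets from the edges.\<close>

lemma fb_yes_cong:
  assumes "encode_fb I = encode_fb J" "ncolors I = ncolors J"
  shows "fb_yes I \<longleftrightarrow> fb_yes J"
proof -
  have pairs: "concat (map (\<lambda>(u, v). [u, v]) E) = concat (map (\<lambda>(u, v). [u, v]) F) \<Longrightarrow> E = F"
    for E F :: "(nat \<times> nat) list"
  proof (induction E arbitrary: F)
    case Nil
    then show ?case by (cases F) auto
  next
    case (Cons e E)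
    then show ?case by (cases e; cases F) auto
  qed
  have "[nverts I, cut_size I] @ map (color I) [0..<nverts I] @ map (target I) [1..<Suc (ncolors I)] @
      concat (map (\<lambda>(u, v). [u, v]) (edges I)) =
      [nverts J, cut_size J] @ map (color J) [0..<nverts J] @ map (target J) [1..<Suc (ncolors J)] @
      concat (map (\<lambda>(u, v). [u, v]) (edges J))"
    using assms(1) unfolding encode_fb_def by (rule encode_nats_inj)
  then have n: "nverts I = nverts J" "cut_size I = cut_size J"
    and "map (color I) [0..<nverts J] = map (color J) [0..<nverts J]"
    and "map (target I) [1..<Suc (ncolors J)] = map (target J) [1..<Suc (ncolors J)]"
    and "edges I = edges J"
    using assms(2) pairs by (auto simp del: upt_Suc)
  then have eq: "\<And>v. v < nverts J \<Longrightarrow> color I v = color J v" "edges I = edges J"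
    "\<And>i. i \<in> {1..ncolors J} \<Longrightarrow> target I i = target J i"
    by (auto simp del: upt_Suc)
  show ?thesis
    unfolding fb_yes_def n eq(2) assms(2)
    using eq(1,3) by (intro has_fair_bisection_cong) auto
qed

text \<open>All instances produced have cut size \<open>0\<close>, so the same reduction serves
  every class that contains those instances, the restricted and the unrestricted one alike.\<close>

lemma W1_hard_fair_bisection:
  assumes S: "{I. cut_size I = 0} \<subseteq> S"
  shows "W1_hard (fair_bisection S)"
  unfolding W1_hard_def
proof
  fix P
  assume "P \<in> W_class 1"
  then obtain d where P: "fpt_reducible P (weighted_circuit_sat 1 d)"
    by (auto simp: W_class_def)
  obtain p r where p: "\<And>C k s. circuit C \<Longrightarrow> weft_at_most 1 C \<Longrightarrow> depth_at_most d C \<Longrightarrow>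
    is_output s (encode_circuit C) k \<Longrightarrow>
    wp p (\<lambda>s' t. t \<le> ((k + 2) * (length (encode_circuit C) + 1)) ^ r \<and>
      (\<exists>I. is_output s' (encode_fb I) (ncolors I) \<and> fb_valid I \<and> cut_size I = 0 \<and> ncolors I \<le> (k + 2) ^ r \<and>
        (fb_yes I \<longleftrightarrow> weighted_satisfiable C k))) s 0"
    by (rule reduction_program[of d]) blast
  show "fpt_reducible P (fair_bisection S)"
  proof (rule fpt_reducible_trans[OF P])
    fix y k s
    assume "(y, k) \<in> insts (weighted_circuit_sat 1 d)" and s: "is_output s y k"
    then obtain C where C: "y = encode_circuit C" "circuit C" "weft_at_most 1 C" "depth_at_most d C"
      by (auto simp: weighted_circuit_sat_def)
    have yes: "(y, k) \<in> yes (weighted_circuit_sat 1 d) \<longleftrightarrow> weighted_satisfiable C k"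
      using C by (auto simp: weighted_circuit_sat_def dest: encode_circuit_inj)
    show "wp p (\<lambda>s' t. t \<le> ((k + 2) * (length y + 1)) ^ r \<and> (\<exists>z k'. is_output s' z k' \<and>
        (z, k') \<in> insts (fair_bisection S) \<and> k' \<le> (k + 2) ^ r \<and>
        ((y, k) \<in> yes (weighted_circuit_sat 1 d) \<longleftrightarrow> (z, k') \<in> yes (fair_bisection S)))) s 0"
    proof (rule wp_mono[OF p[OF C(2-4) s[unfolded C(1)]]], elim conjE exE, intro conjI)
      fix s' I
      assume I: "is_output s' (encode_fb I) (ncolors I)" "fb_valid I" "cut_size I = 0"
        "ncolors I \<le> (k + 2) ^ r" "fb_yes I \<longleftrightarrow> weighted_satisfiable C k"
      have "I \<in> S" using S I(3) by blast
      then have "(encode_fb I, ncolors I) \<in> insts (fair_bisection S)"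
        using I(2) by (auto simp: fair_bisection_def)
      moreover have "(encode_fb I, ncolors I) \<in> yes (fair_bisection S) \<longleftrightarrow> fb_yes I"
      proof
        assume "(encode_fb I, ncolors I) \<in> yes (fair_bisection S)"
        then obtain J where "encode_fb I = encode_fb J" "ncolors I = ncolors J" "fb_yes J"
          by (auto simp: fair_bisection_def)
        then show "fb_yes I" using fb_yes_cong[of I J] by blast
      next
        assume "fb_yes I"
        then show "(encode_fb I, ncolors I) \<in> yes (fair_bisection S)"
          using I(2) \<open>I \<in> S\<close> unfolding fair_bisection_def by auto
      qed
      ultimately show "\<exists>z k'. is_output s' z k' \<and> (z, k') \<in> insts (fair_bisection S) \<and> k' \<le> (k + 2) ^ r \<and>
          ((y, k) \<in> yes (weighted_circuit_sat 1 d) \<longleftrightarrow> (z, k') \<in> yes (fair_bisection S))"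
        using I yes by blast
    qed (simp add: C(1))
  qed
qed

theorem theorem5p3:
  shows "W1_hard (fair_bisection UNIV) \<and> W1_hard (fair_bisection {I. cut_size I = 0})"
  by (simp add: W1_hard_fair_bisection)

end
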